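(* Let $k$ be a field of characteristic zero and $d\ge 4$ a natural number. Then there exists an affine Poisson $k$-algebra of Krull dimension $d$ such that $(0)$ is Poisson rational but not Poisson locally closed.
   Context: A Poisson $k$-algebra is a commutative $k$-algebra $A$ with a $k$-bilinear Lie bracket $\{-,-\}$ such that $\{-,x\}$ is a derivation for each $x\in A$. Affine means finitely generated over $k$ and an integral domain. A Poisson ideal is an ideal $I$ with $\{I,A\}\subseteq I$; a Poisson prime is a prime Poisson ideal. A Poisson prime $P$ is Poisson locally closed if $\{P\}$ is locally closed in the set of Poisson primes with the relative Zariski topology (equivalently, the intersection of all Poisson primes strictly containing $P$ strictly contains $P$). $P$ is Poisson rational if the Poisson centre $\{z:\{z,-\}\equiv0\}$ of $\operatorname{Frac}(A/P)$ is algebraic over $k$. *)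

theory Defs
  imports "HOL-Algebra.Generated_Rings" "HOL-Algebra.Ideal" "HOL-Algebra.FiniteProduct"
    "HOL-Computational_Algebra.Polynomial"
begin

text \<open>The ground field k is a type of class field_char_0. A k-algebra is a commutative
  HOL-Algebra ring R together with a ring homomorphism iota from k into R (the structure map);
  scalar multiplication by c is multiplication by iota c.\<close>

definition k_algebra :: "('k::field \<Rightarrow> 'a) \<Rightarrow> 'a ring \<Rightarrow> bool" where
  "k_algebra \<iota> R \<longleftrightarrow> cring R \<and> (\<forall>c. \<iota> c \<in> carrier R) \<and>
     (\<forall>c d. \<iota> (c + d) = \<iota> c \<oplus>\<^bsub>R\<^esub> \<iota> d) \<and>
     (\<forall>c d. \<iota> (c * d) = \<iota> c \<otimes>\<^bsub>R\<^esub> \<iota> d) \<and> \<iota> 1 = \<one>\<^bsub>R\<^esub>"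

definition affine_k_algebra :: "('k::field \<Rightarrow> 'a) \<Rightarrow> 'a ring \<Rightarrow> bool" where
  "affine_k_algebra \<iota> R \<longleftrightarrow> k_algebra \<iota> R \<and> domain R \<and>
     (\<exists>S. finite S \<and> S \<subseteq> carrier R \<and> carrier R = generate_ring R (range \<iota> \<union> S))"

definition poisson_bracket :: "('k::field \<Rightarrow> 'a) \<Rightarrow> 'a ring \<Rightarrow> ('a \<Rightarrow> 'a \<Rightarrow> 'a) \<Rightarrow> bool" where
  "poisson_bracket \<iota> R br \<longleftrightarrow>
     (\<forall>x\<in>carrier R. \<forall>y\<in>carrier R. br x y \<in> carrier R) \<and>
     (\<forall>x\<in>carrier R. \<forall>y\<in>carrier R. \<forall>z\<in>carrier R.
         br (x \<oplus>\<^bsub>R\<^esub> y) z = br x z \<oplus>\<^bsub>R\<^esub> br y z \<and>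
         br z (x \<oplus>\<^bsub>R\<^esub> y) = br z x \<oplus>\<^bsub>R\<^esub> br z y) \<and>
     (\<forall>c. \<forall>x\<in>carrier R. \<forall>y\<in>carrier R.
         br (\<iota> c \<otimes>\<^bsub>R\<^esub> x) y = \<iota> c \<otimes>\<^bsub>R\<^esub> br x y \<and>
         br x (\<iota> c \<otimes>\<^bsub>R\<^esub> y) = \<iota> c \<otimes>\<^bsub>R\<^esub> br x y) \<and>
     (\<forall>x\<in>carrier R. br x x = \<zero>\<^bsub>R\<^esub>) \<and>
     (\<forall>x\<in>carrier R. \<forall>y\<in>carrier R. \<forall>z\<in>carrier R.
         br x (br y z) \<oplus>\<^bsub>R\<^esub> br y (br z x) \<oplus>\<^bsub>R\<^esub> br z (br x y) = \<zero>\<^bsub>R\<^esub>) \<and>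
     (\<forall>x\<in>carrier R. \<forall>y\<in>carrier R. \<forall>z\<in>carrier R.
         br (y \<otimes>\<^bsub>R\<^esub> z) x = (y \<otimes>\<^bsub>R\<^esub> br z x) \<oplus>\<^bsub>R\<^esub> (br y x \<otimes>\<^bsub>R\<^esub> z))"

definition affine_poisson_algebra ::
    "('k::field \<Rightarrow> 'a) \<Rightarrow> 'a ring \<Rightarrow> ('a \<Rightarrow> 'a \<Rightarrow> 'a) \<Rightarrow> bool" where
  "affine_poisson_algebra \<iota> R br \<longleftrightarrow> affine_k_algebra \<iota> R \<and> poisson_bracket \<iota> R br"

definition prime_chain :: "'a ring \<Rightarrow> nat \<Rightarrow> (nat \<Rightarrow> 'a set) \<Rightarrow> bool" where
  "prime_chain R n P \<longleftrightarrow> (\<forall>i\<le>n. primeideal (P i) R) \<and> (\<forall>i<n. P i \<subset> P (Suc i))"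

definition krull_dim_eq :: "'a ring \<Rightarrow> nat \<Rightarrow> bool" where
  "krull_dim_eq R d \<longleftrightarrow> (\<exists>P. prime_chain R d P) \<and> \<not> (\<exists>P. prime_chain R (Suc d) P)"

definition poisson_prime :: "'a ring \<Rightarrow> ('a \<Rightarrow> 'a \<Rightarrow> 'a) \<Rightarrow> 'a set \<Rightarrow> bool" where
  "poisson_prime R br P \<longleftrightarrow> primeideal P R \<and> (\<forall>a\<in>P. \<forall>b\<in>carrier R. br a b \<in> P)"

text \<open>Poisson spectrum with the relative Zariski topology: closed sets are
  V(I) = {Q. I \<subseteq> Q}. {P} is locally closed iff it is V(I) minus V(J) for some I, J.\<close>
definition poisson_locally_closed :: "'a ring \<Rightarrow> ('a \<Rightarrow> 'a \<Rightarrow> 'a) \<Rightarrow> 'a set \<Rightarrow> bool" where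
  "poisson_locally_closed R br P \<longleftrightarrow> poisson_prime R br P \<and>
     (\<exists>I J. I \<subseteq> carrier R \<and> J \<subseteq> carrier R \<and>
        {P} = {Q. poisson_prime R br Q \<and> I \<subseteq> Q \<and> \<not> J \<subseteq> Q})"

text \<open>For A a domain, the bracket extends uniquely to Frac(A) by the quotient rule:
  {a/b, c/d} = ({a,c}bd - a{b,c}d - b{a,d}c + a{b,d}c) / (b^2 d^2).
  The fraction a/b (b nonzero) lies in the Poisson centre of Frac(A) iff this numerator
  vanishes for all c, d in A with d nonzero.\<close>
definition frac_poisson_central :: "'a ring \<Rightarrow> ('a \<Rightarrow> 'a \<Rightarrow> 'a) \<Rightarrow> 'a \<Rightarrow> 'a \<Rightarrow> bool" where
  "frac_poisson_central R br a b \<longleftrightarrow>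
     (\<forall>c\<in>carrier R. \<forall>d\<in>carrier R - {\<zero>\<^bsub>R\<^esub>}.
        (br a c \<otimes>\<^bsub>R\<^esub> b \<otimes>\<^bsub>R\<^esub> d) \<ominus>\<^bsub>R\<^esub> (a \<otimes>\<^bsub>R\<^esub> br b c \<otimes>\<^bsub>R\<^esub> d)
        \<ominus>\<^bsub>R\<^esub> (b \<otimes>\<^bsub>R\<^esub> br a d \<otimes>\<^bsub>R\<^esub> c) \<oplus>\<^bsub>R\<^esub> (a \<otimes>\<^bsub>R\<^esub> br b d \<otimes>\<^bsub>R\<^esub> c)
        = \<zero>\<^bsub>R\<^esub>)"

text \<open>The fraction a/b is algebraic over k: some nonzero p in k[t] has p(a/b) = 0,
  i.e. (clearing denominators) sum_i iota(p_i) a^i b^(deg p - i) = 0.\<close>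
definition frac_algebraic :: "('k::field \<Rightarrow> 'a) \<Rightarrow> 'a ring \<Rightarrow> 'a \<Rightarrow> 'a \<Rightarrow> bool" where
  "frac_algebraic \<iota> R a b \<longleftrightarrow>
     (\<exists>p :: 'k poly. p \<noteq> 0 \<and>
        finsum R (\<lambda>i. \<iota> (coeff p i) \<otimes>\<^bsub>R\<^esub> (a [^]\<^bsub>R\<^esub> i) \<otimes>\<^bsub>R\<^esub> (b [^]\<^bsub>R\<^esub> (degree p - i)))
          {..degree p} = \<zero>\<^bsub>R\<^esub>)"

definition zero_poisson_rational :: "('k::field \<Rightarrow> 'a) \<Rightarrow> 'a ring \<Rightarrow> ('a \<Rightarrow> 'a \<Rightarrow> 'a) \<Rightarrow> bool" where
  "zero_poisson_rational \<iota> R br \<longleftrightarrow>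
     (\<forall>a\<in>carrier R. \<forall>b\<in>carrier R - {\<zero>\<^bsub>R\<^esub>}.
        frac_poisson_central R br a b \<longrightarrow> frac_algebraic \<iota> R a b)"

end

theory Submission
  imports Defs "HOL-Computational_Algebra.Computational_Algebra" "HOL-Library.Poly_Mapping"
    "HOL-Library.Countable"
begin

text \<open>The example is a vector field on affine 3-space with coordinates P, M, a describing, up to a
  rescaling of time, the flat sections of the universal vector extension of a family of elliptic
  curves: if the point is written as a \<tau> + b with a, b constant, then near the cusp P and M behave like
  q^a and q^(1-a) up to constants. Torsion points give algebraic solution curves; they are obtained
  from an evident one by repeated halving, and those with leading value a = 1/2^n are already Zariski
  dense. A rational first integral is, near the line P = M = 0, a formal function c(a). Following it
  along the invariant surface M = 0 shows c(-a) = c(a), and along P = 0 that c(1-a) = c(1+a), so c is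
  periodic and hence constant. Finally one adjoins variables on which the field acts diagonally, with
  eigenvalues independent of those at the node, and takes as Poisson bracket the wedge of the field
  with the Euler field of one of these variables.\<close>

text \<open>Two demands pull against each other. Infinitely many invariant hypersurfaces would force
  a nonconstant rational first integral, so the dense family of invariant sets must have codimension
  at least 2. Curves in 3-space are the first possibility, and the variable carrying the Euler field
  brings the dimension to 4. The line P = M = 0 consists of zeros of the field; its normal
  eigenvalues 2 a and 2 (1 - a) vary along it and are independent over the integers as functions of
  a. This absence of resonance is why a formal first integral exists for each leading value and is
  determined by it. What remains is global: each of the two invariant surfaces carries invariant
  algebraic curves that meet the line twice, and comparing the two ends turns the local datum c(a)
  into functional equations. The choice a = 1/2^n serves density: as a tends to 0, M vanishes along
  the torsion curve to ever higher order compared with P, so a polynomial is detected by its lowest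
  terms in M and P.\<close>

unbundle fps_syntax

section \<open>Derivations and the vector field\<close>

definition ring_homo :: "('a::comm_ring_1 \<Rightarrow> 'b::comm_ring_1) \<Rightarrow> bool" where
  "ring_homo h \<longleftrightarrow> h 1 = 1 \<and> (\<forall>x y. h (x + y) = h x + h y) \<and> (\<forall>x y. h (x * y) = h x * h y)"

text \<open>The two sides of a chain rule \<open>\<theta> (h f) = h (D f)\<close> are not
  derivations of one ring but derivations along the homomorphism h. In this generality a chain rule
  only has to be checked on generators.\<close>

definition derivation_along ::
    "('a::comm_ring_1 \<Rightarrow> 'b::comm_ring_1) \<Rightarrow> ('a \<Rightarrow> 'b) \<Rightarrow> bool" where
  "derivation_along g T \<longleftrightarrow>
     (\<forall>x y. T (x + y) = T x + T y) \<and> (\<forall>x y. T (x * y) = T x * g y + g x * T y)"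

abbreviation derivation :: "('a::comm_ring_1 \<Rightarrow> 'a) \<Rightarrow> bool" where
  "derivation \<equiv> derivation_along (\<lambda>x. x)"

lemma ring_homoD:
  assumes "ring_homo h"
  shows "h 1 = 1" "h (x + y) = h x + h y" "h (x * y) = h x * h y" "h 0 = 0" "h (- x) = - h x"
    "h (x - y) = h x - h y" "h (x ^ n) = h x ^ n" "h (numeral m) = numeral m" "h (of_nat n) = of_nat n"
proof -
  have 1: "h 1 = 1" and add: "h (x + y) = h x + h y" and mult: "h (x * y) = h x * h y" for x y
    using assms by (auto simp: ring_homo_def)
  have 0: "h 0 = 0" using add[of 0 0] by simp
  have m: "h (- x) = - h x" for x using add[of x "-x"] 0 by (simp add: eq_neg_iff_add_eq_0 add.commute)
  have n: "h (of_nat n) = of_nat n" for n by (induct n) (simp_all add: 0 1 add)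
  show "h 1 = 1" "h (x + y) = h x + h y" "h (x * y) = h x * h y" "h 0 = 0" "h (- x) = - h x"
    by (fact 1 add mult 0 m)+
  show "h (x - y) = h x - h y" using add[of x "-y"] m[of y] by simp
  show "h (x ^ n) = h x ^ n" by (induct n) (simp_all add: 1 mult)
  show "h (of_nat n) = of_nat n" by (fact n)
  show "h (numeral m) = numeral m" using n[of "numeral m"] by simp
qed

lemma ring_homo_sum: "ring_homo h \<Longrightarrow> h (sum f I) = (\<Sum>i\<in>I. h (f i))"
  by (induct I rule: infinite_finite_induct) (simp_all add: ring_homoD)

lemma derivation_alongD:
  assumes "derivation_along g T"
  shows "T (x + y) = T x + T y" "T (x * y) = T x * g y + g x * T y"
    "T 0 = 0" "T (- x) = - T x" "T (x - y) = T x - T y"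
proof -
  have add: "T (x + y) = T x + T y" for x y
    using assms by (auto simp: derivation_along_def)
  have 0: "T 0 = 0" using add[of 0 0] by simp
  have m: "T (- x) = - T x" for x using add[of x "-x"] 0 by (simp add: eq_neg_iff_add_eq_0 add.commute)
  show "T (x + y) = T x + T y" "T 0 = 0" "T (- x) = - T x" by (fact add 0 m)+
  show "T (x * y) = T x * g y + g x * T y" using assms by (auto simp: derivation_along_def)
  show "T (x - y) = T x - T y" using add[of x "-y"] m[of y] by simp
qed

lemma derivation_along_1:
  assumes "derivation_along g T" "ring_homo g" shows "T 1 = 0"
  using derivation_alongD(2)[OF assms(1), of 1 1] ring_homoD(1)[OF assms(2)] by simp

lemma derivation_along_of_nat:
  assumes "derivation_along g T" "ring_homo g" shows "T (of_nat n) = 0"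
  by (induct n) (simp_all add: derivation_alongD[OF assms(1)] derivation_along_1[OF assms])

lemma ring_homo_id: "ring_homo (\<lambda>x. x)"
  by (simp add: ring_homo_def)

lemma derivation_1: "derivation T \<Longrightarrow> T 1 = 0"
  by (rule derivation_along_1[OF _ ring_homo_id])

lemma derivation_of_nat: "derivation T \<Longrightarrow> T (of_nat n) = 0"
  by (rule derivation_along_of_nat[OF _ ring_homo_id])

lemma derivation_numeral: "derivation T \<Longrightarrow> T (numeral n) = 0"
  using derivation_of_nat[of T "numeral n"] by simp

lemma derivation_power:
  assumes "derivation T" shows "T (x ^ Suc n) = of_nat (Suc n) * x ^ n * T x"
  by (induct n) (simp_all add: derivation_alongD[OF assms] derivation_1[OF assms] algebra_simps)

lemma derivation_along_eq_on_poly: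
  fixes T U :: "'a::comm_ring_1 poly \<Rightarrow> 'b::comm_ring_1"
  assumes T: "derivation_along g T" and U: "derivation_along g U"
    and c: "\<And>c. T [:c:] = U [:c:]" and X: "T [:0, 1:] = U [:0, 1:]"
  shows "T p = U p"
proof (induct p)
  case 0
  then show ?case using derivation_alongD(3)[OF T] derivation_alongD(3)[OF U] by simp
next
  case (pCons a p)
  have e: "pCons a p = [:a:] + [:0, 1:] * p" by simp
  show ?case unfolding e by (simp only: derivation_alongD[OF T] derivation_alongD[OF U] c X pCons)
qed

lemma derivation_along_comp: "derivation_along g T \<Longrightarrow> ring_homo h \<Longrightarrow> derivation_along (\<lambda>x. g (h x)) (\<lambda>x. T (h x))"
  unfolding derivation_along_def by (simp add: ring_homoD)

lemma derivation_along_homo: "derivation T \<Longrightarrow> ring_homo h \<Longrightarrow> derivation_along h (\<lambda>x. T (h x))"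
  by (drule (1) derivation_along_comp)

lemma derivation_along_homo': "derivation T \<Longrightarrow> ring_homo h \<Longrightarrow> derivation_along h (\<lambda>x. c * h (T x))"
  unfolding derivation_along_def by (simp add: ring_homoD algebra_simps)

lemma derivation_along_lincomb:
  "derivation_along g T \<Longrightarrow> derivation_along g U \<Longrightarrow> derivation_along g (\<lambda>x. c * T x + d * U x)"
  unfolding derivation_along_def by (simp add: algebra_simps)

lemma ring_homo_const: "ring_homo (\<lambda>c. [:c:])"
  by (simp add: ring_homo_def one_pCons)

lemma derivation_pderiv: "derivation (pderiv :: 'a::idom poly \<Rightarrow> 'a poly)"
  unfolding derivation_along_def by (auto simp: pderiv_add pderiv_mult)

lemma derivation_map_poly:
  assumes D: "derivation D" shows "derivation (map_poly D)"
  unfolding derivation_along_def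
proof (intro conjI allI)
  note D' = derivation_alongD[OF D]
  have s: "D (sum f I) = (\<Sum>i\<in>I. D (f i))" for f and I :: "nat set"
    by (induct I rule: infinite_finite_induct) (simp_all add: D')
  fix p q
  show "map_poly D (p + q) = map_poly D p + map_poly D q"
    by (rule poly_eqI) (simp add: coeff_map_poly D')
  show "map_poly D (p * q) = map_poly D p * q + p * map_poly D q"
    by (rule poly_eqI) (simp add: coeff_map_poly D' coeff_mult s sum.distrib)
qed

section \<open>Evaluation of nested polynomials\<close>

definition eval1 :: "('a::comm_ring_1 \<Rightarrow> 'b::comm_ring_1) \<Rightarrow> 'b \<Rightarrow> 'a poly \<Rightarrow> 'b" where
  "eval1 h x p = poly (map_poly h p) x"

lemma eval1_pCons: "ring_homo h \<Longrightarrow> eval1 h x (pCons c p) = h c + x * eval1 h x p"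
  by (simp add: eval1_def map_poly_pCons ring_homoD)

lemma eval1_0: "eval1 h x 0 = 0"
  by (simp add: eval1_def)

lemma eval1_simps:
  assumes "ring_homo h"
  shows "eval1 h x [:c:] = h c" "eval1 h x [:0, 1:] = x"
  by (simp_all add: eval1_pCons eval1_0 ring_homoD assms)

lemma ring_homo_eval1:
  assumes h: "ring_homo h" shows "ring_homo (eval1 h x)"
  unfolding ring_homo_def
proof (intro conjI allI)
  show "eval1 h x 1 = 1" by (simp add: one_pCons eval1_simps h ring_homoD)
  have add: "eval1 h x (p + q) = eval1 h x p + eval1 h x q" for p q
  proof -
    have "map_poly h (p + q) = map_poly h p + map_poly h q"
      by (rule poly_eqI) (simp add: coeff_map_poly ring_homoD h)
    then show ?thesis by (simp add: eval1_def)
  qed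
  have smult: "eval1 h x (smult c p) = h c * eval1 h x p" for c p
  proof -
    have "map_poly h (smult c p) = smult (h c) (map_poly h p)"
      by (rule poly_eqI) (simp add: coeff_map_poly ring_homoD h)
    then show ?thesis by (simp add: eval1_def)
  qed
  show "eval1 h x (p + q) = eval1 h x p + eval1 h x q" for p q by (rule add)
  show "eval1 h x (p * q) = eval1 h x p * eval1 h x q" for p q
    by (induct p) (simp_all add: eval1_0 eval1_pCons h add smult ring_homoD algebra_simps)
qed

definition ev :: "('k::comm_ring_1 \<Rightarrow> 'b::comm_ring_1) \<Rightarrow> 'b \<Rightarrow> 'b \<Rightarrow> 'b \<Rightarrow> 'k poly poly poly \<Rightarrow> 'b" where
  "ev h P M a = eval1 (eval1 (eval1 h a) P) M"

text \<open>With p_i^2 = \<wp> - e_i, x = p_2/p_1, y = p_3/p_1 and u the suitably normalised value of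
  \<zeta>(z) - a \<eta>_1 - b \<eta>_2, the flat sections satisfy x' = (1 - x^2)(x + u y), y' = (1 - y^2)(y + u x),
  u' = -(x + u y)(y + u x) after rescaling time. The components below are those of half this field in
  the coordinates P = ((x + y)/2)^2, M = ((y - x)/2)^2, a = (1 + u)/2. In nested polynomials M is the
  outermost and a the innermost variable.\<close>

definition fP :: "'a::comm_ring_1 \<Rightarrow> 'a \<Rightarrow> 'a \<Rightarrow> 'a" where
  "fP P M a = 2 * P * (a * (1 - P - M) - 2 * (1 - a) * M)"
definition fM :: "'a::comm_ring_1 \<Rightarrow> 'a \<Rightarrow> 'a \<Rightarrow> 'a" where
  "fM P M a = 2 * M * ((1 - a) * (1 - P - M) - 2 * a * P)"
definition fa :: "'a::comm_ring_1 \<Rightarrow> 'a \<Rightarrow> 'a \<Rightarrow> 'a" where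
  "fa P M a = (1 - a)\<^sup>2 * M - a\<^sup>2 * P"

definition vM :: "'k::comm_ring_1 poly poly poly" where "vM = [:0, 1:]"
definition vP :: "'k::comm_ring_1 poly poly poly" where "vP = [:[:0, 1:]:]"
definition va :: "'k::comm_ring_1 poly poly poly" where "va = [:[:[:0, 1:]:]:]"

text \<open>Differentiating coefficients, once or twice nested, gives the partial derivatives in the
  inner variables P and a. The factor 1 shapes the sum so that
  \<open>derivation_along_lincomb\<close> applies twice.\<close>

definition vfield :: "'k::idom poly poly poly \<Rightarrow> 'k poly poly poly" where
  "vfield f = fM vP vM va * pderiv f + 1 * (fP vP vM va * map_poly pderiv f
     + fa vP vM va * map_poly (map_poly pderiv) f)"

lemma derivation_vfield: "derivation vfield"
  unfolding vfield_def
  by (intro derivation_along_lincomb derivation_pderiv derivation_map_poly)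

lemma vfield_simps:
  "vfield [:[:[:c:]:]:] = 0" "vfield vM = fM vP vM va" "vfield vP = fP vP vM va" "vfield va = fa vP vM va"
  by (simp_all add: vfield_def vM_def vP_def va_def pderiv_pCons map_poly_pCons map_poly_1 flip: one_pCons)

lemma ring_homo_ev: "ring_homo h \<Longrightarrow> ring_homo (ev h P M a)"
  unfolding ev_def by (intro ring_homo_eval1)

lemma ev_simps:
  assumes h: "ring_homo h"
  shows "ev h P M a [:[:[:c:]:]:] = h c" "ev h P M a vM = M" "ev h P M a vP = P" "ev h P M a va = a"
    "ev h P M a [:[:e:]:] = eval1 h a e"
  by (simp_all add: ev_def vM_def vP_def va_def eval1_simps h ring_homo_eval1)

lemma ring_homo_f:
  assumes "ring_homo h"
  shows "h (fP P M a) = fP (h P) (h M) (h a)" "h (fM P M a) = fM (h P) (h M) (h a)"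
    "h (fa P M a) = fa (h P) (h M) (h a)"
  by (simp_all add: fP_def fM_def fa_def ring_homoD assms)

text \<open>Both sides are derivations along the evaluation, so they are compared one nested
  variable at a time, from the innermost outwards. The factor \<open>\<kappa>\<close> is the speed
  at which the point (P, M, a) moves along the field. The lemma serves formal series at the node,
  integral curves on the invariant surfaces and torsion curves alike.\<close>

lemma derivation_ev:
  assumes h: "ring_homo h" and D: "derivation \<theta>" and hc: "\<And>c. \<theta> (h c) = 0"
    and P: "\<theta> P = \<kappa> * fP P M a" and M: "\<theta> M = \<kappa> * fM P M a" and a: "\<theta> a = \<kappa> * fa P M a"
  shows "\<theta> (ev h P M a f) = \<kappa> * ev h P M a (vfield f)"
proof -
  let ?g = "ev h P M a"
  note g = ring_homo_ev[OF h, of P M a]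
  let ?T = "\<lambda>f. \<theta> (?g f)" and ?U = "\<lambda>f. \<kappa> * ?g (vfield f)"
  note e = ev_simps[OF h] vfield_simps ring_homo_f[OF g] P M a hc ring_homoD(4)[OF g]
  have T: "derivation_along ?g ?T" by (rule derivation_along_homo[OF D g])
  have U: "derivation_along ?g ?U" by (rule derivation_along_homo'[OF derivation_vfield g])
  note T1 = derivation_along_comp[OF T ring_homo_const] and U1 = derivation_along_comp[OF U ring_homo_const]
  note T2 = derivation_along_comp[OF T1 ring_homo_const] and U2 = derivation_along_comp[OF U1 ring_homo_const]
  have 3: "?T [:[:c:]:] = ?U [:[:c:]:]" for c
    by (rule derivation_along_eq_on_poly[OF T2 U2]) (simp_all add: e eval1_simps[OF h] flip: va_def)
  have 2: "?T [:c:] = ?U [:c:]" for c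
    by (rule derivation_along_eq_on_poly[OF T1 U1]) (simp_all only: 3, simp add: e flip: vP_def)
  show ?thesis
    by (rule derivation_along_eq_on_poly[OF T U]) (simp_all only: 2, simp add: e flip: vM_def)
qed

section \<open>Formal first integrals near the node\<close>

definition fps_map :: "('a::comm_ring_1 \<Rightarrow> 'b::comm_ring_1) \<Rightarrow> 'a fps \<Rightarrow> 'b fps" where
  "fps_map T f = Abs_fps (\<lambda>n. T (f $ n))"

lemma fps_map_nth [simp]: "fps_map T f $ n = T (f $ n)"
  by (simp add: fps_map_def)

lemma derivation_fps_map:
  assumes D: "derivation D" shows "derivation (fps_map D)"
  unfolding derivation_along_def
proof (intro conjI allI)
  note D' = derivation_alongD[OF D]
  have s: "D (sum f I) = (\<Sum>i\<in>I. D (f i))" for f and I :: "nat set"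
    by (induct I rule: infinite_finite_induct) (simp_all add: D')
  fix p q :: "'a fps"
  show "fps_map D (p + q) = fps_map D p + fps_map D q"
    by (rule fps_ext) (simp add: D')
  show "fps_map D (p * q) = fps_map D p * q + p * fps_map D q"
    by (rule fps_ext) (simp add: D' fps_mult_nth s sum.distrib)
qed

lemma derivation_fps_deriv: "derivation fps_deriv"
  unfolding derivation_along_def by (simp add: algebra_simps)

lemma derivation_fls_deriv: "derivation (fls_deriv :: 'a::comm_ring_1 fls \<Rightarrow> 'a fls)"
  unfolding derivation_along_def by (simp add: algebra_simps)

text \<open>Series along the line P = M = 0, with M outermost. The coefficients are Laurent series
  in a because the recursion for first integrals divides by the eigenvalues, among them 2 i a, which
  vanishes at a = 0.\<close>

definition fvM :: "'k::field fls fps fps" where "fvM = fps_X"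
definition fvP :: "'k::field fls fps fps" where "fvP = fps_const fps_X"
definition fva :: "'k::field fls fps fps" where "fva = fps_const (fps_const fls_X)"

definition formalD :: "'k::field fls fps fps \<Rightarrow> 'k fls fps fps" where
  "formalD f = fM fvP fvM fva * fps_deriv f + 1 * (fP fvP fvM fva * fps_map fps_deriv f
     + fa fvP fvM fva * fps_map (fps_map fls_deriv) f)"

lemma derivation_formalD: "derivation formalD"
  unfolding formalD_def
  by (intro derivation_along_lincomb derivation_fps_deriv derivation_fps_map derivation_fls_deriv)

lemma formalD_simps:
  fixes c :: "'k::field"
  shows "formalD (fps_const (fps_const (fls_const c))) = 0" "formalD fvM = fM fvP fvM (fva :: 'k fls fps fps)"
    "formalD fvP = fP fvP fvM (fva :: 'k fls fps fps)" "formalD fva = fa fvP fvM (fva :: 'k fls fps fps)"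
proof -
  have 1: "fps_map T (fps_const c) = fps_const (T c)" if "T 0 = 0" for T :: "'b::comm_ring_1 \<Rightarrow> 'c::comm_ring_1" and c
    by (rule fps_ext) (simp add: that)
  have 2: "fps_map T fps_X = 0" if "T 0 = 0" "T 1 = 0" for T :: "'b::comm_ring_1 \<Rightarrow> 'c::comm_ring_1"
    by (rule fps_ext) (simp add: that fps_X_def)
  have 3: "fps_map T 0 = 0" "fps_map T 1 = 0" if "T 0 = 0" "T 1 = 0" for T :: "'b::comm_ring_1 \<Rightarrow> 'c::comm_ring_1"
    by (rule fps_ext, simp add: that)+
  show "formalD (fps_const (fps_const (fls_const c))) = 0" "formalD fvM = fM fvP fvM (fva :: 'k fls fps fps)"
    "formalD fvP = fP fvP fvM (fva :: 'k fls fps fps)" "formalD fva = fa fvP fvM (fva :: 'k fls fps fps)"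
    by (simp_all add: formalD_def fvM_def fvP_def fva_def 1 2 3)
qed

text \<open>M and P occur on the right either in the scaling operators \<open>M * u\<close> and
  \<open>P * v\<close>, which are diagonal on coefficients, or as factors that shift an index by
  one. In this form the coefficients of a series can be read off.\<close>

lemma vector_field_expand:
  fixes P M a u v w :: "'a::comm_ring_1"
  shows "fM P M a * u + 1 * (fP P M a * v + fa P M a * w) =
    (2 * (1 - a) + - 2 * (1 + a) * P) * (M * u) + M * (- 2 * (1 - a) * (M * u))
     + (2 * a + - 2 * a * P) * (P * v) + M * (- 2 * (2 - a) * (P * v))
     + M * ((1 - a)\<^sup>2 * w) + - (a\<^sup>2) * (P * w)"
  unfolding fM_def fP_def fa_def by (simp add: algebra_simps power2_eq_square)

text \<open>Besides the coefficient itself, multiplied by the node eigenvalue, only its neighbours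
  one step lower in P or in M occur. The system is therefore triangular and can be solved by
  recursion on n + i.\<close>

lemma formalD_nth:
  fixes f :: "'k::field fls fps fps"
  defines "a \<equiv> fls_X :: 'k fls"
  shows "formalD f $ n $ i =
    (2 * of_nat n * (1 - a) + 2 * of_nat i * a) * f $ n $ i
    + (if i = 0 then 0 else - (2 * of_nat n * (1 + a) + 2 * of_nat (i - 1) * a) * f $ n $ (i - 1)
         - a\<^sup>2 * fls_deriv (f $ n $ (i - 1)))
    + (if n = 0 then 0 else - (2 * of_nat (n - 1) * (1 - a) + 2 * of_nat i * (2 - a)) * f $ (n - 1) $ i
         + (1 - a)\<^sup>2 * fls_deriv (f $ (n - 1) $ i))"
proof -
  let ?c = "\<lambda>x::'k fls. fps_const x" and ?C = "\<lambda>x::'k fls. fps_const (fps_const x)"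
  have C: "ring_homo ?C" by (simp add: ring_homo_def)
  have dec: "formalD f = (?C (2 * (1 - a)) + ?C (- 2 * (1 + a)) * fvP) * (fvM * fps_deriv f)
     + fvM * (?C (- 2 * (1 - a)) * (fvM * fps_deriv f))
     + (?C (2 * a) + ?C (- 2 * a) * fvP) * (fvP * fps_map fps_deriv f)
     + fvM * (?C (- 2 * (2 - a)) * (fvP * fps_map fps_deriv f))
     + fvM * (?C ((1 - a)\<^sup>2) * fps_map (fps_map fls_deriv) f)
     + ?C (- (a\<^sup>2)) * (fvP * fps_map (fps_map fls_deriv) f)"
  proof -
    have Cs: "?C (2 * (1 - a)) = 2 * (1 - fva)" "?C (- 2 * (1 + a)) = - 2 * (1 + fva)"
      "?C (- 2 * (1 - a)) = - 2 * (1 - fva)" "?C (2 * a) = 2 * fva" "?C (- 2 * a) = - 2 * fva"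
      "?C (- 2 * (2 - a)) = - 2 * (2 - fva)" "?C ((1 - a)\<^sup>2) = (1 - fva)\<^sup>2" "?C (- (a\<^sup>2)) = - (fva\<^sup>2)"
      by (simp_all only: ring_homoD[OF C] fva_def a_def)
    show ?thesis
      unfolding Cs formalD_def by (rule vector_field_expand)
  qed
  have X: "(fps_X * fps_deriv g) $ m = fps_const (of_nat m) * g $ m" for g :: "'k fls fps fps" and m
    by (cases m) (simp_all add: fps_of_nat del: of_nat_Suc)
  have X': "(fps_X * fps_deriv g) $ m = of_nat m * g $ m" for g :: "'k fls fps" and m
    by (cases m) simp_all
  show ?thesis
    unfolding dec fvM_def fvP_def
    by (cases n; cases i)
      (simp_all add: X X' distrib_right mult.assoc del: of_nat_Suc, simp_all add: algebra_simps)
qed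

text \<open>The coefficient of P^i M^n is found recursively, since the eigenvalue 2 n (1 - a) + 2 i a at the
  node is nonzero for (n, i) \<noteq> (0, 0).\<close>

lemma formalD_solution:
  fixes c :: "'k::field_char_0 fls"
  obtains F where "F $ 0 $ 0 = c" "formalD F = 0"
proof -
  define a where "a = (fls_X :: 'k fls)"
  define e where "e n i = 2 * of_nat n * (1 - a) + 2 * of_nat i * a" for n i :: nat
  have e: "e n i \<noteq> 0" if "n \<noteq> 0 \<or> i \<noteq> 0" for n i
  proof
    assume "e n i = 0"
    then have 0: "e n i $$ 0 = 0" "e n i $$ 1 = 0" by simp_all
    \<comment> \<open>Sorted by powers of a: the constant term is 2 n, and once n = 0 the
      coefficient of a is 2 i.\<close>
    have e': "e n i = fls_const (2 * of_nat n) + fls_const (2 * of_nat i - 2 * of_nat n) * a"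
      by (simp add: e_def algebra_simps fls_const_nonzero flip: fls_of_nat fls_const_numeral fls_plus_const fls_minus_const fls_const_mult_const)
    from 0(1) have "n = 0" by (simp add: e' a_def)
    from 0(2)[unfolded e'] \<open>n = 0\<close> have "i = 0" by (simp add: a_def)
    with \<open>n = 0\<close> that show False by simp
  qed
  define step where "step n i g h =
     - ((if i = 0 then 0 else - (2 * of_nat n * (1 + a) + 2 * of_nat (i - 1) * a) * g - a\<^sup>2 * fls_deriv g)
      + (if n = 0 then 0 else - (2 * of_nat (n - 1) * (1 - a) + 2 * of_nat i * (2 - a)) * h
         + (1 - a)\<^sup>2 * fls_deriv h)) / e n i" for n i :: nat and g h :: "'k fls"
  define G where "G = wfrec (measure (\<lambda>(n, i). n + i))
     (\<lambda>G (n, i). if n = 0 \<and> i = 0 then c else step n i (if i = 0 then 0 else G (n, i - 1)) (if n = 0 then 0 else G (n - 1, i)))"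
  have G: "G (n, i) = (if n = 0 \<and> i = 0 then c
      else step n i (if i = 0 then 0 else G (n, i - 1)) (if n = 0 then 0 else G (n - 1, i)))" for n i
    unfolding G_def by (subst wfrec) (auto simp: cut_def)
  define F where "F = Abs_fps (\<lambda>n. Abs_fps (\<lambda>i. G (n, i)))"
  have "formalD F = 0"
  proof (intro fps_ext)
    fix n i
    have Gs: "e n i * G (n, i) = - ((if i = 0 then 0 else - (2 * of_nat n * (1 + a) + 2 * of_nat (i - 1) * a) * G (n, i - 1) - a\<^sup>2 * fls_deriv (G (n, i - 1)))
      + (if n = 0 then 0 else - (2 * of_nat (n - 1) * (1 - a) + 2 * of_nat i * (2 - a)) * G (n - 1, i)
         + (1 - a)\<^sup>2 * fls_deriv (G (n - 1, i))))" 
    proof (cases "n = 0 \<and> i = 0")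
      case False
      then show ?thesis using e[of n i] by (subst G) (auto simp: step_def)
    qed (simp add: e_def)
    show "formalD F $ n $ i = 0 $ n $ i"
      unfolding formalD_nth F_def using Gs by (simp add: e_def a_def)
  qed
  moreover have "F $ 0 $ 0 = c" by (simp add: F_def G)
  ultimately show ?thesis by (rule that[rotated])
qed

section \<open>Lowest terms in M and P\<close>

definition low :: "nat \<Rightarrow> 'a::zero fps \<Rightarrow> bool" where
  "low n f \<longleftrightarrow> (\<forall>m<n. f $ m = 0)"

lemma low_mult_nth:
  assumes "low j f" "low l g"
  shows "(f * g) $ (j + l) = f $ j * (g::'a::comm_ring_1 fps) $ l"
proof -
  have "(f * g) $ (j + l) = (\<Sum>i\<in>{0..j + l}. f $ i * g $ (j + l - i))" by (simp add: fps_mult_nth)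
  also have "\<dots> = (\<Sum>i\<in>{j}. f $ i * g $ (j + l - i))"
  proof (rule sum.mono_neutral_right)
    show "\<forall>i\<in>{0..j + l} - {j}. f $ i * g $ (j + l - i) = 0"
    proof
      fix i assume "i \<in> {0..j + l} - {j}"
      then have "i < j \<or> j + l - i < l" by auto
      then show "f $ i * g $ (j + l - i) = 0" using assms by (auto simp: low_def)
    qed
  qed auto
  finally show ?thesis by simp
qed

text \<open>The position (j, i) bounds the lexicographically lowest term from below, M before P. The
  coefficient there may vanish, so that the bound survives an application of \<open>formalD\<close>,
  which can kill the lowest term.\<close>

definition low2 :: "nat \<Rightarrow> nat \<Rightarrow> 'a::zero fps fps \<Rightarrow> bool" where
  "low2 j i f \<longleftrightarrow> low j f \<and> low i (f $ j)"

lemma low2_mult_nth: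
  "low2 j i f \<Longrightarrow> low2 l k g \<Longrightarrow> (f * g) $ (j + l) $ (i + k) = f $ j $ i * (g::'a::comm_ring_1 fps fps) $ l $ k"
  by (simp add: low2_def low_mult_nth)

text \<open>The neighbours (j, i - 1) and (j - 1, i) in \<open>formalD_nth\<close> come
  lexicographically before (j, i), so only the diagonal term is left.\<close>

lemma low2_formalD:
  assumes "low2 j i f"
  shows "low2 j i (formalD f)"
    "formalD f $ j $ i = (2 * of_nat j * (1 - fls_X) + 2 * of_nat i * fls_X) * f $ j $ i"
proof -
  have z: "f $ n = 0" if "n < j" for n using assms that by (simp add: low2_def low_def)
  have z': "f $ j $ n = 0" if "n < i" for n using assms that by (simp add: low2_def low_def)
  show "low2 j i (formalD f)"
    unfolding low2_def low_def
  proof (intro conjI allI impI)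
    fix n assume "n < j"
    show "formalD f $ n = 0"
      by (rule fps_ext) (use \<open>n < j\<close> in \<open>simp add: formalD_nth z\<close>)
  next
    fix n assume "n < i"
    show "formalD f $ j $ n = 0"
      using \<open>n < i\<close> z'[of n] z'[of "n - 1"] z[of "j - 1"]
      by (cases "j = 0"; cases "n = 0") (simp_all add: formalD_nth)
  qed
  show "formalD f $ j $ i = (2 * of_nat j * (1 - fls_X) + 2 * of_nat i * fls_X) * f $ j $ i"
    using z'[of "i - 1"] z[of "j - 1"]
    by (cases "j = 0"; cases "i = 0") (simp_all add: formalD_nth)
qed

lemma low2_subdegree:
  "low2 (subdegree f) (subdegree (f $ subdegree f)) f"
  by (auto simp: low2_def low_def)

text \<open>The equation says that the logarithmic derivatives of p and q differ by R. On lowest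
  terms a logarithmic derivative is the node eigenvalue of the exponent, and the product of the two
  lowest coefficients cancels.\<close>

lemma formalD_leading:
  fixes p q :: "'k::field_char_0 fls fps fps"
  assumes eq: "p * formalD q - q * formalD p + fps_const (fps_const R) * (p * q) = 0"
    and p: "low2 j i p" "p $ j $ i \<noteq> 0" and q: "low2 l k q" "q $ l $ k \<noteq> 0"
  shows "R + 2 * (of_nat l - of_nat j) * (1 - fls_X) + 2 * (of_nat k - of_nat i) * fls_X = 0"
proof -
  note n = low2_mult_nth
  have "0 = (p * formalD q - q * formalD p + fps_const (fps_const R) * (p * q)) $ (j + l) $ (i + k)"
    by (simp add: eq)
  also have "\<dots> = (p * formalD q) $ (j + l) $ (i + k) - (q * formalD p) $ (l + j) $ (k + i) + R * (p * q) $ (j + l) $ (i + k)"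
    by (simp add: add.commute)
  also have "\<dots> = (R + 2 * (of_nat l - of_nat j) * (1 - fls_X) + 2 * (of_nat k - of_nat i) * fls_X) * (p $ j $ i * q $ l $ k)"
    unfolding n[OF p(1) low2_formalD(1)[OF q(1)]] n[OF q(1) low2_formalD(1)[OF p(1)]] n[OF p(1) q(1)]
      low2_formalD(2)[OF q(1)] low2_formalD(2)[OF p(1)] by (simp add: algebra_simps)
  finally show ?thesis using p(2) q(2) by simp
qed

text \<open>An integer combination of the two eigenvalues has degree at most 1 in a, and R has no
  terms in degrees 0 and 1, so neither can compensate the other.\<close>

lemma exponent_zero:
  fixes R :: "'k::field_char_0 fls"
  assumes "R + 2 * (of_nat l - of_nat j) * (1 - fls_X) + 2 * (of_nat k - of_nat i) * fls_X = 0"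
    and "R $$ 0 = 0" "R $$ 1 = 0"
  shows "j = l \<and> i = k \<and> R = 0"
proof -
  let ?c = "fls_const :: 'k \<Rightarrow> _"
  have "R + ?c (2 * (of_nat l - of_nat j)) + ?c (2 * (of_nat k - of_nat i) - 2 * (of_nat l - of_nat j)) * fls_X = 0"
    using assms(1) by (simp add: algebra_simps flip: fls_of_nat fls_const_numeral fls_plus_const fls_minus_const fls_const_mult_const)
  then have 0: "(R + ?c (2 * (of_nat l - of_nat j)) + ?c (2 * (of_nat k - of_nat i) - 2 * (of_nat l - of_nat j)) * fls_X) $$ m = 0" for m
    by simp
  from 0[of 0] assms have jl: "j = l" by simp
  moreover from 0[of 1] assms jl have ik: "i = k" by simp
  ultimately show ?thesis using assms(1) by simp
qed

text \<open>F and 1 are both killed by the field, so if F were nonzero its lowest term would sit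
  where that of 1 does, at (0, 0).\<close>

lemma formalD_constant_zero:
  fixes F :: "'k::field_char_0 fls fps fps"
  assumes F: "formalD F = 0" and F0: "F $ 0 $ 0 = 0" shows "F = 0"
proof (rule ccontr)
  assume "F \<noteq> 0"
  define j i where "j = subdegree F" and "i = subdegree (F $ j)"
  have F: "low2 j i F" "F $ j $ i \<noteq> 0"
    using \<open>F \<noteq> 0\<close> low2_subdegree[of F] by (simp_all add: j_def i_def)
  have 1: "low2 0 0 (1 :: 'k fls fps fps)" by (simp add: low2_def low_def)
  have "F * formalD 1 - 1 * formalD F + fps_const (fps_const 0) * (F * 1) = 0"
    by (simp add: assms derivation_1[OF derivation_formalD])
  from formalD_leading[OF this F 1] have "j = 0 \<and> i = 0"
    using exponent_zero[of 0 0 j 0 i] by simp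
  with F(2) assms(2) show False by simp
qed

text \<open>The lowest term of q need not be a unit, so p / q is not a series for free. Instead F is
  taken to be the formal first integral whose leading value is the ratio of the lowest coefficients.
  Then p - F q satisfies the same equation as p but has lost its coefficient at the one position
  where a nonzero solution must begin.\<close>

lemma formal_first_integral:
  fixes p q :: "'k::field_char_0 fls fps fps"
  assumes eq: "p * formalD q = q * formalD p" and "p \<noteq> 0" "q \<noteq> 0"
  obtains F where "p = F * q" "formalD F = 0"
proof -
  define j i where "j = subdegree q" and "i = subdegree (q $ j)"
  have q: "low2 j i q" "q $ j $ i \<noteq> 0"
    using \<open>q \<noteq> 0\<close> low2_subdegree[of q] by (simp_all add: j_def i_def)
  have same: "low2 j i g \<and> g $ j $ i \<noteq> 0" if g: "g * formalD q = q * formalD g" "g \<noteq> 0" for g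
  proof -
    define l k where "l = subdegree g" and "k = subdegree (g $ l)"
    have g': "low2 l k g" "g $ l $ k \<noteq> 0"
      using \<open>g \<noteq> 0\<close> low2_subdegree[of g] by (simp_all add: l_def k_def)
    have "g * formalD q - q * formalD g + fps_const (fps_const 0) * (g * q) = 0"
      by (simp add: g)
    from formalD_leading[OF this g' q] have "l = j \<and> k = i"
      using exponent_zero[of 0 j l i k] by simp
    with g' show ?thesis by simp
  qed
  obtain F where F: "F $ 0 $ 0 = p $ j $ i / q $ j $ i" "formalD F = 0"
    by (rule formalD_solution)
  define g where "g = p - F * q"
  have "g * formalD q = q * formalD g"
    using eq by (simp add: g_def derivation_alongD[OF derivation_formalD] F algebra_simps)
  moreover have "(F * q) $ (0 + j) $ (0 + i) = F $ 0 $ 0 * q $ j $ i"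
    by (rule low2_mult_nth[OF _ q(1)]) (simp add: low2_def low_def)
  then have "g $ j $ i = 0" using q by (simp add: g_def F)
  ultimately have "g = 0" using same[of g] by blast
  then have "p = F * q" by (simp add: g_def)
  then show ?thesis using F(2) that by blast
qed

section \<open>Restriction to the invariant surfaces\<close>

lemma homo_eval1: "ring_homo g \<Longrightarrow> ring_homo h \<Longrightarrow> g (eval1 h x p) = eval1 (\<lambda>c. g (h c)) (g x) p"
proof (induct p)
  case (pCons c p)
  have gh: "ring_homo (\<lambda>c. g (h c))"
    using pCons.prems by (simp add: ring_homo_def)
  show ?case using pCons by (simp add: eval1_pCons[OF gh] eval1_pCons ring_homoD)
qed (simp add: eval1_0 ring_homoD)

lemma ring_homo_comp: "ring_homo g \<Longrightarrow> ring_homo h \<Longrightarrow> ring_homo (\<lambda>c. g (h c))"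
  by (simp add: ring_homo_def)

lemma ring_homo_fps_const: "ring_homo fps_const"
  by (simp add: ring_homo_def)

lemma ring_homo_fls_const: "ring_homo fls_const"
  by (simp add: ring_homo_def fls_plus_const fls_const_mult_const)

lemma eval1_fps_X_nth:
  assumes h: "ring_homo h"
  shows "eval1 (\<lambda>c. fps_const (h c)) fps_X p $ n = h (coeff p n)"
proof (induct p arbitrary: n)
  case (pCons c p)
  show ?case
    using ring_homo_comp[OF ring_homo_fps_const h]
    by (cases n) (simp_all add: eval1_pCons pCons)
qed (simp add: eval1_0 ring_homoD[OF h])

definition emb0 :: "'k::field poly \<Rightarrow> 'k fls" where
  "emb0 = eval1 fls_const fls_X"
definition emb1 :: "'k::field poly poly \<Rightarrow> 'k fls fps" where
  "emb1 = eval1 (\<lambda>c. fps_const (emb0 c)) fps_X"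
definition emb :: "'k::field poly poly poly \<Rightarrow> 'k fls fps fps" where
  "emb = eval1 (\<lambda>c. fps_const (emb1 c)) fps_X"

lemma ring_homo_emb: "ring_homo emb0" "ring_homo emb1" "ring_homo emb"
proof -
  show 0: "ring_homo emb0" unfolding emb0_def by (intro ring_homo_eval1 ring_homo_fls_const)
  show 1: "ring_homo emb1" unfolding emb1_def by (intro ring_homo_eval1 ring_homo_comp[OF ring_homo_fps_const] 0)
  show "ring_homo emb" unfolding emb_def by (intro ring_homo_eval1 ring_homo_comp[OF ring_homo_fps_const] 1)
qed

lemma emb_nth: "emb1 r $ i = emb0 (coeff r i)" "emb p $ n = emb1 (coeff p n)"
  by (simp_all add: emb1_def emb_def eval1_fps_X_nth ring_homo_emb ring_homo_emb[unfolded emb1_def])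

lemma emb0_nth: "emb0 e $$ int n = coeff e n"
proof -
  have h: "ring_homo (fps_to_fls :: 'a fps \<Rightarrow> 'a fls)"
    by (simp add: ring_homo_def fls_times_fps_to_fls)
  have "emb0 e = fps_to_fls (eval1 fps_const fps_X e)"
    by (simp add: homo_eval1[OF h ring_homo_fps_const] emb0_def )
  then show ?thesis using eval1_fps_X_nth[OF ring_homo_id, of e n] by simp
qed

lemma emb_eq_0:
  shows "emb0 e = 0 \<longleftrightarrow> e = 0" "emb1 r = 0 \<longleftrightarrow> r = 0" "emb p = 0 \<longleftrightarrow> p = 0"
proof -
  show 0: "emb0 e = 0 \<longleftrightarrow> e = 0" for e :: "'k::field poly"
    using emb0_nth[of e] by (auto simp: ring_homoD[OF ring_homo_emb(1)] intro!: poly_eqI)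
  show 1: "emb1 r = 0 \<longleftrightarrow> r = 0" for r :: "'k::field poly poly"
    by (auto simp: fps_eq_iff emb_nth 0 poly_eq_iff)
  show "emb p = 0 \<longleftrightarrow> p = 0"
    by (auto simp: fps_eq_iff[of "emb p"] emb_nth 1 poly_eq_iff[of p])
qed

text \<open>Built up through the series rings, \<open>emb\<close> shows its coefficients; written as
  one evaluation at the point (P, M, a), it obeys the chain rule
  \<open>derivation_ev\<close>.\<close>

lemma emb_eq_ev: "emb = ev (\<lambda>c. fps_const (fps_const (fls_const c))) fvP fvM fva"
proof -
  note c = ring_homo_fps_const and l = ring_homo_fls_const
  note cl = ring_homo_comp[OF c l]
  have 0: "eval1 (\<lambda>c. fps_const (fps_const (fls_const c))) fva = (\<lambda>e::'a poly. fps_const (fps_const (emb0 e)))"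
    by (rule ext) (simp add: emb0_def fva_def homo_eval1[OF c l] homo_eval1[OF c cl])
  have e0: "ring_homo (\<lambda>e. fps_const (emb0 e))" by (rule ring_homo_comp[OF c ring_homo_emb(1)])
  have 1: "eval1 (\<lambda>e::'a poly. fps_const (fps_const (emb0 e))) fvP = (\<lambda>e. fps_const (emb1 e))"
    by (rule ext) (simp add: emb1_def fvP_def homo_eval1[OF c e0])
  show ?thesis unfolding ev_def 0 1 emb_def fvM_def ..
qed

lemma formalD_emb: "formalD (emb f) = emb (vfield f)" for f :: "'k::field poly poly poly"
proof -
  have "ring_homo (\<lambda>c::'k. fps_const (fps_const (fls_const c)))"
    by (intro ring_homo_comp[OF ring_homo_fps_const] ring_homo_fls_const)
  from derivation_ev[OF this derivation_formalD, of fvP 1 fvM fva f] show ?thesis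
    by (simp add: formalD_simps emb_eq_ev)
qed

section \<open>Cancelling powers of a coordinate, and Wronskians\<close>

lemma X_power_decomp:
  fixes p :: "'a::idom poly"
  assumes "p \<noteq> 0" obtains i q where "p = [:0, 1:] ^ i * q" "coeff q 0 \<noteq> 0"
proof -
  from order_decomp[OF assms, of 0] obtain q where q: "p = [:0, 1:] ^ order 0 p * q" "\<not> [:0, 1:] dvd q"
    by auto
  have "coeff q 0 \<noteq> 0" using q(2) by (simp add: dvd_iff_poly_eq_0 flip: poly_0_coeff_0) 
  with q(1) show ?thesis by (rule that)
qed

lemma ring_homo_coeff_0: "ring_homo (\<lambda>p. coeff p 0)"
  by (simp add: ring_homo_def coeff_mult)

lemma ring_homo_map_poly:
  assumes "ring_homo h" shows "ring_homo (map_poly h)"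
  unfolding ring_homo_def
  by (auto intro!: poly_eqI simp: coeff_map_poly ring_homoD[OF assms] coeff_mult ring_homo_sum[OF assms])

lemma ring_homo_fps_map:
  assumes "ring_homo h" shows "ring_homo (fps_map h)"
  unfolding ring_homo_def
  by (auto intro!: fps_ext simp: ring_homoD[OF assms] fps_mult_nth ring_homo_sum[OF assms])

lemma ring_homo_fps_nth_0: "ring_homo (\<lambda>f. f $ 0)"
  by (simp add: ring_homo_def)

text \<open>The variable P sits inside the coefficients and is divided out of all of them at once.
  Each division lowers the degree of the leading coefficient, so the process stops.\<close>

lemma inner_X_power_decomp:
  fixes p :: "'a::idom poly poly"
  assumes "p \<noteq> 0" obtains i q where "p = [:[:0, 1:]:] ^ i * q" "map_poly (\<lambda>c. coeff c 0) q \<noteq> 0"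
  using assms
proof (induct "degree (lead_coeff p)" arbitrary: p thesis rule: less_induct)
  case less
  show ?case
  proof (cases "map_poly (\<lambda>c. coeff c 0) p = 0")
    case False
    then show ?thesis using less.prems(1)[of 0 p] by simp
  next
    case True
    define p' where "p' = map_poly (poly_shift 1) p"
    have p: "p = [:[:0, 1:]:] * p'"
    proof (rule poly_eqI)
      fix n
      have "coeff (coeff p n) 0 = 0"
        using True by (metis coeff_0 coeff_map_poly)
      then have "coeff p n = pCons 0 (poly_shift 1 (coeff p n))"
        by (intro poly_eqI) (simp add: coeff_pCons coeff_poly_shift split: nat.split)
      then show "coeff p n = coeff ([:[:0, 1:]:] * p') n"
        by (simp add: p'_def coeff_map_poly)
    qed
    with less.prems(2) have p': "p' \<noteq> 0" by auto
    have "lead_coeff p = [:0, 1:] * lead_coeff p'"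
      unfolding p lead_coeff_mult by simp
    with p' have "degree (lead_coeff p') < degree (lead_coeff p)"
      by (simp add: degree_mult_eq)
    from less.hyps[OF this _ p'] obtain i q where
      "p' = [:[:0, 1:]:] ^ i * q" "map_poly (\<lambda>c. coeff c 0) q \<noteq> 0" by blast
    with p less.prems(1)[of "Suc i" q] show ?thesis by (simp add: mult.assoc)
  qed
qed

text \<open>Reduction by \<open>\<pi>\<close> kills x but none of u, F and w, so i and l are the
  exact orders of the two sides along x.\<close>

lemma cancel_order:
  fixes x u w F :: "'a::idom" and \<pi> :: "'a \<Rightarrow> 'b::idom"
  assumes \<pi>: "ring_homo \<pi>" and eq: "x ^ i * u = F * (x ^ l * w)" and x: "x \<noteq> 0" "\<pi> x = 0"
    and nz: "\<pi> u \<noteq> 0" "\<pi> F \<noteq> 0" "\<pi> w \<noteq> 0"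
  shows "i = l" "u = F * w"
proof -
  show il: "i = l"
  proof (rule ccontr)
    assume "i \<noteq> l"
    then consider "i < l" | "l < i" by linarith
    then show False
    proof cases
      case 1
      then have "x ^ l = x ^ i * (x * x ^ (l - i - 1))" by (simp flip: power_add power_Suc)
      with eq have "x ^ i * u = x ^ i * (F * (x * x ^ (l - i - 1) * w))"
        by (simp only: mult_ac)
      with x(1) have "u = F * (x * x ^ (l - i - 1) * w)" by simp
      with x nz show False by (simp add: ring_homoD[OF \<pi>])
    next
      case 2
      then have "x ^ i = x ^ l * (x * x ^ (i - l - 1))" by (simp flip: power_add power_Suc)
      with eq have "x ^ l * (x * x ^ (i - l - 1) * u) = x ^ l * (F * w)"
        by (simp only: mult_ac)
      with x(1) have "x * x ^ (i - l - 1) * u = F * w" by simp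
      then have "\<pi> (x * x ^ (i - l - 1) * u) = \<pi> (F * w)" by simp
      with x nz show False by (simp add: ring_homoD[OF \<pi>])
    qed
  qed
  from eq have "x ^ l * u = x ^ l * (F * w)" unfolding il by (simp only: mult_ac)
  with x(1) show "u = F * w" by simp
qed

text \<open>Since x = 0 is invariant, the power of x adds the same element
  \<open>of_nat i * g\<close> to both logarithmic derivatives, and it drops out of their
  difference.\<close>

lemma wronskian_cancel:
  fixes x u w g :: "'a::idom"
  assumes D: "derivation D" and x: "D x = x * g" "x \<noteq> 0"
    and W: "(x ^ i * u) * D (x ^ i * w) = (x ^ i * w) * D (x ^ i * u)"
  shows "u * D w = w * D u"
proof -
  have Dx: "D (x ^ i) = x ^ i * (of_nat i * g)"
    by (induct i) (simp_all add: derivation_1[OF D] derivation_alongD[OF D] x algebra_simps)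
  from W have "(x ^ i * x ^ i) * (u * D w) = (x ^ i * x ^ i) * (w * D u)"
    by (simp add: derivation_alongD[OF D] Dx algebra_simps)
  with x show ?thesis by simp
qed

lemma wronskian_factor:
  fixes y u w :: "'a::comm_ring_1"
  assumes "(y * u) * (y * w' + w * y') = (y * w) * (y * u' + u * y')"
  shows "y * y * (u * w') = y * y * (w * u')"
  using assms by (simp add: algebra_simps)

text \<open>Comparing leading coefficients in the equation shows that every nonzero solution has the
  degree of g. Subtracting the multiple of g that removes the coefficient in that degree must then
  leave 0.\<close>

lemma wronskian_poly:
  fixes f g :: "'k::field_char_0 poly"
  assumes W: "f * pderiv g = g * pderiv f" and g: "g \<noteq> 0"
  obtains c where "f = smult c g"
proof -
  have deg: "degree h = degree g" if W: "h * pderiv g = g * pderiv h" and h: "h \<noteq> 0" for h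
  proof (cases "degree g = 0 \<or> degree h = 0")
    case True
    then have "pderiv g = 0 \<or> pderiv h = 0" by (simp add: pderiv_eq_0_iff)
    with W g h have "pderiv g = 0 \<and> pderiv h = 0" by auto
    then show ?thesis by (simp add: pderiv_eq_0_iff)
  next
    case False
    have lc: "lead_coeff (pderiv r) = of_nat (degree r) * lead_coeff r" if "degree r \<noteq> 0" for r :: "'k poly"
      using that by (simp add: degree_pderiv coeff_pderiv)
    from W have "lead_coeff (h * pderiv g) = lead_coeff (g * pderiv h)" by simp
    then have "of_nat (degree g) * (lead_coeff h * lead_coeff g) = of_nat (degree h) * (lead_coeff h * lead_coeff g)"
      unfolding lead_coeff_mult using False lc[of g] lc[of h] by (simp add: mult_ac)
    with g h show ?thesis by simp
  qed
  define c where "c = coeff f (degree g) / lead_coeff g"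
  define h where "h = f - smult c g"
  have "h * pderiv g = g * pderiv h"
    using W by (simp add: h_def pderiv_diff pderiv_smult algebra_simps)
  moreover have "coeff h (degree g) = 0" using g by (simp add: h_def c_def)
  ultimately have "h = 0" using deg[of h] by (metis leading_coeff_0_iff)
  then show ?thesis using that[of c] by (simp add: h_def)
qed

text \<open>Here \<pi> restricts to an invariant surface x = 0, and \<chi> v further to the integral curve on which the
  remaining coordinate is 1 - \<rho>^2 and a = lin v \<rho>. Both \<rho> = 1 and \<rho> = -1 lie on the line P = M = 0, where
  the first integral takes its leading value.\<close>

lemma restricted_evenness:
  fixes x :: "'k::field_char_0 poly poly poly" and \<pi> :: "'k poly poly poly \<Rightarrow> 'k poly poly"
    and \<pi>' :: "'k fls fps fps \<Rightarrow> 'k fls fps" and lin :: "'k \<Rightarrow> 'k poly"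
  defines "\<chi> \<equiv> \<lambda>v. eval1 (eval1 (\<lambda>c. [:c:]) (lin v)) [:1, 0, -1:]"
  assumes \<pi>: "ring_homo \<pi>" and \<pi>': "ring_homo \<pi>'" and \<pi>\<pi>: "\<And>f. \<pi>' (emb f) = emb1 (\<pi> f)"
    and x: "vfield x = x * g" "x \<noteq> 0" "\<pi> x = 0"
    and decomp: "\<And>f. f \<noteq> 0 \<Longrightarrow> \<exists>i f'. f = x ^ i * f' \<and> \<pi> f' \<noteq> 0"
    and \<chi>: "\<And>v f. \<chi> v (\<pi> (vfield f)) = smult (- v) [:0, 0, 1, 0, -1:] * pderiv (\<chi> v (\<pi> f))"
    and nz: "p \<noteq> 0" "q \<noteq> 0" and F: "emb p = F * emb q" "\<pi>' F $ 0 \<noteq> 0"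
    and W: "p * vfield q = q * vfield p"
  shows "\<exists>r s. s \<noteq> 0 \<and> emb0 r = \<pi>' F $ 0 * emb0 s \<and>
    (\<forall>v. v \<noteq> 0 \<longrightarrow> poly r (poly (lin v) 1) * poly s (poly (lin v) (- 1))
       = poly r (poly (lin v) (- 1)) * poly s (poly (lin v) 1))"
proof -
  have F': "\<pi>' F \<noteq> 0" using F(2) by auto
  obtain i p1 where p1: "p = x ^ i * p1" "\<pi> p1 \<noteq> 0" using decomp[OF nz(1)] by blast
  obtain l q1 where q1: "q = x ^ l * q1" "\<pi> q1 \<noteq> 0" using decomp[OF nz(2)] by blast
  have ex: "emb x \<noteq> 0" "\<pi>' (emb x) = 0"
    by (simp_all add: emb_eq_0 \<pi>\<pi> x ring_homoD[OF ring_homo_emb(2)])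
  have "emb x ^ i * emb p1 = F * (emb x ^ l * emb q1)"
    using F(1) by (simp add: p1 q1 ring_homoD[OF ring_homo_emb(3)])
  from cancel_order[OF \<pi>' this ex] p1(2) q1(2) F'
  have il: "i = l" and e1: "emb p1 = F * emb q1" by (simp_all add: \<pi>\<pi> emb_eq_0)
  have W1: "p1 * vfield q1 = q1 * vfield p1"
    using W unfolding p1(1) q1(1) il by (rule wronskian_cancel[OF derivation_vfield x(1,2)])
  \<comment> \<open>The remaining coordinate of the surface is stripped as well, so that the
    quotients have nonzero restrictions r and s to the line P = M = 0.\<close>
  obtain j p2 where p2: "\<pi> p1 = [:0, 1:] ^ j * p2" "coeff p2 0 \<noteq> 0" using X_power_decomp[OF p1(2)] by blast
  obtain m q2 where q2: "\<pi> q1 = [:0, 1:] ^ m * q2" "coeff q2 0 \<noteq> 0" using X_power_decomp[OF q1(2)] by blast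
  have X: "emb1 [:0, 1:] = fps_X"
    unfolding emb1_def by (rule eval1_simps) (intro ring_homo_comp[OF ring_homo_fps_const] ring_homo_emb)
  have "fps_X ^ j * emb1 p2 = \<pi>' F * (fps_X ^ m * emb1 q2)"
    using arg_cong[OF e1, of \<pi>']
    by (simp add: \<pi>\<pi> ring_homoD[OF \<pi>'] p2 q2 ring_homoD[OF ring_homo_emb(2)] X)
  from cancel_order[OF ring_homo_fps_nth_0 this] p2(2) q2(2) F(2)
  have jm: "j = m" and e2: "emb1 p2 = \<pi>' F * emb1 q2" by (simp_all add: emb_nth emb_eq_0)
  define r s where "r = coeff p2 0" and "s = coeff q2 0"
  have "emb0 r = \<pi>' F $ 0 * emb0 s"
    using arg_cong[OF e2, of "\<lambda>f. f $ 0"] by (simp add: r_def s_def emb_nth)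
  moreover have "poly r (poly (lin v) 1) * poly s (poly (lin v) (- 1))
       = poly r (poly (lin v) (- 1)) * poly s (poly (lin v) 1)" if v: "v \<noteq> 0" for v
  proof -
    note c = ring_homo_const[where 'a = 'k]
    have h: "ring_homo (\<chi> v)" unfolding \<chi>_def by (intro ring_homo_eval1 c)
    have X: "\<chi> v [:0, 1:] = [:1, 0, -1:]" unfolding \<chi>_def by (intro eval1_simps ring_homo_eval1 c)
    \<comment> \<open>At the two ends of the curve the coordinate 1 - y^2 vanishes, so only the
      constant coefficient of t contributes.\<close>
    have at: "poly (\<chi> v t) y = poly (coeff t 0) (poly (lin v) y)" if "y = 1 \<or> y = - 1" for t y
    proof -
      have "poly (eval1 (\<lambda>c. [:c:]) (lin v) e) y = poly e (poly (lin v) y)" for e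
        by (induct e) (simp_all add: eval1_0 eval1_pCons[OF c])
      moreover have "t = pCons (coeff t 0) (poly_shift 1 t)"
        by (intro poly_eqI) (simp add: coeff_pCons coeff_poly_shift split: nat.split)
      then have "\<chi> v t = eval1 (\<lambda>c. [:c:]) (lin v) (coeff t 0) + [:1, 0, -1:] * \<chi> v (poly_shift 1 t)"
        unfolding \<chi>_def using eval1_pCons[OF ring_homo_eval1[OF c]] by metis
      ultimately show ?thesis using that by auto
    qed
    let ?k = "smult (- v) [:0, 0, 1, 0, -1:]" and ?y = "[:1, 0, -1:] ^ m :: 'k poly"
    have "\<chi> v (\<pi> p1) * (?k * pderiv (\<chi> v (\<pi> q1))) = \<chi> v (\<pi> q1) * (?k * pderiv (\<chi> v (\<pi> p1)))"
      using arg_cong[OF W1, of "\<lambda>f. \<chi> v (\<pi> f)"] by (simp only: ring_homoD[OF h] ring_homoD[OF \<pi>] \<chi>)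
    then have "?k * (\<chi> v (\<pi> p1) * pderiv (\<chi> v (\<pi> q1))) = ?k * (\<chi> v (\<pi> q1) * pderiv (\<chi> v (\<pi> p1)))"
      by (simp only: mult.left_commute)
    moreover have "?k \<noteq> 0" using v by simp
    ultimately have "\<chi> v (\<pi> p1) * pderiv (\<chi> v (\<pi> q1)) = \<chi> v (\<pi> q1) * pderiv (\<chi> v (\<pi> p1))"
      by (simp only: mult_cancel_left) blast
    then have "?y * ?y * (\<chi> v p2 * pderiv (\<chi> v q2)) = ?y * ?y * (\<chi> v q2 * pderiv (\<chi> v p2))"
      unfolding p2 q2 jm ring_homoD[OF h] X pderiv_mult by (rule wronskian_factor)
    moreover have "?y * ?y \<noteq> 0" by simp
    ultimately have W2: "\<chi> v p2 * pderiv (\<chi> v q2) = \<chi> v q2 * pderiv (\<chi> v p2)"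
      by (simp only: mult_cancel_left) blast
    show ?thesis
    proof (cases "\<chi> v q2 = 0")
      \<comment> \<open>The curve may lie inside the zero set of \<open>q2\<close>; then s vanishes
        at both ends and the claim reads 0 = 0.\<close>
      case True
      then show ?thesis using at[of 1 q2] at[of "-1" q2] by (simp add: s_def)
    next
      case False
      from wronskian_poly[OF W2 this] obtain c where "\<chi> v p2 = smult c (\<chi> v q2)" .
      then have "poly r (poly (lin v) 1) = c * poly s (poly (lin v) 1)"
        "poly r (poly (lin v) (- 1)) = c * poly s (poly (lin v) (- 1))"
        using at[of 1 q2] at[of "-1" q2] at[of 1 p2] at[of "-1" p2] by (simp_all add: r_def s_def)
      then show ?thesis by simp
    qed
  qed
  ultimately show ?thesis using q2(2) by (auto simp: s_def)
qed

section \<open>Integral curves on the two invariant surfaces\<close>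

lemma eval1_at_0: "ring_homo h \<Longrightarrow> eval1 h 0 p = h (coeff p 0)"
  by (cases p) (simp add: eval1_pCons)

lemma derivation_mult_left: "derivation D \<Longrightarrow> derivation (\<lambda>x. k * D x)"
  unfolding derivation_along_def by (simp add: algebra_simps)

text \<open>On M = 0 the function a^2 / (1 - P) is constant along the field. Calling it v^2, a level
  curve is parametrised by P = 1 - \<rho>^2, a = v \<rho>, and the field moves the parameter with
  speed - v \<rho>^2 (1 - \<rho>^2).\<close>

lemma vfield_on_M0:
  fixes f :: "'k::field_char_0 poly poly poly"
  defines "\<chi> \<equiv> \<lambda>v::'k. eval1 (eval1 (\<lambda>c. [:c:]) [:0, v:]) [:1, 0, -1:]"
  shows "\<chi> v (coeff (vfield f) 0) = smult (- v) [:0, 0, 1, 0, -1:] * pderiv (\<chi> v (coeff f 0))"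
proof -
  have "ring_homo (eval1 (eval1 (\<lambda>c. [:c:]) [:0, v:]) [:1, 0, -1:])"
    by (intro ring_homo_eval1 ring_homo_const)
  then have e: "ev (\<lambda>c. [:c:]) [:1, 0, -1:] 0 [:0, v:] f = \<chi> v (coeff f 0)" for f
    by (simp add: ev_def \<chi>_def eval1_at_0)
  have "smult (- v) [:0, 0, 1, 0, -1:] * pderiv (ev (\<lambda>c. [:c:]) [:1, 0, -1:] 0 [:0, v:] f)
    = 1 * ev (\<lambda>c. [:c:]) [:1, 0, -1:] 0 [:0, v:] (vfield f)"
    by (rule derivation_ev[OF ring_homo_const derivation_mult_left[OF derivation_pderiv]])
      (simp_all add: fP_def fM_def fa_def pderiv_pCons power2_eq_square numeral_poly one_pCons algebra_simps)
  then show ?thesis by (simp add: e)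
qed

text \<open>The field is symmetric under exchanging P with M and a with 1 - a, which turns this into
  the case M = 0.\<close>

lemma vfield_on_P0:
  fixes f :: "'k::field_char_0 poly poly poly"
  defines "\<chi> \<equiv> \<lambda>v::'k. eval1 (eval1 (\<lambda>c. [:c:]) [:1, - v:]) [:1, 0, -1:]"
    and "\<pi> \<equiv> map_poly (\<lambda>c. coeff c 0)"
  shows "\<chi> v (\<pi> (vfield f)) = smult (- v) [:0, 0, 1, 0, -1:] * pderiv (\<chi> v (\<pi> f))"
proof -
  have h: "ring_homo (eval1 (\<lambda>c. [:c:]) [:1, - v:])"
    by (intro ring_homo_eval1 ring_homo_const)
  have e: "ev (\<lambda>c. [:c:]) 0 [:1, 0, -1:] [:1, - v:] f = \<chi> v (\<pi> f)" for f
  proof -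
    have "eval1 (eval1 (\<lambda>c. [:c:]) [:1, - v:]) 0 = (\<lambda>c. eval1 (\<lambda>c. [:c:]) [:1, - v:] (coeff c 0))"
      by (rule ext) (simp add: eval1_at_0[OF h])
    then show ?thesis
      by (simp add: ev_def \<chi>_def \<pi>_def eval1_def[of _ "[:1, 0, -1:]"] map_poly_map_poly ring_homoD[OF h] comp_def)
  qed
  have "smult (- v) [:0, 0, 1, 0, -1:] * pderiv (ev (\<lambda>c. [:c:]) 0 [:1, 0, -1:] [:1, - v:] f)
    = 1 * ev (\<lambda>c. [:c:]) 0 [:1, 0, -1:] [:1, - v:] (vfield f)"
    by (rule derivation_ev[OF ring_homo_const derivation_mult_left[OF derivation_pderiv]])
      (simp_all add: fP_def fM_def fa_def pderiv_pCons power2_eq_square numeral_poly one_pCons algebra_simps)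
  then show ?thesis by (simp add: e)
qed

text \<open>Evenness about 0 and about 1 makes the function periodic with period 2, and a rational
  function taking one value along an arithmetic progression is constant. It comes with two
  representations p / q and r / s because each surface yields its own numerator and
  denominator.\<close>

lemma rational_function_two_symmetries:
  fixes p q r s :: "'k::field_char_0 poly"
  assumes nz: "q \<noteq> 0" "s \<noteq> 0" and eq: "p * s = r * q"
    and sym0: "\<And>v. v \<noteq> 0 \<Longrightarrow> poly p v * poly q (- v) = poly p (- v) * poly q v"
    and sym1: "\<And>v. v \<noteq> 0 \<Longrightarrow> poly r (1 - v) * poly s (1 + v) = poly r (1 + v) * poly s (1 - v)"
  shows "\<exists>c. p = smult c q"
proof -
  \<comment> \<open>From N on, no integer and no negative of one is a zero of either denominator, so
    the reflections may be evaluated there.\<close>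
  define Z where "Z = {x. poly (q * s) x = 0}"
  have "finite Z" unfolding Z_def by (rule poly_roots_finite) (use nz in simp)
  then have "finite ((of_nat :: nat \<Rightarrow> 'k) -` Z)" "finite ((\<lambda>n::nat. - of_nat n :: 'k) -` Z)"
    by (auto intro!: finite_vimageI injI)
  then have "finite ((of_nat :: nat \<Rightarrow> 'k) -` Z \<union> (\<lambda>n::nat. - of_nat n :: 'k) -` Z)" by simp
  then obtain N where N: "\<forall>n \<in> (of_nat :: nat \<Rightarrow> 'k) -` Z \<union> (\<lambda>n::nat. - of_nat n :: 'k) -` Z. n < N"
    unfolding finite_nat_set_iff_bounded by blast
  have nzN: "poly q (of_nat n) \<noteq> 0 \<and> poly s (of_nat n) \<noteq> 0 \<and> poly q (- of_nat n) \<noteq> 0 \<and> poly s (- of_nat n) \<noteq> 0"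
    if "n \<ge> N" for n
    using bspec[OF N, of n] that by (auto simp: Z_def)
  define \<phi> where "\<phi> x = poly p x / poly q x" for x
  have \<phi>: "\<phi> x = poly r x / poly s x" if "poly q x \<noteq> 0" "poly s x \<noteq> 0" for x
  proof -
    have "poly p x * poly s x = poly r x * poly q x" using eq by (metis poly_mult)
    with that show ?thesis by (simp add: \<phi>_def frac_eq_eq)
  qed
  have shift: "\<phi> (of_nat (n + 2)) = \<phi> (of_nat n)" if n: "n \<ge> Suc N" for n
  proof -
    let ?v = "of_nat (n + 1) :: 'k"
    have e: "1 + ?v = of_nat (n + 2)" "1 - ?v = - of_nat n" by simp_all
    have v: "?v \<noteq> 0" by (metis Suc_eq_plus1 of_nat_eq_0_iff nat.simps(3))
    have n0: "(of_nat n :: 'k) \<noteq> 0" using n by simp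
    from nzN[of n] nzN[of "n + 2"] n have nzn: "poly q (of_nat n) \<noteq> 0" "poly s (- of_nat n) \<noteq> 0"
      "poly q (- of_nat n) \<noteq> 0" "poly q (of_nat (n + 2)) \<noteq> 0" "poly s (of_nat (n + 2)) \<noteq> 0" by auto
    have "\<phi> (of_nat (n + 2)) = poly r (1 + ?v) / poly s (1 + ?v)" unfolding e by (rule \<phi>[OF nzn(4,5)])
    also have "\<dots> = poly r (1 - ?v) / poly s (1 - ?v)"
      using sym1[OF v] nzn unfolding e by (simp add: frac_eq_eq)
    also have "\<dots> = \<phi> (- of_nat n)" unfolding e by (rule \<phi>[symmetric, OF nzn(3,2)])
    also have "\<dots> = \<phi> (of_nat n)" using sym0[OF n0] nzn by (simp add: \<phi>_def frac_eq_eq)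
    finally show ?thesis .
  qed
  define c where "c = \<phi> (of_nat (Suc N))"
  have const: "\<phi> (of_nat (Suc N + 2 * m)) = c" for m
  proof (induct m)
    case (Suc m)
    then show ?case using shift[of "Suc N + 2 * m"] by (simp add: add.assoc)
  qed (simp add: c_def)
  have "p - smult c q = 0"
  proof (rule ccontr)
    assume "p - smult c q \<noteq> 0"
    then have "finite {x. poly (p - smult c q) x = 0}" by (rule poly_roots_finite)
    moreover have "range (\<lambda>m::nat. of_nat (Suc N + 2 * m) :: 'k) \<subseteq> {x. poly (p - smult c q) x = 0}"
    proof safe
      fix m :: nat
      show "poly (p - smult c q) (of_nat (Suc N + 2 * m)) = 0"
        using const[of m] nzN[of "Suc N + 2 * m"] by (simp add: \<phi>_def field_simps del: of_nat_Suc of_nat_add)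
    qed
    ultimately have "finite (range (\<lambda>m::nat. of_nat (Suc N + 2 * m) :: 'k))" by (rule finite_subset[rotated])
    moreover have "inj (\<lambda>m::nat. of_nat (Suc N + 2 * m) :: 'k)"
    proof (rule injI)
      fix x y :: nat assume "of_nat (Suc N + 2 * x) = (of_nat (Suc N + 2 * y) :: 'k)"
      then have "Suc N + 2 * x = Suc N + 2 * y" unfolding of_nat_eq_iff .
      then show "x = y" by simp
    qed
    ultimately show False using finite_imageD by blast
  qed
  then show ?thesis by auto
qed

text \<open>R stands for the difference of the eigenvalues of two leading monomials in the extra
  variables. It is excluded by comparing lowest terms at the node; after that p / q is a first
  integral of the field itself.\<close>

lemma vfield_no_first_integral:
  fixes p q :: "'k::field_char_0 poly poly poly"
  assumes eq: "p * vfield q - q * vfield p + [:[:R:]:] * (p * q) = 0"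
    and nz: "p \<noteq> 0" "q \<noteq> 0" and R: "coeff R 0 = 0" "coeff R 1 = 0"
  shows "R = 0 \<and> (\<exists>c. p = [:[:[:c:]:]:] * q)"
proof -
  note h = ring_homoD[OF ring_homo_emb(3)]
  have embR: "emb [:[:R:]:] = fps_const (fps_const (emb0 R))"
    by (intro fps_ext) (simp add: emb_nth coeff_pCons fps_const_def emb_eq_0 split: nat.split)
  have enz: "emb p \<noteq> 0" "emb q \<noteq> 0" using nz by (simp_all add: emb_eq_0)
  have "emb p * formalD (emb q) - emb q * formalD (emb p) + fps_const (fps_const (emb0 R)) * (emb p * emb q) = 0"
    using arg_cong[OF eq, of emb] by (simp only: h formalD_emb embR)
  from formalD_leading[OF this low2_subdegree _ low2_subdegree] enz
  have R0: "R = 0"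
    using exponent_zero[of "emb0 R" "subdegree (emb q)" "subdegree (emb p)"
      "subdegree (emb q $ subdegree (emb q))" "subdegree (emb p $ subdegree (emb p))"]
      R emb0_nth[of R 0] emb0_nth[of R 1] by (simp add: emb_eq_0)
  with eq have W: "p * vfield q = q * vfield p" by simp
  then have "emb p * formalD (emb q) = emb q * formalD (emb p)"
    by (simp add: formalD_emb flip: h)
  from formal_first_integral[OF this enz] obtain F where F: "emb p = F * emb q" "formalD F = 0" .
  have F0: "F $ 0 $ 0 \<noteq> 0" using formalD_constant_zero[OF F(2)] F(1) enz by auto
  define \<pi>P where "\<pi>P = (map_poly (\<lambda>c. coeff c 0) :: 'k poly poly poly \<Rightarrow> _)"
  note c0 = ring_homo_coeff_0 and f0 = ring_homo_fps_nth_0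
  have "\<exists>r s. s \<noteq> 0 \<and> emb0 r = F $ 0 $ 0 * emb0 s \<and>
    (\<forall>v::'k. v \<noteq> 0 \<longrightarrow> poly r (poly [:0, v:] 1) * poly s (poly [:0, v:] (- 1))
       = poly r (poly [:0, v:] (- 1)) * poly s (poly [:0, v:] 1))"
  proof (rule restricted_evenness[OF c0 f0 _ _ _ _ _ vfield_on_M0 nz F(1) F0 W])
    show "vfield vM = vM * (2 * ((1 - va) * (1 - vP - vM) - 2 * va * (vP :: 'k poly poly poly)))"
      by (simp add: vfield_simps fM_def mult.assoc mult.left_commute)
    show "\<exists>i f'. f = vM ^ i * f' \<and> coeff f' 0 \<noteq> 0" if "f \<noteq> 0" for f :: "'k poly poly poly"
      using X_power_decomp[OF that] unfolding vM_def by metis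
  qed (simp_all add: emb_nth vM_def)
  then obtain p0 q0 where 0: "q0 \<noteq> 0" "emb0 p0 = F $ 0 $ 0 * emb0 q0"
    "\<And>v. v \<noteq> 0 \<Longrightarrow> poly p0 v * poly q0 (- v) = poly p0 (- v) * poly q0 v" by auto
  have "\<exists>r s. s \<noteq> 0 \<and> emb0 r = fps_map (\<lambda>g. g $ 0) F $ 0 * emb0 s \<and>
    (\<forall>v::'k. v \<noteq> 0 \<longrightarrow> poly r (poly [:1, - v:] 1) * poly s (poly [:1, - v:] (- 1))
       = poly r (poly [:1, - v:] (- 1)) * poly s (poly [:1, - v:] 1))"
  proof (rule restricted_evenness[OF ring_homo_map_poly[OF c0] ring_homo_fps_map[OF f0] _ _ _ _ _ vfield_on_P0 nz F(1) _ W])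
    show "vfield vP = vP * (2 * (va * (1 - vP - vM) - 2 * (1 - va) * (vM :: 'k poly poly poly)))"
      by (simp add: vfield_simps fP_def mult.assoc mult.left_commute)
    show "\<exists>i f'. f = vP ^ i * f' \<and> map_poly (\<lambda>c. coeff c 0) f' \<noteq> 0" if "f \<noteq> 0" for f :: "'k poly poly poly"
      using inner_X_power_decomp[OF that] unfolding vP_def by metis
    show "fps_map (\<lambda>f. f $ 0) (emb f) = emb1 (map_poly (\<lambda>c. coeff c 0) f)" for f :: "'k poly poly poly"
      by (rule fps_ext) (simp add: emb_nth coeff_map_poly)
  qed (simp_all add: vP_def F0 map_poly_pCons)
  then obtain p1 q1 where 1: "q1 \<noteq> 0" "emb0 p1 = F $ 0 $ 0 * emb0 q1"
    "\<And>v. v \<noteq> 0 \<Longrightarrow> poly p1 (1 - v) * poly q1 (1 + v) = poly p1 (1 + v) * poly q1 (1 - v)" by auto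
  \<comment> \<open>The two surfaces share the line P = M = 0, so both fractions represent the same
    leading value of F.\<close>
  have "emb0 (p0 * q1 - p1 * q0) = 0"
    by (simp add: ring_homoD[OF ring_homo_emb(1)] 0(2) 1(2))
  then have "p0 * q1 = p1 * q0" by (simp add: emb_eq_0)
  from rational_function_two_symmetries[OF 0(1) 1(1) this 0(3) 1(3)]
  obtain c where "p0 = smult c q0" by blast
  then have c: "p0 = [:c:] * q0" by simp
  have ec: "emb0 [:c:] = fls_const c" unfolding emb0_def by (rule eval1_simps[OF ring_homo_fls_const])
  from 0 c have "fls_const c * emb0 q0 = F $ 0 $ 0 * emb0 q0"
    by (simp only: ring_homoD[OF ring_homo_emb(1)] flip: ec)
  then have Fc: "F $ 0 $ 0 = fls_const c" using 0(1) by (simp add: emb_eq_0)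
  \<comment> \<open>A formal first integral with leading value 0 vanishes, so a constant leading
    value makes F constant.\<close>
  have "formalD (F - fps_const (fps_const (fls_const c))) = 0"
    by (simp add: derivation_alongD[OF derivation_formalD] formalD_simps F)
  from formalD_constant_zero[OF this] Fc have "F = fps_const (fps_const (fls_const c))" by simp
  moreover have "emb [:[:[:c:]:]:] = fps_const (fps_const (fls_const c))"
    unfolding emb_eq_ev by (rule ev_simps) (intro ring_homo_comp[OF ring_homo_fps_const] ring_homo_fls_const)
  ultimately have "emb (p - [:[:[:c:]:]:] * q) = 0" using F(1) by (simp only: h) simp
  then have "p = [:[:[:c:]:]:] * q" by (simp only: emb_eq_0) simp
  with R0 show ?thesis by blast
qed

section \<open>Torsion curves\<close>

lemma fps_sqrt_exists:
  fixes f :: "'k::field_char_0 fps"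
  assumes "f $ 0 = 1" obtains g where "g * g = f" "g $ 0 = 1"
proof -
  let ?g = "fps_radical (\<lambda>_ _. 1) 2 f"
  have "?g ^ Suc 1 = f"
    using power_radical[of f "\<lambda>_ _. 1" 1] assms by (simp add: numeral_2_eq_2)
  moreover have "?g $ 0 = 1" by (simp add: fps_radical_nth_0)
  ultimately show ?thesis by (intro that[of ?g]) (simp_all add: power2_eq_square)
qed

text \<open>If (x, y, u) belongs to a point of the elliptic curve, then X^2 = (x + y)/(1 + y),
  Y^2 = (x + y)/(1 + x), U = (u - 1 - x - y)/(2 G) with G^2 = (1 + x)(1 + y) belong to a half of it.\<close>

lemma halving_deriv_x:
  fixes x y u h X Y U :: "'a::idom" and \<theta> :: "'a \<Rightarrow> 'a"
  assumes \<theta>: "derivation \<theta>"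
    and x: "\<theta> x = h * ((1 - x\<^sup>2) * (x + u * y))" and y: "\<theta> y = h * ((1 - y\<^sup>2) * (y + u * x))"
    and X: "X\<^sup>2 * (1 + y) = x + y" and UY: "2 * (1 + x) * (U * Y) = (u - 1 - x - y) * X"
    and nz: "2 * ((x + y) * (1 + y)) \<noteq> 0"
  shows "\<theta> X = h * ((1 + x) * (1 + y)) * ((1 - X\<^sup>2) * (X + U * Y))"
proof -
  note D = derivation_alongD[OF \<theta>]
  have "\<theta> (X\<^sup>2 * (1 + y)) = \<theta> (x + y)" by (simp add: X)
  then have d: "2 * X * \<theta> X * (1 + y) + X\<^sup>2 * \<theta> y = \<theta> x + \<theta> y"
    by (simp add: D derivation_1[OF \<theta>] power2_eq_square algebra_simps)
  have "2 * ((x + y) * (1 + y)) * \<theta> X = X * (1 + y) * (2 * X * \<theta> X * (1 + y))"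
    unfolding X[symmetric] by (simp add: power2_eq_square mult_ac)
  also have "\<dots> = X * ((1 + y) * (\<theta> x + \<theta> y) - X\<^sup>2 * (1 + y) * \<theta> y)"
    unfolding d[symmetric] by (simp add: algebra_simps)
  also have "\<dots> = X * h * ((x + y) * (1 + y) * (1 - x) * (1 + x + u - y))"
    unfolding X x y by (simp add: algebra_simps power2_eq_square)
  also have "\<dots> = h * ((x + y) * (1 + y)) * ((1 + y) - X\<^sup>2 * (1 + y)) * (2 * (1 + x) * X + 2 * (1 + x) * (U * Y))"
    unfolding X UY by (simp add: algebra_simps)
  also have "\<dots> = 2 * ((x + y) * (1 + y)) * (h * ((1 + x) * (1 + y)) * ((1 - X\<^sup>2) * (X + U * Y)))"
    by (simp add: algebra_simps)
  finally show ?thesis using nz by simp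
qed

text \<open>U has G in its denominator. Multiplication by 4 G^3 leaves only the derivatives of 2 U G
  and of G^2, and both of these are polynomials in x, y and u.\<close>

lemma halving_deriv_u:
  fixes x y u h X Y U G :: "'a::idom" and \<theta> :: "'a \<Rightarrow> 'a"
  assumes \<theta>: "derivation \<theta>"
    and x: "\<theta> x = h * ((1 - x\<^sup>2) * (x + u * y))" and y: "\<theta> y = h * ((1 - y\<^sup>2) * (y + u * x))"
    and u: "\<theta> u = - h * ((x + u * y) * (y + u * x))"
    and UX: "2 * (1 + y) * (U * X) = (u - 1 - x - y) * Y" and UY: "2 * (1 + x) * (U * Y) = (u - 1 - x - y) * X"
    and G: "G\<^sup>2 = (1 + x) * (1 + y)" "2 * U * G = u - 1 - x - y" "G * (X * Y) = x + y"
    and nz: "4 * (G * G\<^sup>2) \<noteq> 0"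
  shows "\<theta> U = - (h * ((1 + x) * (1 + y))) * ((X + U * Y) * (Y + U * X))"
proof -
  note D = derivation_alongD[OF \<theta>]
  let ?e = "u - 1 - x - y"
  have "\<theta> (G\<^sup>2) = \<theta> ((1 + x) * (1 + y))" "\<theta> (2 * U * G) = \<theta> ?e" by (simp_all add: G)
  then have dG: "2 * G * \<theta> G = \<theta> x * (1 + y) + (1 + x) * \<theta> y"
    and dU: "2 * \<theta> U * G + 2 * U * \<theta> G = \<theta> u - \<theta> x - \<theta> y"
    by (simp_all add: D derivation_1[OF \<theta>] derivation_numeral[OF \<theta>] power2_eq_square algebra_simps)
  have "4 * (G * G\<^sup>2) * \<theta> U = 2 * G\<^sup>2 * (2 * \<theta> U * G + 2 * U * \<theta> G) - (2 * U * G) * (2 * G * \<theta> G)"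
    by (simp add: algebra_simps power2_eq_square)
  also have "\<dots> = 2 * ((1 + x) * (1 + y)) * (\<theta> u - \<theta> x - \<theta> y) - ?e * (\<theta> x * (1 + y) + (1 + x) * \<theta> y)"
    unfolding dU dG G ..
  also have "\<dots> = - (h * ((1 + x) * (1 + y)) * ((x + y) * ((1 + x + u - y) * (1 + y + u - x))))"
    unfolding x y u by (simp add: algebra_simps power2_eq_square)
  also have "\<dots> = - (h * ((1 + x) * (1 + y)) * (G * ((2 * (1 + x) * X + ?e * X) * (2 * (1 + y) * Y + ?e * Y))))"
    unfolding G(3)[symmetric] by (simp add: algebra_simps)
  also have "\<dots> = 4 * (G * ((1 + x) * (1 + y))) * (- (h * ((1 + x) * (1 + y))) * ((X + U * Y) * (Y + U * X)))"
    unfolding UX[symmetric] UY[symmetric] by (simp add: algebra_simps)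
  finally show ?thesis using nz unfolding G by (simp only: mult_cancel_left) blast
qed

text \<open>Doubling of points in the homogeneous coordinates (1 : P : M); it fixes the point (1 : 1 : 0), which
  keeps the iterated forms from vanishing identically.\<close>

fun duplicate :: "'a::comm_ring_1 \<times> 'a \<times> 'a \<Rightarrow> 'a \<times> 'a \<times> 'a" where
  "duplicate (Z, P, M) = ((2 * Z * (P + M) - (P - M)\<^sup>2)\<^sup>2, (P - M) ^ 4, 16 * P * M * Z\<^sup>2)"

fun torsion_form :: "nat \<Rightarrow> 'a::comm_ring_1 \<times> 'a \<times> 'a \<Rightarrow> 'a" where
  "torsion_form 0 (Z, P, M) = P - M"
| "torsion_form (Suc n) t = torsion_form n (duplicate t)"

lemma torsion_form_homo: "ring_homo h \<Longrightarrow> h (torsion_form n (Z, P, M)) = torsion_form n (h Z, h P, h M)"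
  by (induct n arbitrary: Z P M) (simp_all add: ring_homoD)

lemma torsion_form_cusp: "torsion_form n (1, 1, 0) = 1"
  by (induct n) simp_all

text \<open>Doubling the half point gives back the old point, but its homogeneous coordinates
  acquire the factor \<open>\<zeta> ^ 4 * D\<^sup>2\<close>. This is why the vanishing is carried
  along for every scale \<open>\<zeta>\<close>.\<close>

lemma torsion_form_halving:
  fixes x y X Y :: "'a::{idom, semiring_char_0}"
  assumes X: "X\<^sup>2 * (1 + y) = x + y" and Y: "Y\<^sup>2 * (1 + x) = x + y"
    and nz: "(1 + x) * (1 + y) \<noteq> 0"
    and old: "\<And>\<zeta>. torsion_form n (\<zeta>, \<zeta> * P, \<zeta> * M) = 0"
    and PM: "4 * P = (x + y)\<^sup>2" "4 * M = (y - x)\<^sup>2" "4 * P' = (X + Y)\<^sup>2" "4 * M' = (Y - X)\<^sup>2"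
  shows "torsion_form (Suc n) (\<zeta>, \<zeta> * P', \<zeta> * M') = 0"
proof -
  \<comment> \<open>The square root of the first coordinate of the double of (1 : P' : M'), hence
    the denominator when P and M are expressed by P' and M'.\<close>
  define D where "D = 2 * (P' + M') - (P' - M')\<^sup>2"
  have "4 * (P' - M') = 4 * (X * Y)" "2 * (2 * (P' + M')) = 2 * (X\<^sup>2 + Y\<^sup>2)"
    using PM(3,4) by (simp_all add: algebra_simps power2_eq_square)
  then have d: "P' - M' = X * Y" and s: "2 * (P' + M') = X\<^sup>2 + Y\<^sup>2"
    by (simp_all only: mult_cancel_left) auto
  have four: "r = s" if "4 * r = 4 * s" for r s :: 'a
    using that mult_left_cancel[of "4 :: 'a" r s] by simp
  let ?g = "(1 + x) * (1 + y)"
  have X': "X\<^sup>2 * ?g = (x + y) * (1 + x)" and Y': "Y\<^sup>2 * ?g = (x + y) * (1 + y)"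
    using X Y by (simp_all add: mult_ac flip: X Y)
  have XY': "(X * Y)\<^sup>2 * ?g = (x + y) * (x + y)"
  proof -
    have "(X * Y)\<^sup>2 * ?g = (X\<^sup>2 * (1 + y)) * (Y\<^sup>2 * (1 + x))" by (simp add: power_mult_distrib mult_ac)
    then show ?thesis unfolding X Y .
  qed
  have Dg: "D * ?g = 2 * (x + y)"
  proof -
    have "D * ?g = X\<^sup>2 * ?g + Y\<^sup>2 * ?g - (X * Y)\<^sup>2 * ?g" unfolding D_def d s by (simp add: algebra_simps)
    then show ?thesis unfolding X' Y' XY' by (simp add: algebra_simps)
  qed
  have "?g * ((x + y) * D) = (x + y) * (D * ?g)" by (simp only: mult_ac)
  also have "\<dots> = ?g * (2 * (X * Y)\<^sup>2)" unfolding Dg using XY' by (simp add: algebra_simps)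
  finally have 1: "(x + y) * D = 2 * (X * Y)\<^sup>2" using nz by simp
  have "?g * ((y - x) * D) = (y - x) * (D * ?g)" by (simp only: mult_ac)
  also have "\<dots> = 2 * (Y\<^sup>2 * ?g - X\<^sup>2 * ?g)" unfolding Dg X' Y' by (simp add: algebra_simps)
  also have "\<dots> = ?g * (2 * (Y\<^sup>2 - X\<^sup>2))" by (simp add: algebra_simps)
  finally have 2: "(y - x) * D = 2 * (Y\<^sup>2 - X\<^sup>2)" using nz by simp
  have "4 * (D\<^sup>2 * P) = ((x + y) * D)\<^sup>2" unfolding power_mult_distrib PM(1)[symmetric] by (simp only: mult_ac)
  also have "\<dots> = 4 * (P' - M') ^ 4" unfolding 1 d by (simp add: power_mult_distrib)
  finally have P: "D\<^sup>2 * P = (P' - M') ^ 4" by (rule four)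
  have "4 * (D\<^sup>2 * M) = ((y - x) * D)\<^sup>2" unfolding power_mult_distrib PM(2)[symmetric] by (simp only: mult_ac)
  also have "\<dots> = 4 * ((X + Y)\<^sup>2 * (Y - X)\<^sup>2)" unfolding 2 by (simp add: algebra_simps power2_eq_square)
  also have "\<dots> = 4 * (16 * P' * M')" unfolding PM(3,4)[symmetric] by simp
  finally have M: "D\<^sup>2 * M = 16 * P' * M'" by (rule four)
  have "duplicate (\<zeta>, \<zeta> * P', \<zeta> * M') = (\<zeta> ^ 4 * D\<^sup>2, \<zeta> ^ 4 * D\<^sup>2 * P, \<zeta> ^ 4 * D\<^sup>2 * M)"
  proof -
    have "2 * \<zeta> * (\<zeta> * P' + \<zeta> * M') - (\<zeta> * P' - \<zeta> * M')\<^sup>2 = \<zeta>\<^sup>2 * D"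
      by (simp add: D_def algebra_simps power2_eq_square)
    moreover have "(\<zeta> * P' - \<zeta> * M') ^ 4 = \<zeta> ^ 4 * (P' - M') ^ 4"
      by (simp add: right_diff_distrib[symmetric] power_mult_distrib)
    moreover have "16 * (\<zeta> * P') * (\<zeta> * M') * \<zeta>\<^sup>2 = \<zeta> ^ 4 * (16 * P' * M')"
      by (simp add: power4_eq_xxxx power2_eq_square mult_ac)
    ultimately show ?thesis by (simp add: power_mult_distrib mult.assoc P M flip: power_mult)
  qed
  then show ?thesis using old[of "\<zeta> ^ 4 * D\<^sup>2"] by simp
qed

text \<open>A solution at a point of order a power of 2, parametrised by a power of q. The starting solution is
  x = u = 0, on which P = M; the leading exponents of x + y and y - x stand in the ratio a : 1 - a.\<close>

definition torsion_level :: "nat \<Rightarrow> nat \<Rightarrow> 'k::field_char_0 fps \<Rightarrow> 'k fps \<Rightarrow> 'k fps \<Rightarrow> bool" where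
  "torsion_level n E x y u \<longleftrightarrow>
    (\<exists>h. h \<noteq> 0 \<and> fps_X * fps_deriv x = h * ((1 - x\<^sup>2) * (x + u * y))
       \<and> fps_X * fps_deriv y = h * ((1 - y\<^sup>2) * (y + u * x))
       \<and> fps_X * fps_deriv u = - h * ((x + u * y) * (y + u * x)))
    \<and> (\<exists>c. x + y = fps_X ^ E * c \<and> c $ 0 = 4)
    \<and> (\<exists>g. y - x = fps_X ^ ((2 * 2 ^ n - 1) * E) * g \<and> g $ 0 \<noteq> 0)
    \<and> u $ 0 = 1 / 2 ^ n - 1
    \<and> (\<forall>P M \<zeta>. 4 * P = (x + y)\<^sup>2 \<longrightarrow> 4 * M = (y - x)\<^sup>2 \<longrightarrow> torsion_form n (\<zeta>, \<zeta> * P, \<zeta> * M) = 0)"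

lemma derivation_euler: "derivation (\<lambda>f. fps_X * fps_deriv f)"
  by (rule derivation_mult_left[OF derivation_fps_deriv])

lemma torsion_level_0:
  assumes "E > 0"
  shows "torsion_level 0 E 0 (4 * fps_X ^ E) (0 :: 'k::field_char_0 fps)"
proof -
  let ?y = "4 * fps_X ^ E :: 'k fps"
  \<comment> \<open>On x = u = 0 the system reduces to y' = h (1 - y^2) y. The Euler operator
    multiplies y by E, which dictates h.\<close>
  let ?h = "of_nat E * inverse (1 - ?y\<^sup>2)"
  have four: "(4 :: 'k fps) $ 0 = 4" by (simp add: numeral_fps_const)
  have y0: "?y $ 0 = 0" using assms by (simp add: fps_X_power_iff)
  have sq: "(1 - z\<^sup>2) $ 0 = 1" if "z $ 0 = 0" for z :: "'k fps"
    using that by (simp add: power2_eq_square)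
  from sq[OF y0] have i: "inverse (1 - ?y\<^sup>2) * (1 - ?y\<^sup>2) = 1" by (metis inverse_mult_eq_1 zero_neq_one)
  have "fps_X * fps_deriv (fps_X ^ E :: 'k fps) = of_nat E * fps_X ^ E"
  proof -
    obtain e where e: "E = Suc e" using assms by (cases E) simp_all
    show ?thesis
      unfolding e derivation_power[OF derivation_fps_deriv] by (simp only: fps_deriv_fps_X power_Suc mult_ac mult_1_left)
  qed
  then have "fps_X * fps_deriv ?y = of_nat E * ?y" by (simp add: mult.left_commute)
  also have "\<dots> = ?h * ((1 - ?y\<^sup>2) * (?y + 0 * 0))"
    using i by (simp add: mult.assoc mult.left_commute[of "1 - ?y\<^sup>2"] flip: mult.assoc[of "inverse (1 - ?y\<^sup>2)"])
  finally have dy: "fps_X * fps_deriv ?y = ?h * ((1 - ?y\<^sup>2) * (?y + 0 * 0))" .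
  have "inverse (1 - ?y\<^sup>2) \<noteq> 0" using i by (metis mult_zero_left zero_neq_one)
  then have h0: "?h \<noteq> 0" using assms by (simp only: mult_eq_0_iff of_nat_eq_0_iff) simp
  have T: "torsion_form 0 (\<zeta>, \<zeta> * P, \<zeta> * M) = 0" if "4 * P = (0 + ?y)\<^sup>2" "4 * M = (?y - 0)\<^sup>2" for P M \<zeta> :: "'k fps"
  proof -
    from that have "4 * P = 4 * M" by simp
    then show ?thesis by simp
  qed
  show ?thesis
    unfolding torsion_level_def
  proof (intro conjI)
    show "\<exists>h. h \<noteq> 0 \<and> fps_X * fps_deriv 0 = h * ((1 - 0\<^sup>2) * (0 + 0 * ?y))
       \<and> fps_X * fps_deriv ?y = h * ((1 - ?y\<^sup>2) * (?y + 0 * 0))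
       \<and> fps_X * fps_deriv 0 = - h * ((0 + 0 * ?y) * (?y + 0 * 0))"
      by (rule exI[of _ ?h], intro conjI h0 dy) simp_all
    show "\<exists>c. 0 + ?y = fps_X ^ E * c \<and> c $ 0 = 4"
      by (rule exI[of _ 4]) (simp add: four mult.commute)
    show "\<exists>g. ?y - 0 = fps_X ^ ((2 * 2 ^ 0 - 1) * E) * g \<and> g $ 0 \<noteq> 0"
      by (rule exI[of _ 4]) (simp add: four mult.commute)
    show "\<forall>P M \<zeta>. 4 * P = (0 + ?y)\<^sup>2 \<longrightarrow> 4 * M = (?y - 0)\<^sup>2 \<longrightarrow> torsion_form 0 (\<zeta>, \<zeta> * P, \<zeta> * M) = 0"
      using T by blast
  qed simp
qed

text \<open>Halving takes a square root of x + y, so the old level is used with the even order 2 E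
  and the new one has order E. Up to units, Y - X is the product of this square root and y - x,
  which gives the order E + (2 * 2^n - 1) * 2 E. The value of u at 0 passes to (u - 1) / 2.\<close>

lemma torsion_level_Suc:
  fixes x y u :: "'k::field_char_0 fps"
  assumes E: "E > 0" and lev: "torsion_level n (2 * E) x y u"
  shows "\<exists>X Y U :: 'k fps. torsion_level (Suc n) E X Y U"
proof -
  from lev obtain h c g where h: "h \<noteq> 0" "fps_X * fps_deriv x = h * ((1 - x\<^sup>2) * (x + u * y))"
      "fps_X * fps_deriv y = h * ((1 - y\<^sup>2) * (y + u * x))"
      "fps_X * fps_deriv u = - h * ((x + u * y) * (y + u * x))"
    and c: "x + y = fps_X ^ (2 * E) * c" "c $ 0 = 4"
    and g: "y - x = fps_X ^ ((2 * 2 ^ n - 1) * (2 * E)) * g" "g $ 0 \<noteq> 0"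
    and u0: "u $ 0 = 1 / 2 ^ n - 1"
    and T: "\<And>P M \<zeta>. 4 * P = (x + y)\<^sup>2 \<Longrightarrow> 4 * M = (y - x)\<^sup>2 \<Longrightarrow> torsion_form n (\<zeta>, \<zeta> * P, \<zeta> * M) = 0"
    unfolding torsion_level_def by blast
  have num: "fps_const (1 / 2) * 2 = (1 :: 'k fps)" "fps_const (1 / 4) * 4 = (1 :: 'k fps)"
    by (simp_all add: numeral_fps_const)
  have "(1::nat) \<le> 2 ^ n" by simp
  then have "(0::nat) < 2 * 2 ^ n - 1" by linarith
  with E have pos: "(2 * 2 ^ n - 1) * (2 * E) > (0::nat)" by (metis mult_pos_pos zero_less_numeral)
  have "(x + y) $ 0 = 0" "(y - x) $ 0 = 0"
    unfolding c(1) g(1) using E pos by (simp_all add: fps_X_power_iff)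
  then have xy0: "x $ 0 = 0" "y $ 0 = 0" by (simp_all add: eq_neg_iff_add_eq_0)
  \<comment> \<open>The leading coefficient 4 keeps all square roots over \<open>'k\<close>: c / 4
    has constant term 1, and so X + Y has leading coefficient 2 * 1 * (1 + 1) = 4 again.\<close>
  obtain r where r: "r * r = fps_const (1 / 4) * c" "r $ 0 = 1"
    by (rule fps_sqrt_exists[of "fps_const (1 / 4) * c"]) (simp add: c)
  obtain A where A: "A * A = 1 + x" "A $ 0 = 1" by (rule fps_sqrt_exists[of "1 + x"]) (simp add: xy0)
  obtain C where C: "C * C = 1 + y" "C $ 0 = 1" by (rule fps_sqrt_exists[of "1 + y"]) (simp add: xy0)
  define iA iC where "iA = inverse A" and "iC = inverse C"
  have iA: "iA * A = 1" "iA $ 0 = 1" using A by (simp_all add: iA_def inverse_mult_eq_1)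
  have iC: "iC * C = 1" "iC $ 0 = 1" using C by (simp_all add: iC_def inverse_mult_eq_1)
  define f where "f = 2 * (fps_X ^ E * r)"
  have f: "f * f = x + y"
  proof -
    have "f * f = fps_X ^ (E + E) * ((2 * 2) * (r * r))" unfolding f_def power_add by (simp only: mult_ac)
    also have "(2 * 2) * (r * r) = (fps_const (1 / 4) * 4) * c" unfolding r by simp
    also have "fps_X ^ (E + E) * (fps_const (1 / 4) * 4 * c) = fps_X ^ (2 * E) * c" unfolding num mult_2[of E] by simp
    finally show ?thesis unfolding c .
  qed
  define X Y U where "X = f * iC" and "Y = f * iA" and "U = fps_const (1 / 2) * ((u - 1 - x - y) * (iA * iC))"
  have X: "X\<^sup>2 * (1 + y) = x + y"
  proof -
    have "X\<^sup>2 * (1 + y) = (f * f) * ((iC * C) * (iC * C))"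
      unfolding X_def C(1)[symmetric] by (simp only: power2_eq_square mult_ac)
    then show ?thesis by (simp add: f iC)
  qed
  have Y: "Y\<^sup>2 * (1 + x) = x + y"
  proof -
    have "Y\<^sup>2 * (1 + x) = (f * f) * ((iA * A) * (iA * A))"
      unfolding Y_def A(1)[symmetric] by (simp only: power2_eq_square mult_ac)
    then show ?thesis by (simp add: f iA)
  qed
  have UY: "2 * (1 + x) * (U * Y) = (u - 1 - x - y) * X"
  proof -
    have "2 * (1 + x) * (U * Y) = (fps_const (1 / 2) * 2) * ((iA * A) * (iA * A)) * ((u - 1 - x - y) * X)"
      unfolding U_def X_def Y_def A(1)[symmetric] by (simp only: mult_ac)
    then show ?thesis by (simp only: num iA mult_1)
  qed
  have UX: "2 * (1 + y) * (U * X) = (u - 1 - x - y) * Y"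
  proof -
    have "2 * (1 + y) * (U * X) = (fps_const (1 / 2) * 2) * ((iC * C) * (iC * C)) * ((u - 1 - x - y) * Y)"
      unfolding U_def X_def Y_def C(1)[symmetric] by (simp only: mult_ac)
    then show ?thesis by (simp only: num iC mult_1)
  qed
  define G where "G = A * C"
  have G1: "G\<^sup>2 = (1 + x) * (1 + y)"
    unfolding G_def A(1)[symmetric] C(1)[symmetric] by (simp only: power2_eq_square mult_ac)
  have G2: "2 * U * G = u - 1 - x - y"
  proof -
    have "2 * U * G = (fps_const (1 / 2) * 2) * ((iA * A) * (iC * C)) * (u - 1 - x - y)"
      unfolding U_def G_def by (simp only: mult_ac)
    then show ?thesis by (simp only: num iA iC mult_1)
  qed
  have G3: "G * (X * Y) = x + y"
  proof -
    have "G * (X * Y) = (f * f) * ((iA * A) * (iC * C))"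
      unfolding X_def Y_def G_def by (simp only: mult_ac)
    then show ?thesis by (simp add: f iA iC)
  qed
  have s0: "x + y \<noteq> 0" using c by auto
  have x1: "1 + x \<noteq> 0" "1 + y \<noteq> 0" using A C by auto
  have G0: "4 * (G * G\<^sup>2) \<noteq> 0" using A(2) C(2) by (auto simp: G_def)
  have dX: "fps_X * fps_deriv X = h * ((1 + x) * (1 + y)) * ((1 - X\<^sup>2) * (X + U * Y))"
    by (rule halving_deriv_x[OF derivation_euler h(2,3) X UY]) (use s0 x1 in simp)
  have dY: "fps_X * fps_deriv Y = h * ((1 + x) * (1 + y)) * ((1 - Y\<^sup>2) * (Y + U * X))"
  proof -
    have "fps_X * fps_deriv Y = h * ((1 + y) * (1 + x)) * ((1 - Y\<^sup>2) * (Y + U * X))"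
      by (rule halving_deriv_x[OF derivation_euler h(3,2)])
        (use s0 x1 Y UX in \<open>simp_all add: add.commute diff_diff_eq\<close>)
    then show ?thesis by (simp only: mult.commute)
  qed
  have dU: "fps_X * fps_deriv U = - (h * ((1 + x) * (1 + y))) * ((X + U * Y) * (Y + U * X))"
    by (rule halving_deriv_u[OF derivation_euler h(2-4) UX UY G1 G2 G3 G0])
  have "torsion_level (Suc n) E X Y U"
    unfolding torsion_level_def
  proof (intro conjI)
    show "\<exists>h. h \<noteq> 0 \<and> fps_X * fps_deriv X = h * ((1 - X\<^sup>2) * (X + U * Y))
       \<and> fps_X * fps_deriv Y = h * ((1 - Y\<^sup>2) * (Y + U * X))
       \<and> fps_X * fps_deriv U = - h * ((X + U * Y) * (Y + U * X))"
      by (rule exI[of _ "h * ((1 + x) * (1 + y))"], intro conjI dX dY dU) (use h x1 in simp)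
    have "X + Y = fps_X ^ E * (2 * r * (iA + iC))"
      unfolding X_def Y_def f_def by (simp add: algebra_simps)
    moreover have "(2 * r * (iA + iC)) $ 0 = 4" by (simp add: r iA iC)
    ultimately show "\<exists>c. X + Y = fps_X ^ E * c \<and> c $ 0 = 4" by blast
    \<comment> \<open>Multiplying and dividing by A + C turns C - A into C^2 - A^2 = y - x, whose
      order is known.\<close>
    define j where "j = inverse (A + C)"
    have j: "j * (A + C) = 1" "j $ 0 = 1 / 2" using A C by (simp_all add: j_def inverse_mult_eq_1)
    have "iA - iC = iA * iC * (j * (A + C)) * (C - A)"
    proof -
      have "iA * iC * (C - A) = iA * (iC * C) - iC * (iA * A)" by (simp add: algebra_simps)
      then show ?thesis unfolding j iA iC by simp
    qed
    also have "\<dots> = iA * iC * j * (C * C - A * A)" by (simp add: algebra_simps)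
    also have "C * C - A * A = y - x" unfolding A C by simp
    finally have "Y - X = fps_X ^ (E + (2 * 2 ^ n - 1) * (2 * E)) * (2 * r * (iA * iC * j * g))"
      unfolding X_def Y_def right_diff_distrib[symmetric] g(1) f_def by (simp only: power_add mult_ac)
    moreover have "E + (2 * 2 ^ n - 1) * (2 * E) = (2 * 2 ^ Suc n - 1) * E"
    proof -
      obtain k where k: "2 * 2 ^ n = Suc k" by (cases "2 * 2 ^ n :: nat") simp_all
      then have "2 * 2 ^ Suc n = 2 * Suc k" by simp
      with k show ?thesis by (simp add: algebra_simps)
    qed
    moreover have "(2 * r * (iA * iC * j * g)) $ 0 \<noteq> 0" using g by (simp add: r iA iC j)
    ultimately show "\<exists>g. Y - X = fps_X ^ ((2 * 2 ^ Suc n - 1) * E) * g \<and> g $ 0 \<noteq> 0" by auto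
    show "U $ 0 = 1 / 2 ^ Suc n - 1"
      by (simp add: U_def u0 xy0 iA iC field_simps)
    have "4 * (fps_const (1 / 4) * z) = z" for z :: "'k fps"
    proof -
      have "4 * (fps_const (1 / 4) * z) = (fps_const (1 / 4) * 4) * z" by (simp only: mult_ac)
      then show ?thesis by (simp only: num mult_1)
    qed
    then have old: "torsion_form n (\<zeta>, \<zeta> * (fps_const (1 / 4) * (x + y)\<^sup>2), \<zeta> * (fps_const (1 / 4) * (y - x)\<^sup>2)) = 0"
        "4 * (fps_const (1 / 4) * (x + y)\<^sup>2) = (x + y)\<^sup>2" "4 * (fps_const (1 / 4) * (y - x)\<^sup>2) = (y - x)\<^sup>2" for \<zeta>
      using T by blast+
    show "\<forall>P M \<zeta>. 4 * P = (X + Y)\<^sup>2 \<longrightarrow> 4 * M = (Y - X)\<^sup>2 \<longrightarrow> torsion_form (Suc n) (\<zeta>, \<zeta> * P, \<zeta> * M) = 0"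
    proof (intro allI impI)
      fix P M \<zeta> assume "4 * P = (X + Y)\<^sup>2" "4 * M = (Y - X)\<^sup>2"
      then show "torsion_form (Suc n) (\<zeta>, \<zeta> * P, \<zeta> * M) = 0"
        by (intro torsion_form_halving[OF X Y _ old(1) old(2,3)]) (use x1 in simp_all)
    qed
  qed
  then show ?thesis by blast
qed

lemma torsion_level_exists: "E > 0 \<Longrightarrow> \<exists>x y u :: 'k::field_char_0 fps. torsion_level n E x y u"
proof (induct n arbitrary: E)
  case 0
  then show ?case using torsion_level_0 by blast
next
  case (Suc n)
  then show ?case using torsion_level_Suc by (metis nat_0_less_mult_iff zero_less_numeral)
qed

text \<open>The speed is 2 h rather than h because \<open>fP\<close>, \<open>fM\<close> and
  \<open>fa\<close> are the components of half the field. The multiples 32 and 16 clear the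
  denominators of P, M and a.\<close>

lemma vfield_change_coords:
  fixes x y u h P M a :: "'a::{idom, semiring_char_0}"
  assumes \<theta>: "derivation \<theta>"
    and x: "\<theta> x = h * ((1 - x\<^sup>2) * (x + u * y))" and y: "\<theta> y = h * ((1 - y\<^sup>2) * (y + u * x))"
    and u: "\<theta> u = - h * ((x + u * y) * (y + u * x))"
    and P: "4 * P = (x + y)\<^sup>2" and M: "4 * M = (y - x)\<^sup>2" and a: "2 * a = 1 + u"
  shows "\<theta> P = 2 * h * fP P M a" "\<theta> M = 2 * h * fM P M a" "\<theta> a = 2 * h * fa P M a"
proof -
  note D = derivation_alongD[OF \<theta>]
  have cancel: "r = s" if "numeral k * r = numeral k * s" for k and r s :: 'a
    using that mult_left_cancel[of "numeral k :: 'a" r s] by simp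
  have "\<theta> (4 * P) = \<theta> ((x + y)\<^sup>2)" "\<theta> (4 * M) = \<theta> ((y - x)\<^sup>2)" "\<theta> (2 * a) = \<theta> (1 + u)"
    by (simp_all only: P M a)
  then have d: "4 * \<theta> P = 2 * (x + y) * (\<theta> x + \<theta> y)" "4 * \<theta> M = 2 * (y - x) * (\<theta> y - \<theta> x)"
    "2 * \<theta> a = \<theta> u"
    by (simp_all add: D derivation_1[OF \<theta>] derivation_numeral[OF \<theta>] power2_eq_square algebra_simps)
  have b: "2 * (1 - a) = 1 - u" using a by (simp add: algebra_simps)
  have "32 * \<theta> P = 8 * (4 * \<theta> P)" by simp
  also have "\<dots> = 4 * h * (x + y)\<^sup>2 * ((1 + u) * (4 - (x + y)\<^sup>2 - (y - x)\<^sup>2) - 2 * (1 - u) * (y - x)\<^sup>2)"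
    unfolding d x y by (simp add: algebra_simps power2_eq_square)
  also have "\<dots> = 32 * (2 * h * fP P M a)"
    unfolding P[symmetric] M[symmetric] a[symmetric] b[symmetric] fP_def by (simp add: algebra_simps)
  finally show "\<theta> P = 2 * h * fP P M a" by (rule cancel)
  have "32 * \<theta> M = 8 * (4 * \<theta> M)" by simp
  also have "\<dots> = 4 * h * (y - x)\<^sup>2 * ((1 - u) * (4 - (x + y)\<^sup>2 - (y - x)\<^sup>2) - 2 * (1 + u) * (x + y)\<^sup>2)"
    unfolding d x y by (simp add: algebra_simps power2_eq_square)
  also have "\<dots> = 32 * (2 * h * fM P M a)"
    unfolding P[symmetric] M[symmetric] a[symmetric] b[symmetric] fM_def by (simp add: algebra_simps)
  finally show "\<theta> M = 2 * h * fM P M a" by (rule cancel)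
  have "16 * \<theta> a = 8 * (2 * \<theta> a)" by simp
  also have "\<dots> = 2 * h * ((1 - u)\<^sup>2 * (y - x)\<^sup>2 - (1 + u)\<^sup>2 * (x + y)\<^sup>2)"
    unfolding d u by (simp add: algebra_simps power2_eq_square)
  also have "\<dots> = 16 * (2 * h * fa P M a)"
    unfolding P[symmetric] M[symmetric] a[symmetric] b[symmetric] fa_def by (simp add: algebra_simps power2_eq_square)
  finally show "\<theta> a = 2 * h * fa P M a" by (rule cancel)
qed

text \<open>Restriction to the curve at level n with E = 1. Its kernel is invariant because the
  speed is nonzero, and nontrivial because it contains a torsion form. The orders of P and M and the
  initial value of a are recorded for the density argument.\<close>

lemma torsion_curve:
  "\<exists>(\<psi> :: 'k::field_char_0 poly poly poly \<Rightarrow> 'k fps) c g. ring_homo \<psi> \<and>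
    (\<forall>f. \<psi> f = 0 \<longrightarrow> \<psi> (vfield f) = 0) \<and> (\<exists>H. H \<noteq> 0 \<and> \<psi> H = 0) \<and>
    \<psi> vP = fps_X\<^sup>2 * c \<and> c $ 0 \<noteq> 0 \<and> \<psi> vM = fps_X ^ (2 * (2 * 2 ^ n - 1)) * g \<and> g $ 0 \<noteq> 0 \<and>
    (\<forall>e. \<psi> [:[:e:]:] $ 0 = poly e (1 / 2 ^ Suc n))"
proof -
  obtain x y u :: "'k fps" where "torsion_level n 1 x y u" using torsion_level_exists[of 1 n] by auto
  then obtain h c g where h: "h \<noteq> 0" "fps_X * fps_deriv x = h * ((1 - x\<^sup>2) * (x + u * y))"
      "fps_X * fps_deriv y = h * ((1 - y\<^sup>2) * (y + u * x))"
      "fps_X * fps_deriv u = - h * ((x + u * y) * (y + u * x))"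
    and c: "x + y = fps_X ^ 1 * c" "c $ 0 = 4"
    and g: "y - x = fps_X ^ ((2 * 2 ^ n - 1) * 1) * g" "g $ 0 \<noteq> 0"
    and u0: "u $ 0 = 1 / 2 ^ n - 1"
    and T: "\<And>P M \<zeta>. 4 * P = (x + y)\<^sup>2 \<Longrightarrow> 4 * M = (y - x)\<^sup>2 \<Longrightarrow> torsion_form n (\<zeta>, \<zeta> * P, \<zeta> * M) = 0"
    unfolding torsion_level_def by blast
  let ?C = "fps_const :: 'k \<Rightarrow> 'k fps"
  define P M a where "P = ?C (1 / 4) * (x + y)\<^sup>2" and "M = ?C (1 / 4) * (y - x)\<^sup>2" and "a = ?C (1 / 2) * (1 + u)"
  have num: "2 * ?C (1 / 2) = 1" "4 * ?C (1 / 4) = 1"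
    by (simp_all add: numeral_fps_const)
  have 4: "4 * P = (x + y)\<^sup>2" "4 * M = (y - x)\<^sup>2" "2 * a = 1 + u"
    unfolding P_def M_def a_def by (simp_all only: mult.assoc[symmetric] num mult_1_left)
  note hC = ring_homo_fps_const[where 'a = 'k]
  define \<psi> where "\<psi> = ev ?C P M a"
  note ode = vfield_change_coords[OF derivation_euler h(2-4) 4]
  have \<psi>h: "ring_homo \<psi>" unfolding \<psi>_def by (rule ring_homo_ev[OF hC])
  note s = ev_simps[OF hC, of P M a, folded \<psi>_def]
  have \<psi>D: "fps_X * fps_deriv (\<psi> f) = 2 * h * \<psi> (vfield f)" for f
    unfolding \<psi>_def by (rule derivation_ev[OF hC derivation_euler _ ode]) simp
  have inv: "\<psi> (vfield f) = 0" if "\<psi> f = 0" for f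
    using \<psi>D[of f] h(1) that by simp
  have rel: "\<exists>H. H \<noteq> 0 \<and> \<psi> H = 0"
  proof (intro exI conjI)
    let ?H = "torsion_form n (1, vP, vM) :: 'k poly poly poly"
    have "ev (\<lambda>c. c) 1 0 0 ?H = torsion_form n (1, 1, 0 :: 'k)"
      by (simp add: torsion_form_homo ring_homo_ev ring_homo_id ev_simps ring_homoD(1)[OF ring_homo_ev[OF ring_homo_id]])
    then show "?H \<noteq> 0"
      by (metis torsion_form_cusp zero_neq_one ring_homoD(4) ring_homo_ev ring_homo_id)
    show "\<psi> ?H = 0"
      using T[OF 4(1,2), of 1] by (simp add: torsion_form_homo[OF \<psi>h] s ring_homoD(1)[OF \<psi>h])
  qed
  have P: "\<psi> vP = fps_X\<^sup>2 * (?C (1 / 4) * c\<^sup>2)"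
    unfolding s P_def c(1) by (simp only: power_mult_distrib power_one_right mult_ac)
  have M: "\<psi> vM = fps_X ^ (2 * (2 * 2 ^ n - 1)) * (?C (1 / 4) * g\<^sup>2)"
    unfolding s M_def g(1) mult_1_right power_mult_distrib power_mult[symmetric] mult.commute[of _ 2]
    by (simp only: mult_ac)
  have a0: "a $ 0 = 1 / 2 ^ Suc n" by (simp add: a_def u0)
  have e: "\<psi> [:[:e:]:] $ 0 = poly e (1 / 2 ^ Suc n)" for e
  proof -
    have "eval1 ?C a e $ 0 = poly e (a $ 0)"
      by (induct e) (simp_all add: eval1_0 eval1_pCons[OF hC])
    then show ?thesis by (simp add: s a0)
  qed
  show ?thesis
    by (intro exI[of _ \<psi>] exI[of _ "?C (1 / 4) * c\<^sup>2"] exI[of _ "?C (1 / 4) * g\<^sup>2"])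
      (use \<psi>h inv rel P M e c(2) g(2) in \<open>auto simp: power2_eq_square\<close>)
qed

text \<open>Divide f by its power of M, and let P^i e(a) be the lowest term in P of the part free of
  M. On the curve at level n this term has order exactly 2 i if e does not vanish at 1/2^(n+1),
  while multiples of M have order at least 2 (2 * 2^n - 1). Large n outside finitely many exceptions
  therefore leaves the coefficient in degree 2 i nonzero.\<close>

lemma torsion_curves_dense:
  fixes f :: "'k::field_char_0 poly poly poly"
  assumes f: "f \<noteq> 0"
  shows "\<exists>\<psi> :: 'k poly poly poly \<Rightarrow> 'k fps. ring_homo \<psi> \<and>
    (\<forall>f. \<psi> f = 0 \<longrightarrow> \<psi> (vfield f) = 0) \<and> (\<exists>H. H \<noteq> 0 \<and> \<psi> H = 0) \<and> \<psi> f \<noteq> 0"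
proof -
  obtain j f1 where f1: "f = [:0, 1:] ^ j * f1" "coeff f1 0 \<noteq> 0" using X_power_decomp[OF f] .
  obtain i f2 where f2: "coeff f1 0 = [:0, 1:] ^ i * f2" "coeff f2 0 \<noteq> 0" using X_power_decomp[OF f1(2)] .
  define e where "e = coeff f2 0"
  have "finite {z. poly e z = 0}" using f2 by (intro poly_roots_finite) (simp add: e_def)
  moreover have "inj (\<lambda>n::nat. 1 / 2 ^ Suc n :: 'k)"
  proof (rule injI)
    fix m n :: nat assume "1 / 2 ^ Suc m = (1 / 2 ^ Suc n :: 'k)"
    then have "(of_nat (2 ^ Suc m) :: 'k) = of_nat (2 ^ Suc n)" by (simp add: field_simps)
    then show "m = n" unfolding of_nat_eq_iff by simp
  qed
  ultimately have "finite ((\<lambda>n::nat. 1 / 2 ^ Suc n :: 'k) -` {z. poly e z = 0})"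
    by (rule finite_vimageI)
  \<comment> \<open>Excluding \<open>{..i}\<close> forces i < n < 2^n, which pushes multiples of M
    beyond degree 2 i.\<close>
  then have "finite ((\<lambda>n::nat. 1 / 2 ^ Suc n :: 'k) -` {z. poly e z = 0} \<union> {..i})"
    by (intro finite_UnI) simp_all
  then obtain n where n: "n \<notin> (\<lambda>n::nat. 1 / 2 ^ Suc n :: 'k) -` {z. poly e z = 0} \<union> {..i}"
    using ex_new_if_finite[OF infinite_UNIV_nat] by blast
  obtain \<psi> c g where \<psi>: "ring_homo \<psi>" "\<And>f. \<psi> f = 0 \<Longrightarrow> \<psi> (vfield f) = 0" "\<exists>H. H \<noteq> 0 \<and> \<psi> H = 0"
    and P: "\<psi> vP = fps_X\<^sup>2 * c" "c $ 0 \<noteq> 0" and M: "\<psi> vM = fps_X ^ (2 * (2 * 2 ^ n - 1)) * g" "g $ 0 \<noteq> 0"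
    and at: "\<And>e. \<psi> [:[:e:]:] $ 0 = poly e (1 / 2 ^ Suc n :: 'k)"
    using torsion_curve[where 'k = 'k and n = n] by blast
  note h = ring_homoD[OF \<psi>(1)]
  have "n < 2 ^ n" by (rule less_exp)
  moreover have "i < n" using n by simp
  ultimately have ord: "2 * i < 2 * (2 * 2 ^ n - 1)" by linarith
  define f1' f2' where "f1' = poly_shift 1 f1" and "f2' = poly_shift 1 f2"
  have shift: "r = pCons (coeff r 0) (poly_shift 1 r)" for r :: "'b::comm_ring_1 poly"
    by (intro poly_eqI) (simp add: coeff_pCons coeff_poly_shift split: nat.split)
  have "f1 = [:coeff f1 0:] + vM * f1'"
    using shift[of f1] by (simp add: f1'_def vM_def)
  moreover have "[:coeff f1 0:] = vP ^ i * ([:[:e:]:] + vP * [:f2':])"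
  proof -
    have "f2 = [:e:] + [:0, 1:] * f2'" using shift[of f2] by (simp add: f2'_def e_def)
    then have "[:coeff f1 0:] = [:[:0, 1:] ^ i * ([:e:] + [:0, 1:] * f2'):]" using f2(1) by simp
    also have "\<dots> = vP ^ i * ([:[:e:]:] + vP * [:f2':])"
      unfolding vP_def by (simp only: ring_homoD[OF ring_homo_const])
    finally show ?thesis .
  qed
  ultimately have "\<psi> f1 = fps_X ^ (2 * i) * (c ^ i * (\<psi> [:[:e:]:] + fps_X\<^sup>2 * c * \<psi> [:f2':]))
      + fps_X ^ (2 * (2 * 2 ^ n - 1)) * (g * \<psi> f1')"
    by (simp only: h P M power_mult_distrib flip: power_mult) (simp only: mult_ac)
  then have "\<psi> f1 $ (2 * i) = (c $ 0) ^ i * poly e (1 / 2 ^ Suc n)"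
    using ord by (simp add: fps_X_power_mult_nth at fps_power_zeroth)
  then have "\<psi> f1 \<noteq> 0" using n P(2) by auto
  moreover have "\<psi> [:0, 1:] \<noteq> 0" using M unfolding vM_def by auto
  ultimately have "\<psi> f \<noteq> 0" by (simp add: f1 h)
  with \<psi> show ?thesis by blast
qed

section \<open>The polynomial ring and its derivation\<close>

abbreviation "lookup \<equiv> Poly_Mapping.lookup"
abbreviation "keys \<equiv> Poly_Mapping.keys"
abbreviation "single \<equiv> Poly_Mapping.single"
abbreviation "mapp \<equiv> Poly_Mapping.mapp"

section \<open>Monoid algebras and diagonal derivations\<close>

lemma poly_mapping_sum_singles: "f = (\<Sum>k\<in>keys f. single k (lookup f k))"
  by (rule poly_mapping_eqI) (auto simp: lookup_sum lookup_single when_def sum.If_cases in_keys_iff)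

lemma poly_mapping_add_induct [case_names single add]:
  fixes f :: "'m \<Rightarrow>\<^sub>0 'b::comm_monoid_add"
  assumes s: "\<And>k b. P (single k b)" and a: "\<And>f g. P f \<Longrightarrow> P g \<Longrightarrow> P (f + g)"
  shows "P f"
proof -
  have "P (\<Sum>k\<in>I. single k (lookup f k))" if "finite I" for I
    using that by (induct I) (use s[of undefined 0] in \<open>simp_all add: s a\<close>)
  then show ?thesis by (subst poly_mapping_sum_singles) simp
qed

lemma poly_mapping_bilinear_eq:
  fixes T U :: "('m \<Rightarrow>\<^sub>0 'b::comm_monoid_add) \<Rightarrow> ('m \<Rightarrow>\<^sub>0 'b) \<Rightarrow> 'c::ab_group_add"
  assumes "\<And>f f' g. T (f + f') g = T f g + T f' g" "\<And>f g g'. T f (g + g') = T f g + T f g'"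
    "\<And>f f' g. U (f + f') g = U f g + U f' g" "\<And>f g g'. U f (g + g') = U f g + U f g'"
    and s: "\<And>k a l b. T (single k a) (single l b)
      = U (single k a) (single l b)"
  shows "T f g = U f g"
proof (induct f rule: poly_mapping_add_induct)
  case (single k a)
  show ?case by (induct g rule: poly_mapping_add_induct) (simp_all add: s assms)
qed (simp add: assms)

lemma lookup_mapp_0: "(\<And>m. F m 0 = 0) \<Longrightarrow> lookup (mapp F f) m = F m (lookup f m)"
  by (auto simp: lookup_mapp when_def in_keys_iff)

lemma mapp_single: "(\<And>m. F m 0 = 0) \<Longrightarrow> mapp F (single k b) = single k (F k b)"
  by (rule poly_mapping_eqI) (auto simp: lookup_mapp_0 lookup_single when_def)

lemma mapp_add:
  "(\<And>m. F m 0 = 0) \<Longrightarrow> (\<And>m a b. F m (a + b) = F m a + F m b) \<Longrightarrow> mapp F (f + g) = mapp F f + mapp F g"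
  by (rule poly_mapping_eqI) (simp add: lookup_mapp_0 lookup_add)

lemma ring_homo_mapp:
  fixes F :: "'m::comm_monoid_add \<Rightarrow> 'b::comm_ring_1 \<Rightarrow> 'c::comm_ring_1"
  assumes 0: "\<And>m. F m 0 = 0" and add: "\<And>m a b. F m (a + b) = F m a + F m b" and 1: "F 0 1 = 1"
    and mult: "\<And>m n a b. F (m + n) (a * b) = F m a * F n b"
  shows "ring_homo (mapp F)"
  unfolding ring_homo_def
proof (intro conjI allI)
  note madd = mapp_add[of F, OF 0 add] and ms = mapp_single[of F, OF 0]
  show "mapp F 1 = 1" using ms[of 0 1] by (simp add: 1)
  show "mapp F (f + g) = mapp F f + mapp F g" for f g by (rule madd)
  show "mapp F (f * g) = mapp F f * mapp F g" for f g
    by (rule poly_mapping_bilinear_eq[where T = "\<lambda>f g. mapp F (f * g)" and U = "\<lambda>f g. mapp F f * mapp F g"])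
      (simp_all add: madd ms mult_single mult algebra_simps)
qed

definition diag :: "('b::comm_ring_1 \<Rightarrow> 'b) \<Rightarrow> ('m \<Rightarrow> 'b) \<Rightarrow> ('m::comm_monoid_add \<Rightarrow>\<^sub>0 'b) \<Rightarrow> ('m \<Rightarrow>\<^sub>0 'b)" where
  "diag D e = mapp (\<lambda>m b. D b + e m * b)"

lemma lookup_diag: "derivation D \<Longrightarrow> lookup (diag D e f) m = D (lookup f m) + e m * lookup f m"
  unfolding diag_def by (rule lookup_mapp_0) (simp add: derivation_alongD)

lemma keys_diag: "keys (diag D e f) \<subseteq> keys f"
  unfolding diag_def by (rule keys_mapp_subset)

lemma derivation_diag:
  assumes D: "derivation D" and e: "\<And>m n. e (m + n) = e m + e n"
  shows "derivation (diag D e)"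
  unfolding derivation_along_def
proof (intro conjI allI)
  note D' = derivation_alongD[OF D]
  have add: "diag D e (f + g) = diag D e f + diag D e g" for f g
    by (rule poly_mapping_eqI) (simp add: lookup_diag[OF D] lookup_add D' algebra_simps)
  have s: "diag D e (single k b) = single k (D b + e k * b)" for k b
    unfolding diag_def by (rule mapp_single) (simp add: D')
  show "diag D e (f + g) = diag D e f + diag D e g" for f g by (rule add)
  show "diag D e (f * g) = diag D e f * g + f * diag D e g" for f g
  proof (rule poly_mapping_bilinear_eq[where T = "\<lambda>f g. diag D e (f * g)" and U = "\<lambda>f g. diag D e f * g + f * diag D e g"])
    show "diag D e (single k a * single l b) =
        diag D e (single k a) * single l b +
        single k a * diag D e (single l b)" for k a l b
      by (simp add: mult_single s e D' algebra_simps flip: single_add)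
  qed (simp_all add: add algebra_simps)
qed

lemma diag_commute:
  assumes D: "derivation D" "derivation D'" and c: "\<And>b. D (D' b) = D' (D b)"
    and e: "\<And>m. D (e' m) = D' (e m)"
  shows "diag D e (diag D' e' f) = diag D' e' (diag D e f)"
  by (rule poly_mapping_eqI)
    (simp add: lookup_diag D derivation_alongD[OF D(1)] derivation_alongD[OF D(2)] c e algebra_simps)

text \<open>Once the terms at m and n are split off, all remaining products have exponents strictly
  below m + n.\<close>

lemma lookup_mult_leading:
  fixes f g :: "'m::{ordered_cancel_comm_monoid_add, linorder} \<Rightarrow>\<^sub>0 'b::comm_ring_1"
  assumes f: "\<And>k. k \<in> keys f \<Longrightarrow> k \<le> m" and g: "\<And>k. k \<in> keys g \<Longrightarrow> k \<le> n"
  shows "lookup (f * g) (m + n) = lookup f m * lookup g n"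
proof -
  let ?a = "single m (lookup f m)" and ?b = "single n (lookup g n)"
  define f' g' where "f' = f - ?a" and "g' = g - ?b"
  have f': "k < m" if "k \<in> keys f'" for k
    using that f[of k] by (cases "k = m") (auto simp: f'_def in_keys_iff lookup_minus lookup_single when_def)
  have g': "k < n" if "k \<in> keys g'" for k
    using that g[of k] by (cases "k = n") (auto simp: g'_def in_keys_iff lookup_minus lookup_single when_def)
  have z: "lookup (r * s) (m + n) = 0"
    if "\<And>k l. k \<in> keys r \<Longrightarrow> l \<in> keys s \<Longrightarrow> k + l < m + n" for r s :: "'m \<Rightarrow>\<^sub>0 'b"
  proof (rule ccontr)
    assume "lookup (r * s) (m + n) \<noteq> 0"
    then have "m + n \<in> keys (r * s)" by (simp add: in_keys_iff)
    then obtain k l where "m + n = k + l" "k \<in> keys r" "l \<in> keys s" using keys_mult[of r s] by blast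
    with that[of k l] show False by simp
  qed
  have "f * g = ?a * ?b + f' * g + ?a * g'" unfolding f'_def g'_def by (simp add: algebra_simps)
  moreover have "lookup (f' * g) (m + n) = 0"
    by (rule z) (use f' g in \<open>blast intro: add_less_le_mono\<close>)
  moreover have "lookup (?a * g') (m + n) = 0"
    by (rule z) (use g' in \<open>auto intro: add_strict_left_mono split: if_splits\<close>)
  ultimately show ?thesis by (simp add: lookup_add mult_single)
qed

section \<open>The extended field and its first integrals\<close>

type_synonym monomial = "nat \<Rightarrow>\<^sub>0 nat"
type_synonym 'k mring = "monomial \<Rightarrow>\<^sub>0 'k poly poly poly"

text \<open>The field acts on the i-th extra variable with eigenvalue a^(i + 2). Starting at a^2 makes these
  eigenvalues linearly independent over the integers from 2 a and 2 (1 - a), those at the node.\<close>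

definition weight :: "monomial \<Rightarrow> 'k::field_char_0 poly" where
  "weight m = (\<Sum>i\<in>keys m. monom (of_nat (lookup m i)) (i + 2))"

lemma coeff_weight: "coeff (weight m) j = (if j < 2 then 0 else of_nat (lookup m (j - 2)))"
proof -
  have "coeff (weight m) j = (\<Sum>i\<in>keys m. if j - 2 = i \<and> 2 \<le> j then of_nat (lookup m i) else 0)"
    unfolding weight_def coeff_sum by (rule sum.cong) (auto simp: coeff_monom)
  also have "\<dots> = (if j < 2 then 0 else of_nat (lookup m (j - 2)))"
    by (cases "j < 2") (auto simp: sum.delta in_keys_iff)
  finally show ?thesis .
qed

lemma weight_add: "weight (m + n) = weight m + weight n"
  by (rule poly_eqI) (simp add: coeff_weight lookup_add)

lemma weight_eq_iff: "weight m = weight n \<longleftrightarrow> m = n"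
proof
  assume w: "weight m = (weight n :: 'a poly)"
  show "m = n"
  proof (rule poly_mapping_eqI)
    fix i
    show "lookup m i = lookup n i" using arg_cong[OF w, of "\<lambda>p. coeff p (i + 2)"] by (simp add: coeff_weight)
  qed
qed simp

definition mflow :: "'k::field_char_0 mring \<Rightarrow> 'k mring" where
  "mflow = diag vfield (\<lambda>m. [:[:weight m:]:])"

definition meuler :: "'k::field_char_0 mring \<Rightarrow> 'k mring" where
  "meuler = diag (\<lambda>_. 0) (\<lambda>m. of_nat (lookup m 0))"

definition mconst :: "'k::field_char_0 \<Rightarrow> 'k mring" where
  "mconst c = single 0 [:[:[:c:]:]:]"

lemma derivation_zero: "derivation (\<lambda>_. 0)"
  by (simp add: derivation_along_def)

lemma derivation_mflow: "derivation mflow"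
  unfolding mflow_def by (rule derivation_diag[OF derivation_vfield]) (simp add: weight_add)

lemma derivation_meuler: "derivation meuler"
  unfolding meuler_def by (rule derivation_diag[OF derivation_zero]) (simp add: lookup_add)

text \<open>Both derivations are diagonal on monomials, and the Euler weights are integers, which
  the field kills. The Jacobi identity for the wedge of the two derivations rests on this
  commutation.\<close>

lemma mflow_meuler: "mflow (meuler f) = meuler (mflow f)"
  unfolding mflow_def meuler_def
  by (rule diag_commute[OF derivation_vfield derivation_zero])
    (simp_all add: derivation_alongD[OF derivation_vfield] derivation_of_nat[OF derivation_vfield])

lemma ring_homo_mconst: "ring_homo mconst"
  unfolding ring_homo_def mconst_def by (simp add: mult_single mult.commute flip: single_add single_one one_pCons)

lemma lookup_mconst_mult: "lookup (mconst c * f) m = [:[:[:c:]:]:] * lookup f m"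
proof (induct f rule: poly_mapping_add_induct)
  case (single k b)
  show ?case by (auto simp: mconst_def mult_single lookup_single when_def)
qed (simp add: lookup_add algebra_simps smult_add_right)

lemma mflow_mconst: "mflow (mconst c) = 0"
  by (rule poly_mapping_eqI)
    (simp add: mflow_def mconst_def lookup_diag[OF derivation_vfield] lookup_single when_def
      vfield_simps derivation_alongD[OF derivation_vfield] weight_def)

text \<open>At the product of the leading monomials the equation becomes one for the two leading
  coefficients, with the difference of the weights as R. Hence the leading monomials agree and the
  leading coefficients are proportional; subtracting the corresponding multiple of q leaves a
  solution without a term there, which is 0.\<close>

lemma mflow_no_first_integral:
  fixes p q :: "'k::field_char_0 mring"
  assumes eq: "p * mflow q = q * mflow p" and q: "q \<noteq> 0"
  shows "\<exists>c. p = mconst c * q"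
proof -
  have lead: "Max (keys r) = Max (keys q) \<and>
      (\<exists>c. lookup r (Max (keys q)) = [:[:[:c:]:]:] * lookup q (Max (keys q)))"
    if r: "r * mflow q = q * mflow r" "r \<noteq> 0" for r
  proof -
    define m n where "m = Max (keys r)" and "n = Max (keys q)"
    have k: "keys r \<noteq> {}" "keys q \<noteq> {}" using r q by (simp_all add: poly_mapping_eq_iff in_keys_iff fun_eq_iff set_eq_iff)
    have nz: "lookup r m \<noteq> 0" "lookup q n \<noteq> 0"
      using Max_in[OF finite_keys k(1)] Max_in[OF finite_keys k(2)] by (simp_all add: m_def n_def in_keys_iff)
    have kr: "k \<le> m" if "k \<in> keys r" for k using that by (simp add: m_def)
    have kq: "k \<le> n" if "k \<in> keys q" for k using that by (simp add: n_def)
    have kr': "k \<le> m" if "k \<in> keys (mflow r)" for k using that keys_diag kr unfolding mflow_def by blast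
    have kq': "k \<le> n" if "k \<in> keys (mflow q)" for k using that keys_diag kq unfolding mflow_def by blast
    have "lookup (r * mflow q) (m + n) = lookup (q * mflow r) (n + m)" using r by (simp add: add.commute)
    then have E: "lookup r m * lookup (mflow q) n = lookup q n * lookup (mflow r) m"
      by (simp only: lookup_mult_leading[OF kr kq'] lookup_mult_leading[OF kq kr'])
    have rearrange: "r' * v - q' * u + (b - a) * (r' * q') = 0" if "r' * (v + b * q') = q' * (u + a * r')"
      for r' q' u v a b :: "'k poly poly poly"
      using that by (simp add: algebra_simps)
    have W: "[:[:weight n:]:] - [:[:weight m :: 'k poly:]:] = [:[:weight n - weight m:]:]" by simp
    note rearrange[OF E[unfolded mflow_def lookup_diag[OF derivation_vfield]], unfolded W]
    from vfield_no_first_integral[OF this nz] have "weight n - weight m = (0 :: 'k poly)"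
      "\<exists>c. lookup r m = [:[:[:c:]:]:] * lookup q n" by (simp_all add: coeff_weight)
    then show ?thesis by (simp add: weight_eq_iff m_def n_def)
  qed
  show ?thesis
  proof (cases "p = 0")
    case True
    then show ?thesis by (intro exI[of _ 0]) (simp add: ring_homoD[OF ring_homo_mconst])
  next
    case False
    let ?n = "Max (keys q)"
    from lead[OF eq False] obtain c where c: "lookup p ?n = [:[:[:c:]:]:] * lookup q ?n" by blast
    define p' where "p' = p - mconst c * q"
    have "p' * mflow q = q * mflow p'"
      using eq by (simp add: p'_def derivation_alongD[OF derivation_mflow] mflow_mconst algebra_simps)
    moreover have "lookup p' ?n = 0" by (simp only: p'_def lookup_minus lookup_mconst_mult c) simp
    ultimately have "p' = 0"
      using lead[of p'] by (metis Max_in finite_keys in_keys_iff keys_eq_empty)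
    then show ?thesis by (auto simp: p'_def)
  qed
qed

section \<open>The Poisson structure\<close>

text \<open>The number r of extra variables is not part of a type: \<open>mring\<close> has
  infinitely many, and \<open>mvars r\<close> is a subset. Subrings and primes are therefore handled
  as subsets of a type-class ring until the final transport.\<close>

definition subring_in :: "'a::comm_ring_1 set \<Rightarrow> bool" where
  "subring_in S \<longleftrightarrow> 1 \<in> S \<and> (\<forall>x\<in>S. \<forall>y\<in>S. x + y \<in> S \<and> x * y \<in> S) \<and> (\<forall>x\<in>S. - x \<in> S)"

definition prime_in :: "'a::comm_ring_1 set \<Rightarrow> 'a set \<Rightarrow> bool" where
  "prime_in S P \<longleftrightarrow> P \<subseteq> S \<and> 0 \<in> P \<and> 1 \<notin> P \<and> (\<forall>x\<in>P. \<forall>y\<in>P. x + y \<in> P) \<and>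
     (\<forall>x\<in>P. \<forall>s\<in>S. s * x \<in> P) \<and> (\<forall>x\<in>S. \<forall>y\<in>S. x * y \<in> P \<longrightarrow> x \<in> P \<or> y \<in> P)"

lemma subring_inD:
  assumes "subring_in S"
  shows "1 \<in> S" "0 \<in> S" "x \<in> S \<Longrightarrow> y \<in> S \<Longrightarrow> x + y \<in> S" "x \<in> S \<Longrightarrow> y \<in> S \<Longrightarrow> x * y \<in> S"
    "x \<in> S \<Longrightarrow> - x \<in> S" "x \<in> S \<Longrightarrow> y \<in> S \<Longrightarrow> x - y \<in> S" "x \<in> S \<Longrightarrow> x ^ n \<in> S"
    "(\<And>i. i \<in> I \<Longrightarrow> f i \<in> S) \<Longrightarrow> sum f I \<in> S"
proof -
  have 1: "1 \<in> S" and a: "x \<in> S \<Longrightarrow> y \<in> S \<Longrightarrow> x + y \<in> S" and m: "x \<in> S \<Longrightarrow> y \<in> S \<Longrightarrow> x * y \<in> S"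
    and u: "x \<in> S \<Longrightarrow> - x \<in> S" for x y
    using assms by (auto simp: subring_in_def)
  have 0: "0 \<in> S" using a[OF 1 u[OF 1]] by simp
  show "1 \<in> S" "0 \<in> S" "x \<in> S \<Longrightarrow> y \<in> S \<Longrightarrow> x + y \<in> S" "x \<in> S \<Longrightarrow> y \<in> S \<Longrightarrow> x * y \<in> S"
    "x \<in> S \<Longrightarrow> - x \<in> S" by (fact 1 0 | erule (1) a | erule (1) m | erule u)+
  show "x \<in> S \<Longrightarrow> y \<in> S \<Longrightarrow> x - y \<in> S" using a[of x "-y"] u[of y] by simp
  show "x \<in> S \<Longrightarrow> x ^ n \<in> S" by (induct n) (simp_all add: 1 m)
  show "(\<And>i. i \<in> I \<Longrightarrow> f i \<in> S) \<Longrightarrow> sum f I \<in> S"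
    by (induct I rule: infinite_finite_induct) (simp_all add: 0 a)
qed

lemma prime_in_kernel:
  fixes h :: "'a::comm_ring_1 \<Rightarrow> 'b::idom"
  assumes "subring_in S" "ring_homo h" shows "prime_in S {x \<in> S. h x = 0}"
  using assms by (auto simp: prime_in_def ring_homoD subring_inD)

definition mvars :: "nat \<Rightarrow> 'k::field_char_0 mring set" where
  "mvars r = {f. \<forall>m\<in>keys f. keys m \<subseteq> {..<r}}"

definition mbracket :: "'k::field_char_0 mring \<Rightarrow> 'k mring \<Rightarrow> 'k mring" where
  "mbracket f g = meuler f * mflow g - meuler g * mflow f"

lemma single_in_mvars: "keys m \<subseteq> {..<r} \<Longrightarrow> single m b \<in> mvars r"
  by (auto simp: mvars_def split: if_splits)

lemma subring_in_mvars: "subring_in (mvars r)"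
  unfolding subring_in_def
proof (intro conjI ballI)
  show "1 \<in> mvars r" by (simp add: mvars_def)
  show "x + y \<in> mvars r" if "x \<in> mvars r" "y \<in> mvars r" for x y :: "'a mring"
    using that keys_add[of x y] unfolding mvars_def by blast
  show "- x \<in> mvars r" if "x \<in> mvars r" for x :: "'a mring"
    using that by (simp add: mvars_def in_keys_iff)
  show "x * y \<in> mvars r" if "x \<in> mvars r" "y \<in> mvars r" for x y :: "'a mring"
  proof -
    have "keys m \<subseteq> {..<r}" if m: "m \<in> keys (x * y)" for m
    proof -
      from m obtain a b where "m = a + b" "a \<in> keys x" "b \<in> keys y" using keys_mult[of x y] by blast
      moreover have "keys (a + b) \<subseteq> keys a \<union> keys b" by (rule keys_add)
      ultimately show ?thesis using \<open>x \<in> mvars r\<close> \<open>y \<in> mvars r\<close> unfolding mvars_def by blast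
    qed
    then show ?thesis by (simp add: mvars_def)
  qed
qed

lemma mflow_in_mvars: "f \<in> mvars r \<Longrightarrow> mflow f \<in> mvars r"
  using keys_diag unfolding mvars_def mflow_def by blast

lemma meuler_in_mvars: "f \<in> mvars r \<Longrightarrow> meuler f \<in> mvars r"
  using keys_diag unfolding mvars_def meuler_def by blast

lemma mconst_in_mvars: "mconst c \<in> mvars r"
  unfolding mconst_def by (rule single_in_mvars) simp

lemma mbracket_in_mvars: "f \<in> mvars r \<Longrightarrow> g \<in> mvars r \<Longrightarrow> mbracket f g \<in> mvars r"
  unfolding mbracket_def by (intro subring_inD[OF subring_in_mvars] mflow_in_mvars meuler_in_mvars)

lemma meuler_mconst: "meuler (mconst c) = 0"
  by (rule poly_mapping_eqI)
    (simp add: meuler_def mconst_def lookup_diag[OF derivation_zero] lookup_single when_def)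

lemma mbracket_props:
  shows "mbracket (x + y) z = mbracket x z + mbracket y z" "mbracket z (x + y) = mbracket z x + mbracket z y"
    "mbracket (mconst c * x) y = mconst c * mbracket x y" "mbracket x (mconst c * y) = mconst c * mbracket x y"
    "mbracket x x = 0" "mbracket (y * z) x = y * mbracket z x + mbracket y x * z"
    "mbracket x (mbracket y z) + mbracket y (mbracket z x) + mbracket z (mbracket x y) = 0"
proof -
  note D = derivation_alongD[OF derivation_mflow] derivation_alongD[OF derivation_meuler]
  show "mbracket (x + y) z = mbracket x z + mbracket y z" "mbracket z (x + y) = mbracket z x + mbracket z y"
    "mbracket (mconst c * x) y = mconst c * mbracket x y" "mbracket x (mconst c * y) = mconst c * mbracket x y"
    "mbracket x x = 0" "mbracket (y * z) x = y * mbracket z x + mbracket y x * z"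
    by (simp_all add: mbracket_def D mflow_mconst meuler_mconst algebra_simps)
  show "mbracket x (mbracket y z) + mbracket y (mbracket z x) + mbracket z (mbracket x y) = 0"
    by (simp add: mbracket_def D mflow_meuler algebra_simps)
qed

text \<open>The prime is the kernel of restricting every coefficient to a torsion curve on which
  some chosen coefficient of f survives. Both derivations act on each monomial separately, so they
  preserve this kernel, and with them the bracket does.\<close>

lemma mvars_poisson_primes_dense:
  fixes f :: "'k::field_char_0 mring"
  assumes f: "f \<noteq> 0"
  shows "\<exists>P. prime_in (mvars r) P \<and> (\<forall>a\<in>P. \<forall>b\<in>mvars r. mbracket a b \<in> P) \<and> P \<noteq> {0} \<and> f \<notin> P"
proof -
  obtain m where m: "lookup f m \<noteq> 0" using f by (metis poly_mapping_eqI lookup_zero)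
  obtain \<psi> :: "'k poly poly poly \<Rightarrow> 'k fps" and H where \<psi>: "ring_homo \<psi>"
    "\<And>f. \<psi> f = 0 \<Longrightarrow> \<psi> (vfield f) = 0" "H \<noteq> 0" "\<psi> H = 0" "\<psi> (lookup f m) \<noteq> 0"
    using torsion_curves_dense[OF m] by blast
  note h = ring_homoD[OF \<psi>(1)]
  let ?\<Psi> = "mapp (\<lambda>(m::monomial) b. \<psi> b)"
  have \<Psi>: "ring_homo ?\<Psi>" by (rule ring_homo_mapp) (simp_all add: h)
  have \<Psi>0: "?\<Psi> g = 0 \<longleftrightarrow> (\<forall>m. \<psi> (lookup g m) = 0)" for g
    by (simp add: poly_mapping_eq_iff fun_eq_iff lookup_mapp_0 h)
  define P where "P = {g \<in> mvars r. ?\<Psi> g = 0}"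
  have "prime_in (mvars r) P" unfolding P_def by (rule prime_in_kernel[OF subring_in_mvars \<Psi>])
  moreover have "mbracket a b \<in> P" if "a \<in> P" "b \<in> mvars r" for a b
  proof -
    from that have a: "a \<in> mvars r" "?\<Psi> a = 0" by (simp_all add: P_def)
    then have a0: "\<psi> (lookup a m) = 0" for m by (simp add: \<Psi>0)
    have "?\<Psi> (mflow a) = 0"
      by (simp add: \<Psi>0 mflow_def lookup_diag[OF derivation_vfield] ring_homoD(2,3)[OF \<psi>(1)] a0 \<psi>(2)
          del: mult_pCons_left)
    moreover have "?\<Psi> (meuler a) = 0"
      by (simp add: \<Psi>0 meuler_def lookup_diag[OF derivation_zero] h a0)
    ultimately show ?thesis
      using mbracket_in_mvars[OF a(1) that(2)] by (simp add: P_def mbracket_def ring_homoD[OF \<Psi>])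
  qed
  moreover have "single 0 H \<in> P" "single (0::monomial) H \<noteq> 0"
    using \<psi>(3,4) by (auto simp: P_def \<Psi>0 lookup_single when_def h intro: single_in_mvars dest: arg_cong[of _ _ "\<lambda>f. lookup f 0"])
  moreover have "f \<notin> P" using \<psi>(5) by (auto simp: P_def \<Psi>0)
  ultimately show ?thesis by blast
qed

text \<open>P has Euler degree 0 and is moved by the field, so the bracket with P shows that the
  Euler field kills p / q. The bracket with the first extra variable then shows that the extended
  field kills p / q too, which leaves only constants.\<close>

lemma mbracket_central:
  assumes q: "q \<noteq> 0"
    and central: "\<And>c. c \<in> mvars r \<Longrightarrow> mbracket p c * q = p * mbracket q c" and r: "r > 0"
  shows "\<exists>c. p = mconst c * q"
proof -
  let ?X = "single (single 0 1) 1 :: 'a mring" and ?P = "single 0 vP :: 'a mring" and ?a = "single 0 (va\<^sup>2) :: 'a mring"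
  have wP: "meuler ?P = 0"
    by (rule poly_mapping_eqI) (simp add: meuler_def lookup_diag[OF derivation_zero] lookup_single when_def)
  have wX: "meuler ?X = ?X"
    by (rule poly_mapping_eqI) (auto simp: meuler_def lookup_diag[OF derivation_zero] lookup_single when_def)
  have dP: "mflow ?P = single 0 (fP vP vM va)"
    by (rule poly_mapping_eqI) (auto simp: mflow_def lookup_diag[OF derivation_vfield] lookup_single when_def
        vfield_simps weight_def derivation_alongD[OF derivation_vfield])
  have w1: "weight (single 0 (Suc 0)) = monom (1::'a) 2"
    by (simp add: weight_def numeral_2_eq_2)
  have dX: "mflow ?X = single 0 [:[:monom 1 2:]:] * ?X"
    by (rule poly_mapping_eqI) (auto simp: mflow_def lookup_diag[OF derivation_vfield] lookup_single when_def
        mult_single w1 derivation_alongD[OF derivation_vfield] derivation_1[OF derivation_vfield])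
  have "fP vP vM va \<noteq> (0 :: 'a poly poly poly)"
  proof
    assume z: "fP vP vM va = (0 :: 'a poly poly poly)"
    have "ev (\<lambda>c. c) 2 0 1 (fP vP vM va) = fP 2 0 (1::'a)"
      by (simp add: ring_homo_f[OF ring_homo_ev[OF ring_homo_id]] ev_simps[OF ring_homo_id])
    moreover have "fP 2 0 (1::'a) = - 4" by (simp add: fP_def)
    ultimately show False using z by (simp add: ring_homoD(4)[OF ring_homo_ev[OF ring_homo_id]])
  qed
  then have dP0: "mflow ?P \<noteq> 0" unfolding dP by (metis lookup_single_eq lookup_zero)
  have X0: "?X \<noteq> 0" by (metis lookup_single_eq lookup_zero zero_neq_one)
  have "?P \<in> mvars r" by (rule single_in_mvars) simp
  from central[OF this] have "mflow ?P * (meuler p * q - p * meuler q) = 0"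
    by (simp add: mbracket_def wP algebra_simps)
  with dP0 have e: "meuler p * q = p * meuler q" by simp
  have "?X \<in> mvars r" by (rule single_in_mvars) (use r in simp)
  from central[OF this] have "(meuler p * q - p * meuler q) * mflow ?X = ?X * (mflow p * q - p * mflow q)"
    by (simp add: mbracket_def wX[unfolded One_nat_def] algebra_simps)
  with e X0 have "p * mflow q = q * mflow p" by (simp add: mult.commute)
  from mflow_no_first_integral[OF this q] show ?thesis .
qed

lemma closed_under_poly:
  fixes h :: "'a::comm_ring_1 poly \<Rightarrow> 'b::comm_ring_1"
  assumes h: "ring_homo h" and K: "\<And>x y. x \<in> K \<Longrightarrow> y \<in> K \<Longrightarrow> x + y \<in> K \<and> x * y \<in> K"
    and c: "\<And>c. h [:c:] \<in> K" and X: "h [:0, 1:] \<in> K"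
  shows "h p \<in> K"
proof (induct p)
  case 0
  then show ?case using c[of 0] by simp
next
  case (pCons a p)
  have e: "pCons a p = [:a:] + [:0, 1:] * p" by simp
  show ?case unfolding e ring_homoD[OF h] using K c X pCons by blast
qed

lemma mvars_generated:
  assumes K: "\<And>x y. x \<in> K \<Longrightarrow> y \<in> K \<Longrightarrow> x + y \<in> K \<and> x * y \<in> K"
    and c: "\<And>c. mconst c \<in> K" and v: "single 0 va \<in> K" "single 0 vP \<in> K" "single 0 vM \<in> K"
    and X: "\<And>i. i < r \<Longrightarrow> single (single i 1) 1 \<in> K"
  shows "mvars r \<subseteq> K"
proof
  fix f :: "'a mring" assume f: "f \<in> mvars r"
  have h: "ring_homo (\<lambda>b :: 'a poly poly poly. single (0::monomial) b)"
    by (simp add: ring_homo_def single_add mult_single)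
  note h1 = ring_homo_comp[OF h ring_homo_const] 
  note h2 = ring_homo_comp[OF h1 ring_homo_const]
  have 2: "single 0 [:[:e:]:] \<in> K" for e :: "'a poly"
    by (rule closed_under_poly[OF h2 K]) (use c v(1) in \<open>simp_all add: mconst_def va_def\<close>)
  have 1: "single 0 [:t:] \<in> K" for t :: "'a poly poly"
    by (rule closed_under_poly[OF h1 K]) (use 2 v(2) in \<open>simp_all add: vP_def\<close>)
  have B: "single 0 b \<in> K" for b :: "'a poly poly poly"
    by (rule closed_under_poly[OF h K]) (use 1 v(3) in \<open>simp_all add: vM_def\<close>)
  have one: "1 \<in> K" using c[of 1] by (simp add: ring_homoD(1)[OF ring_homo_mconst])
  have m1: "single (m + n) (1 :: 'a poly poly poly) = single m 1 * single n 1" for m n :: monomial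
    by (simp add: mult_single)
  have Xn: "single (single i n) 1 \<in> K" if "i < r" for i n
  proof (induct n)
    case (Suc n)
    have "single i (Suc n) = single i 1 + single i n" by (simp flip: single_add)
    then show ?case using K X[OF that] Suc by (metis m1)
  qed (simp add: one)
  have M: "single m 1 \<in> K" if "keys m \<subseteq> {..<r}" for m
  proof -
    have "single (\<Sum>i\<in>I. single i (lookup m i)) 1 \<in> K" if "I \<subseteq> {..<r}" for I
    proof -
      have "finite I" using that by (rule finite_subset) simp
      then show ?thesis using that
      proof (induct I)
        case (insert i I)
        then have "single (single i (lookup m i)) 1 * single (\<Sum>i\<in>I. single i (lookup m i)) 1 \<in> K"
          using K Xn by auto
        then show ?case using insert by (simp add: m1)
      qed (simp add: one)
    qed
    from this[OF that] show ?thesis by (simp flip: poly_mapping_sum_singles)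
  qed
  have "(\<Sum>k\<in>I. single k (lookup f k)) \<in> K" if "I \<subseteq> keys f" for I
  proof -
    have "finite I" using that by (rule finite_subset) simp
    then show ?thesis using that
    proof (induct I)
      case empty
      then show ?case using c[of 0] by (simp add: ring_homoD(4)[OF ring_homo_mconst])
    next
      case (insert k I)
      then have "keys k \<subseteq> {..<r}" using f by (auto simp: mvars_def)
      from K[OF B M[OF this]] have "single k (lookup f k) \<in> K" by (simp add: mult_single)
      then show ?case using insert K by simp
    qed
  qed
  from this[of "keys f"] show "f \<in> K" by (simp flip: poly_mapping_sum_singles)
qed

section \<open>Krull dimension\<close>

lemma linear_dependence:
  fixes v :: "'i \<Rightarrow> 'j \<Rightarrow> 'k::field"
  assumes "finite J" "finite I" "card J < card I"
  shows "\<exists>c. (\<exists>i\<in>I. c i \<noteq> 0) \<and> (\<forall>j\<in>J. (\<Sum>i\<in>I. c i * v i j) = 0)"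
  using assms
proof (induct J arbitrary: I v rule: finite_induct)
  case empty
  then have "I \<noteq> {}" by auto
  then show ?case by (intro exI[of _ "\<lambda>_. 1"]) auto
next
  case (insert j J)
  show ?case
  proof (cases "\<forall>i\<in>I. v i j = 0")
    case True
    from insert have "card J < card I" by simp
    from insert.hyps(3)[OF insert.prems(1) this, of v] obtain c where
      "\<exists>i\<in>I. c i \<noteq> 0" "\<forall>j\<in>J. (\<Sum>i\<in>I. c i * v i j) = 0" by blast
    with True show ?thesis by (intro exI[of _ c]) auto
  next
    case False
    then obtain i0 where i0: "i0 \<in> I" "v i0 j \<noteq> 0" by blast
    define I' where "I' = I - {i0}"
    have fin: "finite I'" and card: "card J < card I'"
      using insert i0 by (auto simp: I'_def)
    have I: "I = insert i0 I'" "i0 \<notin> I'" using i0 by (auto simp: I'_def)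
    from insert.hyps(3)[OF fin card, of "\<lambda>i j'. v i j' - v i j / v i0 j * v i0 j'"] obtain c where
      c: "\<exists>i\<in>I'. c i \<noteq> 0" "\<And>j'. j' \<in> J \<Longrightarrow> (\<Sum>i\<in>I'. c i * (v i j' - v i j / v i0 j * v i0 j')) = 0" by blast
    define s where "s = (\<Sum>i\<in>I'. c i * v i j)"
    \<comment> \<open>The pivot receives the coefficient that makes the entry at j cancel; at the
      other indices the induction already works with the reduced vectors.\<close>
    define c' where "c' = c(i0 := - s / v i0 j)"
    have sum: "(\<Sum>i\<in>I. c' i * v i j') = (\<Sum>i\<in>I'. c i * v i j') - s / v i0 j * v i0 j'" for j'
    proof -
      have "(\<Sum>i\<in>I'. c' i * v i j') = (\<Sum>i\<in>I'. c i * v i j')"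
        by (rule sum.cong) (use I(2) in \<open>auto simp: c'_def\<close>)
      then show ?thesis using I fin by (simp add: c'_def)
    qed
    have "(\<Sum>i\<in>I. c' i * v i j') = 0" if "j' \<in> insert j J" for j'
    proof (cases "j' = j")
      case True
      then show ?thesis using i0 unfolding sum by (simp add: s_def)
    next
      case False
      with that have "0 = (\<Sum>i\<in>I'. c i * (v i j' - v i j / v i0 j * v i0 j'))" using c(2) by simp
      also have "\<dots> = (\<Sum>i\<in>I'. c i * v i j' - c i * v i j * (v i0 j' / v i0 j))"
        by (rule sum.cong) (simp_all add: algebra_simps)
      also have "\<dots> = (\<Sum>i\<in>I'. c i * v i j') - s / v i0 j * v i0 j'"
        unfolding sum_subtractf s_def sum_distrib_right[symmetric] by simp
      finally show ?thesis unfolding sum by simp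
    qed
    moreover have "\<exists>i\<in>I. c' i \<noteq> 0" using c(1) I by (auto simp: c'_def)
    ultimately show ?thesis by blast
  qed
qed

text \<open>A chain of primes is remembered through one element of each step, lying in the next
  prime but not in the present one. These elements turn out to be algebraically independent.\<close>

fun prime_flag :: "'a::comm_ring_1 set \<Rightarrow> 'a set \<Rightarrow> 'a list \<Rightarrow> bool" where
  "prime_flag S P [] \<longleftrightarrow> prime_in S P"
| "prime_flag S P (x # xs) \<longleftrightarrow> prime_in S P \<and> x \<in> S \<and> x \<notin> P \<and> (\<exists>P'. P \<subseteq> P' \<and> x \<in> P' \<and> prime_flag S P' xs)"

fun list_monomial :: "'a::comm_ring_1 list \<Rightarrow> nat list \<Rightarrow> 'a" where
  "list_monomial (x # xs) (a # as) = x ^ a * list_monomial xs as"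
| "list_monomial _ _ = 1"

definition exponents :: "nat \<Rightarrow> nat \<Rightarrow> nat list set" where
  "exponents n N = {as. set as \<subseteq> {..N} \<and> length as = n}"

lemma card_exponents: "card (exponents n N) = (N + 1) ^ n" "finite (exponents n N)"
  unfolding exponents_def using card_lists_length_eq[of "{..N}" n] finite_lists_length_eq[of "{..N}" n] by auto

lemma sum_exponents_Suc:
  "(\<Sum>as\<in>exponents (Suc n) N. f as) = (\<Sum>a\<le>N. \<Sum>as\<in>exponents n N. f (a # as))"
proof -
  have "exponents (Suc n) N = (\<lambda>(a, as). a # as) ` ({..N} \<times> exponents n N)"
    by (auto simp: exponents_def length_Suc_conv image_iff)
  moreover have "inj_on (\<lambda>(a, as). a # as) ({..N} \<times> exponents n N)" by (auto simp: inj_on_def)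
  ultimately have "(\<Sum>as\<in>exponents (Suc n) N. f as) = (\<Sum>(a, as)\<in>{..N} \<times> exponents n N. f (a # as))"
    by (simp add: sum.reindex case_prod_unfold)
  then show ?thesis by (simp add: sum.cartesian_product)
qed

lemma list_monomial_in: "subring_in S \<Longrightarrow> set xs \<subseteq> S \<Longrightarrow> list_monomial xs as \<in> S"
  by (induct xs as rule: list_monomial.induct) (auto intro!: subring_inD)

lemma prime_flag_subset: "prime_flag S P xs \<Longrightarrow> set xs \<subseteq> S"
  by (induct S P xs rule: prime_flag.induct) auto

lemma prime_flag_prime: "prime_flag S P xs \<Longrightarrow> prime_in S P"
  by (cases xs) auto

lemma prime_in_power_cancel:
  assumes P: "prime_in S P" and S: "subring_in S" and x: "x \<in> S" "x \<notin> P" and y: "y \<in> S"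
  shows "x ^ n * y \<in> P \<Longrightarrow> y \<in> P"
proof (induct n)
  case (Suc n)
  have "x * (x ^ n * y) \<in> P" using Suc.prems by (simp add: mult.assoc)
  moreover have "x ^ n * y \<in> S" using S x y by (intro subring_inD(4,7))
  ultimately have "x ^ n * y \<in> P" using P x unfolding prime_in_def by blast
  then show ?case by (rule Suc.hyps)
qed simp

text \<open>In a relation, the lowest power of the first element cancels modulo P; what is left is a relation
  between the remaining elements modulo the next prime.\<close>

lemma prime_flag_independent:
  fixes \<iota> :: "'k::field \<Rightarrow> 'a::comm_ring_1"
  assumes S: "subring_in S" and \<iota>: "ring_homo \<iota>" "\<And>c. \<iota> c \<in> S"
  shows "prime_flag S P xs \<Longrightarrow> (\<Sum>as\<in>exponents (length xs) N. \<iota> (c as) * list_monomial xs as) \<in> P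
    \<Longrightarrow> as \<in> exponents (length xs) N \<Longrightarrow> c as = 0"
proof (induct xs arbitrary: P c as)
  case Nil
  have e: "exponents 0 N = {[]}" by (auto simp: exponents_def)
  show ?case
  proof (rule ccontr)
    assume "c as \<noteq> 0"
    with Nil e have "\<iota> (inverse (c [])) * \<iota> (c []) = 1" by (simp add: ring_homoD(1)[OF \<iota>(1)] flip: ring_homoD(3)[OF \<iota>(1)])
    moreover have "\<iota> (c []) \<in> P" using Nil e by simp
    ultimately have "1 \<in> P" using Nil.prems(1) \<iota>(2) unfolding prime_flag.simps prime_in_def by metis
    then show False using Nil.prems(1) by (simp add: prime_in_def)
  qed
next
  case (Cons x xs)
  let ?E = "exponents (length xs) N"
  define g where "g a = (\<Sum>as\<in>?E. \<iota> (c (a # as)) * list_monomial xs as)" for a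
  from Cons.prems(1) obtain P' where P': "P \<subseteq> P'" "x \<in> P'" "prime_flag S P' xs"
    and P: "prime_in S P" and x: "x \<in> S" "x \<notin> P" by auto
  note pP' = prime_flag_prime[OF P'(3)]
  have gS: "g a \<in> S" for a
    unfolding g_def by (intro subring_inD(8,4)[OF S] \<iota> list_monomial_in[OF S] prime_flag_subset[OF P'(3)])
  have total: "(\<Sum>a\<le>N. x ^ a * g a) \<in> P"
    using Cons.prems(2) by (simp add: sum_exponents_Suc g_def sum_distrib_left mult_ac)
  have "\<forall>as\<in>?E. c (a # as) = 0" if "a \<le> N" for a
    using that
  proof (induct a rule: less_induct)
    case (less a)
    define y where "y = (\<Sum>b\<in>{a<..N}. x ^ (b - a - 1) * g b)"
    have yS: "y \<in> S" unfolding y_def by (intro subring_inD(8,4,7)[OF S] x gS)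
    have "g b = 0" if "b < a" for b
      using less.hyps[OF that] that less.prems by (simp add: g_def ring_homoD(4)[OF \<iota>(1)])
    then have "(\<Sum>b\<le>N. x ^ b * g b) = (\<Sum>b\<in>{a..N}. x ^ b * g b)"
      by (intro sum.mono_neutral_right) auto
    also have "{a..N} = insert a {a<..N}" using less.prems by auto
    also have "(\<Sum>b\<in>insert a {a<..N}. x ^ b * g b) = x ^ a * g a + (\<Sum>b\<in>{a<..N}. x ^ b * g b)" by simp
    also have "(\<Sum>b\<in>{a<..N}. x ^ b * g b) = (\<Sum>b\<in>{a<..N}. x ^ a * (x * (x ^ (b - a - 1) * g b)))"
    proof (rule sum.cong[OF refl])
      fix b assume "b \<in> {a<..N}"
      then have "b = a + Suc (b - a - 1)" by auto
      then have "x ^ b = x ^ a * (x * x ^ (b - a - 1))" by (metis power_Suc power_add)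
      then show "x ^ b * g b = x ^ a * (x * (x ^ (b - a - 1) * g b))" by (simp only: mult.assoc)
    qed
    also have "x ^ a * g a + \<dots> = x ^ a * (g a + x * y)"
      by (simp add: y_def distrib_left sum_distrib_left)
    finally have "x ^ a * (g a + x * y) \<in> P" using total by simp
    then have "g a + x * y \<in> P"
      by (rule prime_in_power_cancel[OF P S x, rotated]) (intro subring_inD(3,4)[OF S] gS x yS)
    then have "g a + x * y \<in> P'" using P' by blast
    moreover have "(- y) * x \<in> P'" using pP' P'(2) subring_inD(5)[OF S yS] unfolding prime_in_def by blast
    ultimately have "(g a + x * y) + (- y) * x \<in> P'" using pP' unfolding prime_in_def by blast
    then have "g a \<in> P'" by (simp add: mult.commute)
    then show ?case using Cons.hyps[OF P'(3), of "\<lambda>as. c (a # as)"] by (auto simp: g_def)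
  qed
  moreover from Cons.prems(3) obtain b bs where "as = b # bs" "b \<le> N" "bs \<in> ?E"
    by (cases as) (auto simp: exponents_def)
  ultimately show ?case by blast
qed

lemma prime_flag_of_chain:
  assumes "\<And>i. i \<le> n \<Longrightarrow> prime_in S (P i)" "\<And>i. i < n \<Longrightarrow> P i \<subset> P (Suc i)"
  shows "\<exists>xs. length xs = n \<and> prime_flag S (P 0) xs"
  using assms
proof (induct n arbitrary: P)
  case (Suc n)
  from Suc.hyps[of "\<lambda>i. P (Suc i)"] Suc.prems obtain xs where
    xs: "length xs = n" "prime_flag S (P (Suc 0)) xs" by auto
  from Suc.prems(2)[of 0] obtain x where x: "x \<in> P (Suc 0)" "x \<notin> P 0" and s: "P 0 \<subseteq> P (Suc 0)" by auto
  have "x \<in> S" using Suc.prems(1)[of "Suc 0"] x by (auto simp: prime_in_def)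
  then have "prime_flag S (P 0) (x # xs)" using xs x s Suc.prems(1)[of 0] by auto
  with xs show ?case by (intro exI[of _ "x # xs"]) simp
qed simp

text \<open>An abstract degree bound: \<open>Q D a\<close> is to be read as a having degree at most
  D. The abstraction lets the bound be passed through the nested polynomial rings one layer at a
  time.\<close>

definition graded :: "(nat \<Rightarrow> 'a::comm_ring_1 \<Rightarrow> bool) \<Rightarrow> bool" where
  "graded Q \<longleftrightarrow> (\<forall>D. Q D 0 \<and> Q D 1) \<and> (\<forall>D a b. Q D a \<longrightarrow> Q D b \<longrightarrow> Q D (a + b)) \<and>
     (\<forall>D E a b. Q D a \<longrightarrow> Q E b \<longrightarrow> Q (D + E) (a * b)) \<and> (\<forall>D E a. Q D a \<longrightarrow> D \<le> E \<longrightarrow> Q E a) \<and>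
     (\<forall>a. \<exists>D. Q D a)"

lemma gradedD:
  assumes "graded Q"
  shows "Q D 0" "Q D 1" "Q D a \<Longrightarrow> Q D b \<Longrightarrow> Q D (a + b)" "Q D a \<Longrightarrow> Q E b \<Longrightarrow> Q (D + E) (a * b)"
    "Q D a \<Longrightarrow> D \<le> E \<Longrightarrow> Q E a" "\<exists>D. Q D a" "(\<And>i. i \<in> I \<Longrightarrow> Q D (f i)) \<Longrightarrow> Q D (sum f I)"
    "Q D a \<Longrightarrow> Q (n * D) (a ^ n)"
proof -
  have 0: "Q D 0" and 1: "Q D 1" and a: "Q D a \<Longrightarrow> Q D b \<Longrightarrow> Q D (a + b)"
    and m: "Q D a \<Longrightarrow> Q E b \<Longrightarrow> Q (D + E) (a * b)" for D E a b
    using assms unfolding graded_def by blast+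
  show "Q D 0" "Q D 1" "Q D a \<Longrightarrow> Q D b \<Longrightarrow> Q D (a + b)" "Q D a \<Longrightarrow> Q E b \<Longrightarrow> Q (D + E) (a * b)"
    "Q D a \<Longrightarrow> D \<le> E \<Longrightarrow> Q E a" "\<exists>D. Q D a"
    using assms unfolding graded_def by blast+
  show "(\<And>i. i \<in> I \<Longrightarrow> Q D (f i)) \<Longrightarrow> Q D (sum f I)"
    by (induct I rule: infinite_finite_induct) (simp_all add: 0 a)
  show "Q D a \<Longrightarrow> Q (n * D) (a ^ n)" by (induct n) (simp_all add: 1 m)
qed

text \<open>One number bounds the degree in every variable separately, so that the admissible
  exponents form a box whose points are easy to count.\<close>

definition poly_bound :: "(nat \<Rightarrow> 'a::comm_ring_1 \<Rightarrow> bool) \<Rightarrow> nat \<Rightarrow> 'a poly \<Rightarrow> bool" where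
  "poly_bound Q D p \<longleftrightarrow> degree p \<le> D \<and> (\<forall>i. Q D (coeff p i))"

lemma graded_poly_bound:
  assumes Q: "graded Q" shows "graded (poly_bound Q)"
  unfolding graded_def
proof (intro conjI allI impI)
  note q = gradedD[OF Q]
  show "poly_bound Q D 0" "poly_bound Q D 1" for D
    by (simp_all add: poly_bound_def q coeff_pCons one_pCons split: nat.split)
  show "poly_bound Q D (a + b)" if "poly_bound Q D a" "poly_bound Q D b" for D a b
    using that by (auto simp: poly_bound_def q intro: degree_add_le)
  show "poly_bound Q E a" if "poly_bound Q D a" "D \<le> E" for D E a
    using that q(5) unfolding poly_bound_def by (meson le_trans)
  show "poly_bound Q (D + E) (a * b)" if "poly_bound Q D a" "poly_bound Q E b" for D E a b
    using that degree_mult_le[of a b] by (auto simp: poly_bound_def coeff_mult intro!: q(7) q(4))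
  show "\<exists>D. poly_bound Q D p" for p
  proof (induct p)
    case 0
    then show ?case by (auto simp: poly_bound_def q)
  next
    case (pCons c p)
    then obtain D where D: "poly_bound Q D p" by blast
    obtain E where E: "Q E c" using q(6) by blast
    have "degree (pCons c p) \<le> Suc (D + E)" using D degree_pCons_le[of c p] by (simp add: poly_bound_def)
    moreover have "Q (Suc (D + E)) (coeff (pCons c p) i)" for i
      using D q(5)[OF E, of "Suc (D + E)"] q(5)[of D _ "Suc (D + E)"]
      by (auto simp: poly_bound_def coeff_pCons split: nat.split)
    ultimately show ?case unfolding poly_bound_def by blast
  qed
qed

definition mring_bound :: "nat \<Rightarrow> 'k::field_char_0 mring \<Rightarrow> bool" where
  "mring_bound D f \<longleftrightarrow> (\<forall>m\<in>keys f. (\<forall>i. lookup m i \<le> D) \<and>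
     poly_bound (poly_bound (poly_bound (\<lambda>_ _. True))) D (lookup f m))"

lemma graded_mring_bound: "graded mring_bound"
  unfolding graded_def
proof (intro conjI allI impI)
  let ?Q = "poly_bound (poly_bound (poly_bound (\<lambda>_ _. True))) :: nat \<Rightarrow> 'a poly poly poly \<Rightarrow> bool"
  have "graded (\<lambda>(_::nat) (_::'a). True)" by (simp add: graded_def)
  then have "graded ?Q" by (intro graded_poly_bound)
  note q = gradedD[OF this]
  show "mring_bound D 0" "mring_bound D (1 :: 'a mring)" for D
    by (simp_all add: mring_bound_def q)
  show add: "mring_bound D (a + b)" if "mring_bound D a" "mring_bound D b" for D and a b :: "'a mring"
    unfolding mring_bound_def
  proof
    fix m assume "m \<in> keys (a + b)"
    then have "m \<in> keys a \<or> m \<in> keys b" using keys_add[of a b] by blast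
    moreover have "?Q D (lookup f m)" if "mring_bound D f" for f
      using that by (cases "m \<in> keys f") (auto simp: mring_bound_def in_keys_iff q)
    ultimately show "(\<forall>i. lookup m i \<le> D) \<and> ?Q D (lookup (a + b) m)"
      using that by (auto simp: mring_bound_def lookup_add q)
  qed
  have s: "mring_bound D (single m b)" if "\<And>i. lookup m i \<le> D" "?Q D b" for D m b
    using that by (simp add: mring_bound_def)
  have sum: "mring_bound D (sum f I)" if "\<And>i. i \<in> I \<Longrightarrow> mring_bound D (f i)" for D I and f :: "monomial \<Rightarrow> 'a mring"
    using that by (induct I rule: infinite_finite_induct) (auto simp: mring_bound_def[of D 0] intro: add)
  show "mring_bound E a" if "mring_bound D a" "D \<le> E" for D E and a :: "'a mring"
    using that q(5) unfolding mring_bound_def by (meson le_trans)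
  show "mring_bound (D + E) (a * b)" if "mring_bound D a" "mring_bound E b" for D E and a b :: "'a mring"
  proof -
    have "a * b = (\<Sum>k\<in>keys a. \<Sum>l\<in>keys b. single (k + l) (lookup a k * lookup b l))"
      using arg_cong2[where f = "(*)", OF poly_mapping_sum_singles[of a] poly_mapping_sum_singles[of b]]
      by (simp only: sum_product mult_single)
    then show ?thesis
      using that by (auto simp: mring_bound_def[of D a] mring_bound_def[of E b] lookup_add
          intro!: sum s q(4) add_mono)
  qed
  show "\<exists>D. mring_bound D f" for f :: "'a mring"
  proof (induct f rule: poly_mapping_add_induct)
    case (single m b)
    obtain E where E: "?Q E b" using q(6) by blast
    have "lookup m i \<le> sum (lookup m) (keys m)" for i
      by (cases "i \<in> keys m") (auto simp: in_keys_iff intro: member_le_sum)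
    then have "mring_bound (sum (lookup m) (keys m) + E) (single m b)"
      using q(5)[OF E, of "sum (lookup m) (keys m) + E"] by (intro s) (auto intro: trans_le_add1)
    then show ?case by blast
  next
    case (add f g)
    then obtain D E where "mring_bound D f" "mring_bound E g" by blast
    then have "mring_bound (D + E) f" "mring_bound (D + E) g"
      using q(5) unfolding mring_bound_def by (meson le_add1 le_add2 le_trans)+
    then show ?case using \<open>\<And>D a b. mring_bound D a \<Longrightarrow> mring_bound D b \<Longrightarrow> mring_bound D (a + b)\<close> by blast
  qed
qed

definition mcoeff :: "'k::field_char_0 mring \<Rightarrow> monomial \<times> nat \<times> nat \<times> nat \<Rightarrow> 'k" where
  "mcoeff f = (\<lambda>(m, i, j, l). coeff (coeff (coeff (lookup f m) i) j) l)"

lemma mcoeff_inject: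
  assumes "\<And>x. mcoeff f x = mcoeff g x" shows "f = g"
proof (rule poly_mapping_eqI, rule poly_eqI, rule poly_eqI, rule poly_eqI)
  fix m i j l
  show "coeff (coeff (coeff (lookup f m) i) j) l = coeff (coeff (coeff (lookup g m) i) j) l"
    using assms[of "(m, i, j, l)"] by (simp add: mcoeff_def)
qed

lemma mcoeff_linear: "mcoeff (\<Sum>i\<in>I. mconst (c i) * f i) x = (\<Sum>i\<in>I. c i * mcoeff (f i) x)"
  by (induct I rule: infinite_finite_induct)
    (auto simp: mcoeff_def lookup_add lookup_mconst_mult split: prod.splits)

definition exponent_box :: "nat \<Rightarrow> nat \<Rightarrow> (monomial \<times> nat \<times> nat \<times> nat) set" where
  "exponent_box r D = {m. keys m \<subseteq> {..<r} \<and> (\<forall>i. lookup m i \<le> D)} \<times> {..D} \<times> {..D} \<times> {..D}"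

lemma mcoeff_support:
  assumes "f \<in> mvars r" "mring_bound D f" "x \<notin> exponent_box r D" shows "mcoeff f x = 0"
proof (rule ccontr)
  obtain m i j l where x: "x = (m, i, j, l)" by (cases x)
  assume nz: "mcoeff f x \<noteq> 0"
  then have "m \<in> keys f" by (auto simp: mcoeff_def x in_keys_iff)
  with assms have "keys m \<subseteq> {..<r}" "\<And>i. lookup m i \<le> D"
    and b: "poly_bound (poly_bound (poly_bound (\<lambda>_ _. True))) D (lookup f m)"
    by (auto simp: mvars_def mring_bound_def)
  moreover have "coeff (lookup f m) i \<noteq> 0" "coeff (coeff (lookup f m) i) j \<noteq> 0"
    using nz by (auto simp: mcoeff_def x)
  then have "i \<le> D" "j \<le> D" "l \<le> D"
    using b nz le_degree[of "lookup f m" i] le_degree[of "coeff (lookup f m) i" j]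
      le_degree[of "coeff (coeff (lookup f m) i) j" l]
    by (auto simp: poly_bound_def mcoeff_def x intro: le_trans)
  ultimately show False using assms(3) by (simp add: exponent_box_def x)
qed

lemma card_exponent_box: "finite (exponent_box r D) \<and> card (exponent_box r D) \<le> (D + 1) ^ (r + 3)"
proof -
  let ?M = "{m. keys m \<subseteq> {..<r} \<and> (\<forall>i. lookup m i \<le> D)} :: monomial set"
  have inj: "inj_on (\<lambda>m. map (lookup m) [0..<r]) ?M"
  proof (rule inj_onI, rule poly_mapping_eqI)
    fix m n i assume mn: "m \<in> ?M" "n \<in> ?M" "map (lookup m) [0..<r] = map (lookup n) [0..<r]"
    show "lookup m i = lookup n i"
    proof (cases "i < r")
      case True
      then show ?thesis using mn(3) by auto
    next
      case False
      then have "i \<notin> keys m" "i \<notin> keys n" using mn(1,2) by auto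
      then show ?thesis by (simp add: in_keys_iff)
    qed
  qed
  have sub: "(\<lambda>m. map (lookup m) [0..<r]) ` ?M \<subseteq> exponents r D" by (auto simp: exponents_def)
  have fin: "finite ?M" by (rule inj_on_finite[OF inj sub]) (rule card_exponents)
  have "card ?M \<le> (D + 1) ^ r"
    using card_inj_on_le[OF inj sub] card_exponents[of r D] by simp
  moreover have "card (exponent_box r D) = card ?M * (D + 1) ^ 3"
    unfolding exponent_box_def card_cartesian_product power3_eq_cube by (simp only: card_atMost Suc_eq_plus1)
  ultimately have "card (exponent_box r D) \<le> (D + 1) ^ (r + 3)"
    unfolding power_add by (simp only: mult_le_mono1)
  moreover have "finite (exponent_box r D)" unfolding exponent_box_def using fin by simp
  ultimately show ?thesis by blast
qed

text \<open>A longer chain would give r + 4 algebraically independent elements. Their monomials with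
  exponents up to N number (N + 1)^(r + 4), yet they lie in a space of dimension at most (C N +
  1)^(r + 3), so for large N they satisfy a linear relation.\<close>

lemma mvars_no_long_chain:
  assumes P: "\<And>i. i \<le> Suc (r + 3) \<Longrightarrow> prime_in (mvars r) (P i :: 'k::field_char_0 mring set)"
    "\<And>i. i < Suc (r + 3) \<Longrightarrow> P i \<subset> P (Suc i)"
  shows False
proof -
  let ?d = "r + 3"
  obtain xs where xs: "length xs = Suc ?d" "prime_flag (mvars r) (P 0) xs"
    using prime_flag_of_chain[where n = "Suc ?d" and S = "mvars r" and P = P, OF P] by blast
  note g = gradedD[OF graded_mring_bound]
  have "\<exists>D. \<forall>x\<in>set xs. mring_bound D x" for xs :: "'k mring list"
  proof (induct xs)
    case (Cons x xs)
    then obtain D E where "\<forall>x\<in>set xs. mring_bound D x" "mring_bound E x" using g(6) by blast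
    then have "\<forall>y\<in>set (x # xs). mring_bound (D + E) y" using g(5)[of D _ "D + E"] g(5)[of E x "D + E"] by auto
    then show ?case by blast
  qed simp
  then obtain D where D: "\<And>x. x \<in> set xs \<Longrightarrow> mring_bound D x" by blast
  \<comment> \<open>C N bounds the degrees of all these monomials. With d = r + 3 and N = (C + 1)^d
    one gets (C N + 1)^d \<le> ((C + 1) (N + 1))^d = N (N + 1)^d < (N + 1)^(d + 1).\<close>
  define C where "C = Suc ?d * D"
  define N where "N = (C + 1) ^ ?d"
  have bound: "mring_bound (length ys * (N * D)) (list_monomial ys as)"
    if "set ys \<subseteq> set xs" "as \<in> exponents (length ys) N" for ys as
    using that
  proof (induct ys as rule: list_monomial.induct)
    case (1 y ys a as)
    then have a: "a \<le> N" "as \<in> exponents (length ys) N" by (auto simp: exponents_def)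
    have "mring_bound (a * D) (y ^ a)" using 1 by (intro g(8) D) auto
    then have "mring_bound (N * D) (y ^ a)" by (rule g(5)) (use a in simp)
    from g(4)[OF this 1(1)] 1 a show ?case by simp
  qed (auto simp: g)
  let ?E = "exponents (Suc ?d) N" and ?J = "exponent_box r (C * N)"
  have "card ?J \<le> (C * N + 1) ^ ?d" using card_exponent_box by blast
  also have "\<dots> \<le> ((C + 1) * (N + 1)) ^ ?d" by (rule power_mono) simp_all
  also have "\<dots> = N * (N + 1) ^ ?d" by (simp only: power_mult_distrib N_def)
  also have "\<dots> < (N + 1) * (N + 1) ^ ?d" by (rule mult_strict_right_mono) simp_all
  also have "\<dots> = (N + 1) ^ Suc ?d" by (simp only: power_Suc)
  finally have "card ?J < card ?E" by (simp add: card_exponents)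
  from linear_dependence[OF _ card_exponents(2) this, of "\<lambda>as. mcoeff (list_monomial xs as)"] card_exponent_box
  obtain c where c: "\<exists>as\<in>?E. c as \<noteq> 0"
    "\<And>j. j \<in> ?J \<Longrightarrow> (\<Sum>as\<in>?E. c as * mcoeff (list_monomial xs as) j) = 0" by blast
  have "(\<Sum>as\<in>?E. mconst (c as) * list_monomial xs as) = 0"
  proof (rule mcoeff_inject)
    fix x
    have "(\<Sum>as\<in>?E. c as * mcoeff (list_monomial xs as) x) = 0"
    proof (cases "x \<in> ?J")
      case False
      have "mcoeff (list_monomial xs as) x = 0" if "as \<in> ?E" for as
        by (rule mcoeff_support[OF _ _ False])
          (use list_monomial_in[OF subring_in_mvars prime_flag_subset[OF xs(2)]] bound[of xs as] that xs(1)
            in \<open>simp_all add: C_def mult_ac\<close>)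
      then show ?thesis by simp
    qed (rule c(2))
    then show "mcoeff (\<Sum>as\<in>?E. mconst (c as) * list_monomial xs as) x = mcoeff 0 x"
      by (simp only: mcoeff_linear) (simp add: mcoeff_def split: prod.split)
  qed
  then have "(\<Sum>as\<in>exponents (length xs) N. mconst (c as) * list_monomial xs as) \<in> P 0"
    using prime_flag_prime[OF xs(2)] xs(1) by (simp add: prime_in_def)
  from prime_flag_independent[OF subring_in_mvars ring_homo_mconst mconst_in_mvars xs(2) this] c(1) xs(1)
  show False by auto
qed

lemma keys_add_nat: "keys (m + n :: monomial) = keys m \<union> keys n"
  by (auto simp: in_keys_iff lookup_add)

lemma ring_homo_lookup_0: "ring_homo (\<lambda>f :: 'k::field_char_0 mring. lookup f 0)"
  unfolding ring_homo_def
proof (intro conjI allI)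
  fix f g :: "'k mring"
  have z: "k + l = 0 \<longleftrightarrow> k = 0 \<and> l = 0" for k l :: monomial
    using keys_add_nat[of k l] by (auto simp flip: keys_eq_empty)
  show "lookup (f * g) 0 = lookup f 0 * lookup g 0"
    by (rule poly_mapping_bilinear_eq[where T = "\<lambda>f g. lookup (f * g) 0" and U = "\<lambda>f g. lookup f 0 * lookup g 0"])
      (auto simp: lookup_add algebra_simps mult_single lookup_single when_def z)
qed (simp_all add: lookup_add)

text \<open>The extra variables are set to 0 one after the other, followed by M, P and a; each
  variable itself shows that the inclusion at its step is strict.\<close>

lemma mvars_long_chain:
  "\<exists>P. (\<forall>i\<le>r + 3. prime_in (mvars r) (P i :: 'k::field_char_0 mring set)) \<and> (\<forall>i<r + 3. P i \<subset> P (Suc i))"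
proof -
  define \<rho> where "\<rho> i = mapp (\<lambda>(m::monomial) (b :: 'k poly poly poly). if keys m \<inter> {..<i} = {} then b else 0)" for i
  have h: "ring_homo (\<rho> i)" for i
    unfolding \<rho>_def by (rule ring_homo_mapp) (auto simp: keys_add_nat)
  have \<rho>0: "\<rho> i f = 0 \<longleftrightarrow> (\<forall>m. keys m \<inter> {..<i} = {} \<longrightarrow> lookup f m = 0)" for i f
    by (auto simp: \<rho>_def poly_mapping_eq_iff fun_eq_iff lookup_mapp_0)
  define P where "P i = (if i \<le> r then {f \<in> mvars r. \<rho> i f = 0}
      else if i = r + 1 then {f \<in> mvars r. coeff (lookup f 0) 0 = 0}
      else if i = r + 2 then {f \<in> mvars r. coeff (coeff (lookup f 0) 0) 0 = 0}
      else {f \<in> mvars r. coeff (coeff (coeff (lookup f 0) 0) 0) 0 = 0})" for i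
  note c0 = ring_homo_coeff_0
  note h1 = ring_homo_comp[OF c0 ring_homo_lookup_0]
  note h2 = ring_homo_comp[OF c0 h1]
  note h3 = ring_homo_comp[OF c0 h2]
  have "prime_in (mvars r) (P i)" for i
    unfolding P_def
    by (auto intro: prime_in_kernel[OF subring_in_mvars h] prime_in_kernel[OF subring_in_mvars h1]
        prime_in_kernel[OF subring_in_mvars h2] prime_in_kernel[OF subring_in_mvars h3])
  moreover have "P i \<subset> P (Suc i)" if "i < r + 3" for i
  proof -
    from that consider "i < r" | "i = r" | "i = r + 1" | "i = r + 2" by linarith
    then show ?thesis
    proof cases
      case 1
      have "P i \<subseteq> P (Suc i)" using 1 by (auto simp: P_def \<rho>0 lessThan_Suc)
      moreover have "single (single i 1) 1 \<in> P (Suc i)"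
        using 1 by (auto simp: P_def \<rho>0 lookup_single when_def intro: single_in_mvars)
      moreover have "single (single i 1) 1 \<notin> P i"
        using 1 by (auto simp: P_def \<rho>0 intro!: exI[of _ "single i 1"])
      ultimately show ?thesis by blast
    next
      case 2
      have "P i \<subseteq> P (Suc i)" using 2 by (auto simp: P_def \<rho>0)
      moreover have "single 0 vM \<in> P (Suc i)" "single 0 vM \<notin> P i"
        using 2 by (auto simp: P_def \<rho>0 vM_def intro: single_in_mvars intro!: exI[of _ 0])
      ultimately show ?thesis by blast
    next
      case 3
      have "P i \<subseteq> P (Suc i)" using 3 by (auto simp: P_def)
      moreover have "single 0 vP \<in> P (Suc i)" "single 0 vP \<notin> P i"
        using 3 by (auto simp: P_def vP_def intro: single_in_mvars)
      ultimately show ?thesis by blast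
    next
      case 4
      have "P i \<subseteq> P (Suc i)" using 4 by (auto simp: P_def)
      moreover have "single 0 va \<in> P (Suc i)" "single 0 va \<notin> P i"
        using 4 by (auto simp: P_def va_def intro: single_in_mvars)
      ultimately show ?thesis by blast
    qed
  qed
  ultimately show ?thesis by blast
qed

text \<open>The theorem asks for a carrier inside \<open>nat \<Rightarrow> 'k\<close>, whereas the
  algebra lives in a nested polynomial type. The structure is carried over along an
  injection.\<close>

definition transport :: "('a \<Rightarrow> 'b) \<Rightarrow> 'a::comm_ring_1 set \<Rightarrow> 'b ring" where
  "transport \<phi> S = \<lparr>carrier = \<phi> ` S,
     monoid.mult = (\<lambda>x y. \<phi> (inv_into S \<phi> x * inv_into S \<phi> y)), one = \<phi> 1,
     zero = \<phi> 0, add = (\<lambda>x y. \<phi> (inv_into S \<phi> x + inv_into S \<phi> y))\<rparr>"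

locale transported =
  fixes \<phi> :: "'a::idom \<Rightarrow> 'b" and S :: "'a set"
  assumes inj: "inj_on \<phi> S" and S: "subring_in S"
begin

abbreviation "T \<equiv> transport \<phi> S"

lemmas S_closed = subring_inD[OF S]

lemma inv: "x \<in> S \<Longrightarrow> inv_into S \<phi> (\<phi> x) = x"
  by (rule inv_into_f_f[OF inj])

lemma eq: "x \<in> S \<Longrightarrow> y \<in> S \<Longrightarrow> \<phi> x = \<phi> y \<longleftrightarrow> x = y"
  using inj by (auto simp: inj_on_def)

lemma T_simps:
  "carrier T = \<phi> ` S" "\<one>\<^bsub>T\<^esub> = \<phi> 1" "\<zero>\<^bsub>T\<^esub> = \<phi> 0"
  "x \<in> S \<Longrightarrow> y \<in> S \<Longrightarrow> \<phi> x \<otimes>\<^bsub>T\<^esub> \<phi> y = \<phi> (x * y)"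
  "x \<in> S \<Longrightarrow> y \<in> S \<Longrightarrow> \<phi> x \<oplus>\<^bsub>T\<^esub> \<phi> y = \<phi> (x + y)"
  by (simp_all add: transport_def inv)

lemma cring_T: "cring T"
proof (rule cringI)
  show "abelian_group T"
  proof (rule abelian_groupI)
    fix x assume "x \<in> carrier T"
    then obtain x' where "x' \<in> S" "x = \<phi> x'" by (auto simp: T_simps)
    then show "\<exists>y\<in>carrier T. y \<oplus>\<^bsub>T\<^esub> x = \<zero>\<^bsub>T\<^esub>"
      by (intro bexI[of _ "\<phi> (- x')"]) (auto simp: T_simps S_closed)
  qed (auto simp: T_simps S_closed add_ac)
  show "comm_monoid T"
    by (rule comm_monoidI) (auto simp: T_simps S_closed mult_ac)
qed (auto simp: T_simps S_closed algebra_simps)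

sublocale T: cring T by (rule cring_T)

lemma domain_T: "domain T"
proof (rule domain.intro[OF cring_T], unfold_locales)
  show "\<one>\<^bsub>T\<^esub> \<noteq> \<zero>\<^bsub>T\<^esub>" by (simp add: T_simps eq S_closed)
  show "a = \<zero>\<^bsub>T\<^esub> \<or> b = \<zero>\<^bsub>T\<^esub>" if "a \<otimes>\<^bsub>T\<^esub> b = \<zero>\<^bsub>T\<^esub>" "a \<in> carrier T" "b \<in> carrier T" for a b
    using that by (auto simp: T_simps eq S_closed)
qed

lemma T_uminus: "x \<in> S \<Longrightarrow> \<ominus>\<^bsub>T\<^esub> \<phi> x = \<phi> (- x)"
  by (rule T.minus_equality) (simp_all add: T_simps S_closed)

lemma T_minus: "x \<in> S \<Longrightarrow> y \<in> S \<Longrightarrow> \<phi> x \<ominus>\<^bsub>T\<^esub> \<phi> y = \<phi> (x - y)"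
  by (simp add: a_minus_def T_uminus T_simps S_closed)

lemma prime_T: "prime_in S P \<Longrightarrow> primeideal (\<phi> ` P) T"
proof (rule primeidealI)
  assume P: "prime_in S P"
  then have sub: "P \<subseteq> S" by (simp add: prime_in_def)
  then have SP: "x \<in> P \<Longrightarrow> x \<in> S" for x by blast
  have um: "- x \<in> P" if "x \<in> P" for x
    using P that S_closed(5)[OF S_closed(1)] unfolding prime_in_def by (metis mult_minus1)
  show "ideal (\<phi> ` P) T"
  proof (rule idealI)
    show "ring T" by unfold_locales
    show "subgroup (\<phi> ` P) (add_monoid T)"
    proof (rule T.add.subgroupI)
      show "\<phi> ` P \<subseteq> carrier T" using sub by (auto simp: T_simps)
      show "\<phi> ` P \<noteq> {}" using P by (auto simp: prime_in_def)
      show "\<ominus>\<^bsub>T\<^esub> a \<in> \<phi> ` P" if "a \<in> \<phi> ` P" for a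
        using that um SP by (auto simp: T_uminus)
      show "a \<oplus>\<^bsub>T\<^esub> b \<in> \<phi> ` P" if "a \<in> \<phi> ` P" "b \<in> \<phi> ` P" for a b
        using that P SP by (auto simp: T_simps prime_in_def)
    qed
    show "x \<otimes>\<^bsub>T\<^esub> a \<in> \<phi> ` P" "a \<otimes>\<^bsub>T\<^esub> x \<in> \<phi> ` P" if "a \<in> \<phi> ` P" "x \<in> carrier T" for a x
      using that P SP by (auto simp: T_simps prime_in_def mult.commute)
  qed
  show "cring T" by (rule cring_T)
  show "carrier T \<noteq> \<phi> ` P"
  proof
    assume "carrier T = \<phi> ` P"
    then have "\<phi> 1 \<in> \<phi> ` P" by (metis T.one_closed T_simps(2))
    then show False using P SP by (auto simp: prime_in_def eq S_closed)
  qed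
  show "a \<in> \<phi> ` P \<or> b \<in> \<phi> ` P" if ab: "a \<in> carrier T" "b \<in> carrier T" "a \<otimes>\<^bsub>T\<^esub> b \<in> \<phi> ` P" for a b
  proof -
    from ab obtain x y where xy: "x \<in> S" "a = \<phi> x" "y \<in> S" "b = \<phi> y" by (auto simp: T_simps)
    with ab have "\<phi> (x * y) \<in> \<phi> ` P" by (simp add: T_simps)
    then have "x * y \<in> P" using xy SP by (auto simp: eq S_closed)
    then show ?thesis using P xy unfolding prime_in_def by blast
  qed
qed

lemma prime_of_T:
  assumes "primeideal Q T"
  shows "prime_in S {x \<in> S. \<phi> x \<in> Q}" "Q = \<phi> ` {x \<in> S. \<phi> x \<in> Q}"
proof -
  interpret primeideal Q T by (rule assms)
  have sub: "Q \<subseteq> carrier T" by (rule a_subset)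
  then show "Q = \<phi> ` {x \<in> S. \<phi> x \<in> Q}" by (auto simp: T_simps)
  have "\<phi> 1 \<notin> Q"
    using I_notcarr one_imp_carrier by (auto simp: T_simps)
  moreover have "\<phi> 0 \<in> Q" using zero_closed by (simp add: T_simps)
  moreover have "\<phi> (x + y) \<in> Q" if "x \<in> S" "y \<in> S" "\<phi> x \<in> Q" "\<phi> y \<in> Q" for x y
    using a_closed[of "\<phi> x" "\<phi> y"] that by (simp add: T_simps)
  moreover have "\<phi> (s * x) \<in> Q" if "x \<in> S" "s \<in> S" "\<phi> x \<in> Q" for s x
    using I_l_closed[of "\<phi> x" "\<phi> s"] that by (simp add: T_simps)
  moreover have "\<phi> x \<in> Q \<or> \<phi> y \<in> Q" if "x \<in> S" "y \<in> S" "\<phi> (x * y) \<in> Q" for x y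
    using I_prime[of "\<phi> x" "\<phi> y"] that by (simp add: T_simps)
  ultimately show "prime_in S {x \<in> S. \<phi> x \<in> Q}"
    unfolding prime_in_def by (auto simp: S_closed)
qed

lemma krull_dim_T:
  assumes "\<exists>P. (\<forall>i\<le>d. prime_in S (P i)) \<and> (\<forall>i<d. P i \<subset> P (Suc i))"
    and "\<And>P. (\<And>i. i \<le> Suc d \<Longrightarrow> prime_in S (P i)) \<Longrightarrow> (\<And>i. i < Suc d \<Longrightarrow> P i \<subset> P (Suc i)) \<Longrightarrow> False"
  shows "krull_dim_eq T d"
  unfolding krull_dim_eq_def
proof
  from assms(1) obtain P where P: "\<And>i. i \<le> d \<Longrightarrow> prime_in S (P i)" "\<And>i. i < d \<Longrightarrow> P i \<subset> P (Suc i)" by blast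
  have "\<phi> ` P i \<subset> \<phi> ` P (Suc i)" if "i < d" for i
  proof -
    have "P (Suc i) \<subseteq> S" using P(1)[of "Suc i"] that by (simp add: prime_in_def)
    with P(2)[OF that] show ?thesis
      by (metis (no_types, lifting) image_mono inj inj_on_image_eq_iff psubset_eq subset_trans)
  qed
  then show "\<exists>P. prime_chain T d P"
    using P prime_T by (intro exI[of _ "\<lambda>i. \<phi> ` P i"]) (simp add: prime_chain_def)
  show "\<not> (\<exists>P. prime_chain T (Suc d) P)"
  proof
    assume "\<exists>P. prime_chain T (Suc d) P"
    then obtain Q where Q: "\<And>i. i \<le> Suc d \<Longrightarrow> primeideal (Q i) T" "\<And>i. i < Suc d \<Longrightarrow> Q i \<subset> Q (Suc i)"
      unfolding prime_chain_def by blast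
    show False
    proof (rule assms(2)[of "\<lambda>i. {x \<in> S. \<phi> x \<in> Q i}"])
      show "prime_in S {x \<in> S. \<phi> x \<in> Q i}" if "i \<le> Suc d" for i by (rule prime_of_T(1)[OF Q(1)[OF that]])
      show "{x \<in> S. \<phi> x \<in> Q i} \<subset> {x \<in> S. \<phi> x \<in> Q (Suc i)}" if "i < Suc d" for i
      proof -
        have "{x \<in> S. \<phi> x \<in> Q i} \<noteq> {x \<in> S. \<phi> x \<in> Q (Suc i)}"
          using prime_of_T(2)[OF Q(1)[of i]] prime_of_T(2)[OF Q(1)[of "Suc i"]] Q(2)[OF that] that
          by (metis less_imp_le_nat psubset_eq Suc_leI)
        then show ?thesis using Q(2)[OF that] by blast
      qed
    qed
  qed
qed

end

section \<open>Transport and conclusion\<close>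

context transported
begin

lemma T_power: "x \<in> S \<Longrightarrow> \<phi> x [^]\<^bsub>T\<^esub> (n::nat) = \<phi> (x ^ n)"
  by (induct n) (simp_all add: T_simps S_closed mult.commute)

lemma T_finsum: "(\<And>i. g i \<in> S) \<Longrightarrow> finsum T (\<lambda>i. \<phi> (g i)) {..n::nat} = \<phi> (\<Sum>i\<le>n. g i)"
  by (induct n) (simp_all add: T.finsum_Suc Pi_iff T_simps S_closed add.commute)

lemma k_algebra_T:
  assumes "ring_homo \<iota>" "\<And>c. \<iota> c \<in> S"
  shows "k_algebra (\<lambda>c. \<phi> (\<iota> c)) T"
  using assms cring_T by (simp add: k_algebra_def T_simps ring_homoD)

lemma affine_T:
  assumes \<iota>: "ring_homo \<iota>" "\<And>c. \<iota> c \<in> S" and G: "finite G" "G \<subseteq> S"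
    and gen: "\<And>K. (\<And>x y. x \<in> K \<Longrightarrow> y \<in> K \<Longrightarrow> x + y \<in> K \<and> x * y \<in> K) \<Longrightarrow> (\<And>c. \<iota> c \<in> K) \<Longrightarrow> G \<subseteq> K \<Longrightarrow> S \<subseteq> K"
  shows "affine_k_algebra (\<lambda>c. \<phi> (\<iota> c)) T"
  unfolding affine_k_algebra_def
proof (intro conjI exI[of _ "\<phi> ` G"])
  show "k_algebra (\<lambda>c. \<phi> (\<iota> c)) T" by (rule k_algebra_T[OF \<iota>])
  show "domain T" by (rule domain_T)
  show "finite (\<phi> ` G)" "\<phi> ` G \<subseteq> carrier T" using G by (auto simp: T_simps)
  let ?H = "range (\<lambda>c. \<phi> (\<iota> c)) \<union> \<phi> ` G"
  have "S \<subseteq> {x \<in> S. \<phi> x \<in> generate_ring T ?H}"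
  proof (rule gen)
    fix x y assume "x \<in> {x \<in> S. \<phi> x \<in> generate_ring T ?H}" "y \<in> {x \<in> S. \<phi> x \<in> generate_ring T ?H}"
    then have xy: "x \<in> S" "\<phi> x \<in> generate_ring T ?H" "y \<in> S" "\<phi> y \<in> generate_ring T ?H" by auto
    then show "x + y \<in> {x \<in> S. \<phi> x \<in> generate_ring T ?H} \<and> x * y \<in> {x \<in> S. \<phi> x \<in> generate_ring T ?H}"
      using generate_ring.eng_add[OF xy(2,4)] generate_ring.eng_mult[OF xy(2,4)] by (simp add: T_simps S_closed)
  next
    show "\<iota> c \<in> {x \<in> S. \<phi> x \<in> generate_ring T ?H}" for c
      using \<iota>(2) by (auto intro: generate_ring.incl)
    show "G \<subseteq> {x \<in> S. \<phi> x \<in> generate_ring T ?H}"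
      using G by (auto intro: generate_ring.incl)
  qed
  moreover have "generate_ring T ?H \<subseteq> carrier T"
    by (rule T.generate_ring_incl) (use \<iota>(2) G in \<open>auto simp: T_simps\<close>)
  ultimately show "carrier T = generate_ring T ?H" by (auto simp: T_simps)
qed

definition "lift_bracket br = (\<lambda>x y. \<phi> (br (inv_into S \<phi> x) (inv_into S \<phi> y)))"

lemma lift_bracket: "x \<in> S \<Longrightarrow> y \<in> S \<Longrightarrow> lift_bracket br (\<phi> x) (\<phi> y) = \<phi> (br x y)"
  by (simp add: lift_bracket_def inv)

lemma poisson_prime_T:
  assumes "prime_in S P" "\<And>a b. a \<in> P \<Longrightarrow> b \<in> S \<Longrightarrow> br a b \<in> P"
  shows "poisson_prime T (lift_bracket br) (\<phi> ` P)"
  unfolding poisson_prime_def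
proof (intro conjI ballI)
  show "primeideal (\<phi> ` P) T" by (rule prime_T[OF assms(1)])
  show "lift_bracket br a b \<in> \<phi> ` P" if "a \<in> \<phi> ` P" "b \<in> carrier T" for a b
    using that assms by (auto simp: T_simps lift_bracket prime_in_def subset_iff)
qed

end

text \<open>The coefficients are listed along an enumeration of exponents, with monomials coded by
  lists. Lists differing by trailing zeros code the same monomial, so coefficients repeat, but each
  of them occurs and the map is injective.\<close>

definition monomial_coeffs :: "'k::field_char_0 mring \<Rightarrow> nat \<Rightarrow> 'k" where
  "monomial_coeffs f N = (case from_nat N of (as, x) \<Rightarrow> mcoeff f (Poly_Mapping.nth as, x))"

lemma inj_monomial_coeffs: "inj monomial_coeffs"
proof (rule injI, rule mcoeff_inject)
  fix f g :: "'k::field_char_0 mring" and y :: "monomial \<times> nat \<times> nat \<times> nat"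
  assume eq: "monomial_coeffs f = monomial_coeffs g"
  obtain m x where y: "y = (m, x)" by (cases y)
  obtain N where "\<forall>i\<in>keys m. i < N"
    using finite_keys[of m] unfolding finite_nat_set_iff_bounded by blast
  then have N: "keys m \<subseteq> {..<N}" by auto
  have m: "Poly_Mapping.nth (map (lookup m) [0..<N]) = m"
  proof (rule poly_mapping_eqI)
    fix i
    show "lookup (Poly_Mapping.nth (map (lookup m) [0..<N])) i = lookup m i"
      using N by (cases "i < N") (auto simp: nth_default_def in_keys_iff subset_iff)
  qed
  have "monomial_coeffs f (to_nat (map (lookup m) [0..<N], x)) = monomial_coeffs g (to_nat (map (lookup m) [0..<N], x))"
    by (simp add: eq)
  then show "mcoeff f y = mcoeff g y" by (simp add: monomial_coeffs_def m y)
qed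

theorem theorem8p1:
  fixes d :: nat
  assumes "d \<ge> 4"
  shows "\<exists>(\<iota> :: 'k::field_char_0 \<Rightarrow> (nat \<Rightarrow> 'k)) (R :: (nat \<Rightarrow> 'k) ring) br.
           affine_poisson_algebra \<iota> R br \<and> krull_dim_eq R d \<and>
           poisson_prime R br {\<zero>\<^bsub>R\<^esub>} \<and>
           zero_poisson_rational \<iota> R br \<and>
           \<not> poisson_locally_closed R br {\<zero>\<^bsub>R\<^esub>}"
proof -
  \<comment> \<open>The coordinates P, M and a account for three dimensions. The bound on d leaves
    at least one extra variable, the one whose Euler field enters the bracket.\<close>
  define r where "r = d - 3"
  have r: "d = r + 3" "r > 0" using assms by (simp_all add: r_def)
  define S where "S = (mvars r :: 'k mring set)"
  interpret transported monomial_coeffs S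
    by unfold_locales (use inj_monomial_coeffs subring_in_mvars in \<open>auto simp: S_def inj_on_def inj_def\<close>)
  let ?\<phi> = "monomial_coeffs :: 'k mring \<Rightarrow> nat \<Rightarrow> 'k"
  define br where "br = lift_bracket mbracket"
  let ?\<iota> = "\<lambda>c. ?\<phi> (mconst c)"
  have cS: "mconst c \<in> S" for c unfolding S_def by (rule mconst_in_mvars)
  have bS: "x \<in> S \<Longrightarrow> y \<in> S \<Longrightarrow> mbracket x y \<in> S" for x y unfolding S_def by (rule mbracket_in_mvars)
  have br: "x \<in> S \<Longrightarrow> y \<in> S \<Longrightarrow> br (?\<phi> x) (?\<phi> y) = ?\<phi> (mbracket x y)" for x y
    unfolding br_def by (rule lift_bracket)
  note c = ring_homoD[OF ring_homo_mconst]
  let ?G = "{single 0 va, single 0 vP, single 0 vM} \<union> (\<lambda>i. single (single i 1) 1) ` {..<r}"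
  have "affine_k_algebra ?\<iota> T"
  proof (rule affine_T[where G = ?G])
    show "S \<subseteq> K" if "\<And>x y. x \<in> K \<Longrightarrow> y \<in> K \<Longrightarrow> x + y \<in> K \<and> x * y \<in> K" "\<And>c. mconst c \<in> K" "?G \<subseteq> K" for K
      unfolding S_def by (rule mvars_generated) (use that in auto)
    show "?G \<subseteq> S" by (auto simp: S_def intro: single_in_mvars)
  qed (simp_all add: cS ring_homo_mconst)
  moreover have "poisson_bracket ?\<iota> T br"
    unfolding poisson_bracket_def
    by (auto simp: T_simps br bS cS S_closed mbracket_props(1-5,7)) (simp_all add: mbracket_props(6))
  moreover have "krull_dim_eq T d"
    unfolding r(1)
  proof (rule krull_dim_T)
    show "\<exists>P. (\<forall>i\<le>r + 3. prime_in S (P i)) \<and> (\<forall>i<r + 3. P i \<subset> P (Suc i))"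
      unfolding S_def by (rule mvars_long_chain)
    show False if "\<And>i. i \<le> Suc (r + 3) \<Longrightarrow> prime_in S (P i)" "\<And>i. i < Suc (r + 3) \<Longrightarrow> P i \<subset> P (Suc i)" for P
      using that unfolding S_def by (rule mvars_no_long_chain)
  qed
  moreover have pp: "poisson_prime T br {\<zero>\<^bsub>T\<^esub>}"
  proof -
    have "prime_in S {0}" by (auto simp: prime_in_def S_closed)
    moreover have "mbracket 0 b = 0" for b :: "'k mring"
      using mbracket_props(1)[of 0 0 b] by simp
    ultimately show ?thesis
      using poisson_prime_T[of "{0}" mbracket] by (simp add: br_def T_simps)
  qed
  moreover have "zero_poisson_rational ?\<iota> T br"
    unfolding zero_poisson_rational_def
  proof (intro ballI impI)
    fix x y assume "x \<in> carrier T" "y \<in> carrier T - {\<zero>\<^bsub>T\<^esub>}" and fc: "frac_poisson_central T br x y"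
    then obtain p q where p: "p \<in> S" "x = ?\<phi> p" and q: "q \<in> S" "y = ?\<phi> q" "q \<noteq> 0"
      by (auto simp: T_simps)
    have "mbracket p a * q = p * mbracket q a" if a: "a \<in> mvars r" for a
    proof -
      have a: "a \<in> S" using a by (simp add: S_def)
      \<comment> \<open>With denominator 1 the quotient rule in the definition of centrality reduces
        to the bracket with the ring element a.\<close>
      have one: "?\<phi> 1 \<in> carrier T - {\<zero>\<^bsub>T\<^esub>}" by (auto simp: T_simps S_closed eq)
      have "?\<phi> a \<in> carrier T" using a by (simp add: T_simps)
      with fc one have "br x (?\<phi> a) \<otimes>\<^bsub>T\<^esub> y \<otimes>\<^bsub>T\<^esub> ?\<phi> 1 \<ominus>\<^bsub>T\<^esub> x \<otimes>\<^bsub>T\<^esub> br y (?\<phi> a) \<otimes>\<^bsub>T\<^esub> ?\<phi> 1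
        \<ominus>\<^bsub>T\<^esub> y \<otimes>\<^bsub>T\<^esub> br x (?\<phi> 1) \<otimes>\<^bsub>T\<^esub> ?\<phi> a \<oplus>\<^bsub>T\<^esub> x \<otimes>\<^bsub>T\<^esub> br y (?\<phi> 1) \<otimes>\<^bsub>T\<^esub> ?\<phi> a = \<zero>\<^bsub>T\<^esub>"
        unfolding frac_poisson_central_def by blast
      moreover have "mbracket b 1 = 0" for b :: "'k mring"
        by (simp add: mbracket_def derivation_1[OF derivation_mflow] derivation_1[OF derivation_meuler])
      ultimately show ?thesis
        using p q a by (simp add: br T_simps T_minus bS S_closed eq)
    qed
    from mbracket_central[OF q(3) this r(2)] obtain e where e: "p = mconst e * q" by blast
    show "frac_algebraic ?\<iota> T x y"
      unfolding frac_algebraic_def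
    \<comment> \<open>Since p / q is the scalar e, it is a root of the linear polynomial t -
      e.\<close>
    proof (intro exI[of _ "[:- e, 1:]"] conjI)
      have "finsum T (\<lambda>i. ?\<iota> (poly.coeff [:- e, 1:] i) \<otimes>\<^bsub>T\<^esub> (x [^]\<^bsub>T\<^esub> i) \<otimes>\<^bsub>T\<^esub> (y [^]\<^bsub>T\<^esub> (1 - i))) {..1}
        = ?\<phi> (\<Sum>i\<le>1. mconst (poly.coeff [:- e, 1:] i) * p ^ i * q ^ (1 - i))"
        using p q by (subst T_finsum[symmetric]) (simp_all add: T_power T_simps S_closed cS)
      also have "\<dots> = \<zero>\<^bsub>T\<^esub>" by (simp add: T_simps c e)
      finally show "finsum T (\<lambda>i. ?\<iota> (poly.coeff [:- e, 1:] i) \<otimes>\<^bsub>T\<^esub> (x [^]\<^bsub>T\<^esub> i)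
        \<otimes>\<^bsub>T\<^esub> (y [^]\<^bsub>T\<^esub> (Polynomial.degree [:- e, 1:] - i))) {..Polynomial.degree [:- e, 1:]} = \<zero>\<^bsub>T\<^esub>" by simp
    qed simp
  qed
  moreover have "\<not> poisson_locally_closed T br {\<zero>\<^bsub>T\<^esub>}"
  proof
    assume "poisson_locally_closed T br {\<zero>\<^bsub>T\<^esub>}"
    then obtain I J where IJ: "J \<subseteq> carrier T"
      "{{\<zero>\<^bsub>T\<^esub>}} = {Q. poisson_prime T br Q \<and> I \<subseteq> Q \<and> \<not> J \<subseteq> Q}"
      unfolding poisson_locally_closed_def by blast
    \<comment> \<open>Local closedness at (0) forces I to be trivial and J to contain some nonzero
      f. A nonzero Poisson prime avoiding f would then belong to the same set as (0).\<close>
    then have I: "I \<subseteq> {\<zero>\<^bsub>T\<^esub>}" and "\<not> J \<subseteq> {\<zero>\<^bsub>T\<^esub>}" by blast+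
    with IJ(1) obtain f where f: "f \<in> S" "?\<phi> f \<in> J" "f \<noteq> 0" by (auto simp: T_simps)
    from mvars_poisson_primes_dense[OF f(3)] obtain P where P: "prime_in S P"
      "\<And>a b. a \<in> P \<Longrightarrow> b \<in> S \<Longrightarrow> mbracket a b \<in> P" "P \<noteq> {0}" "f \<notin> P"
      unfolding S_def by blast
    have sub: "P \<subseteq> S" "0 \<in> P" using P(1) by (simp_all add: prime_in_def)
    have "poisson_prime T br (?\<phi> ` P)" unfolding br_def using P by (intro poisson_prime_T)
    moreover have "I \<subseteq> ?\<phi> ` P" using I sub by (auto simp: T_simps)
    moreover have "?\<phi> f \<notin> ?\<phi> ` P" using P(4) f sub by (auto simp: eq subset_iff)
    ultimately have "?\<phi> ` P \<in> {Q. poisson_prime T br Q \<and> I \<subseteq> Q \<and> \<not> J \<subseteq> Q}"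
      using f(2) by (auto simp: subset_iff)
    then have "?\<phi> ` P = {\<zero>\<^bsub>T\<^esub>}" unfolding IJ(2)[symmetric] by simp
    moreover obtain g where "g \<in> P" "g \<noteq> 0" using P(3) sub by auto
    ultimately have "?\<phi> g = ?\<phi> 0" by (auto simp: T_simps)
    then show False using \<open>g \<in> P\<close> \<open>g \<noteq> 0\<close> sub by (auto simp: eq subset_iff)
  qed
  ultimately show ?thesis unfolding affine_poisson_algebra_def by blast
qed

end
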